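(* Let $a$ be a non-negative integer and $b\in\mathbb{C}$. Let $M(a,b)$ be the complex vector space of dimension $4(a+1)$ with basis $$F^n\Lambda\ (0\le n\le a),\quad F^nV\Lambda\ (0\le n\le a+1),\quad F^n\omega\ (0\le n\le a-1),\quad F^nVFV\Lambda\ (0\le n\le a),$$ where these are formal symbols, and symbols with $n$ outside the indicated ranges denote $0$. Define linear operators on $M(a,b)$ as follows. (1) $F$ maps $F^n x$ to $F^{n+1}x$, and $E F^n x=n(c_x-n+1)F^{n-1}x$, $H F^n x=(c_x-2n)F^nx$, $Y F^nx=y_xF^nx$, for $x=\Lambda,\ V\Lambda,\ \omega,\ VFV\Lambda$ with $c_x=a,\ a+1,\ a-1,\ a$ and $y_x=2b-a,\ 2b-a-1,\ 2b-a-1,\ 2b-a-2$ respectively. (2) $UF^n\Lambda=0$, $\;UF^nV\Lambda=bF^n\Lambda$, $\;UF^n\omega=(a+1-b)F^{n+1}\Lambda$, $\;UF^nVFV\Lambda=\big(\tfrac{b}{a+1}-1\big)F^{n+1}V\Lambda+\tfrac{b}{a+1}F^n\omega$. (3) $VF^n\Lambda=\big(1-\tfrac{n}{a+1}\big)F^nV\Lambda-\tfrac{n}{a+1}F^{n-1}\omega$, $\;VF^nV\Lambda=nF^{n-1}VFV\Lambda$, $\;VF^n\omega=(a-n)F^nVFV\Lambda$, $\;VF^nVFV\Lambda=0$. (4) $W=[E,U]$ and $X=-[F,V]$. Then these operators define a representation of the Lie superalgebra $SU(2/1)$ on $M(a,b)$. If $b(b-a-1)\neq0$ (typical) it is irreducible.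 If $b=0$ (atypical 1), $V\Lambda$ is a highest weight and the span of the $F^nV\Lambda$ and $F^nVFV\Lambda$ can be quotiented out, leaving an irreducible representation; if $b=a+1$ (atypical 2), $\omega$ is a highest weight and the span of the $F^n\omega$ and $F^nVFV\Lambda$ can be quotiented out, leaving an irreducible representation. Let $R(a,b)$ be the irreducible representation so obtained. All finite dimensional irreducible representations of $SU(2/1)$ are obtained in this way (up to the choice of overall parity). In this basis the even generators are represented by matrices with integer entries, and the odd generators by matrices with entries of the form $(p+qb)/(a+1)$ with $p,q\in\mathbb{Z}$.
   Context: $SU(2/1)$ denotes the complex Lie superalgebra $sl(2/1,\mathbb{C})$ with even generators $F,H,E,Y$ and odd generators $U,V,W,X$ and relations: $[H,E]=2E$, $[H,F]=-2F$, $[E,F]=H$, $Y$ commutes with $E,F,H$; $[H,U]=-U$, $[H,W]=W$, $[H,X]=-X$, $[H,V]=V$; $[Y,U]=U$, $[Y,W]=W$, $[Y,V]=-V$, $[Y,X]=-X$; $[E,U]=W$, $[F,W]=U$, $[E,X]=-V$, $[F,V]=-X$, $[E,V]=[E,W]=[F,U]=[F,X]=0$; $\{U,V\}=\tfrac12(Y+H)$, $\{W,X\}=\tfrac12(Y-H)$, $\{U,X\}=-F$, $\{V,W\}=-E$, $\{U,W\}=\{X,V\}=0$, and $\{Z,Z\}=0$ for $Z=U,V,W,X$. A finite dimensional representation is a $\mathbb{Z}/2$-graded complex vector space with operators satisfying these (anti)commutation relations, even generators preserving and odd generators reversing the grading. On $M(a,b)$ the grading puts $F^n\Lambda$ and $F^nVFV\Lambda$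 in one parity and $F^nV\Lambda$ and $F^n\omega$ in the other. Here $\Lambda$ is the highest weight vector: $H\Lambda=a\Lambda$, $\tfrac12(Y+H)\Lambda=b\Lambda$, $E\Lambda=U\Lambda=0$, and $\omega$ stands for $(aFV-(a+1)VF)\Lambda$.
   Formalization: Integer matrices are claimed for F, H, E; since Y has eigenvalues such as 2b−a, its entries are claimed to be p+qb with p, q integers, and integers whenever 2b is an integer. That ω is a highest weight when b=a+1 is claimed only for a≥1, as ω=0 when a=0. *)

theory Defs
  imports Complex_Main "HOL-Algebra.AbelCoset" "Jordan_Normal_Form.VS_Connect"
begin

abbreviation \<CC> :: "complex ring" where
  "\<CC> \<equiv> class_ring"

section \<open>Representations of the Lie superalgebra \<open>SU(2/1) = sl(2|1)\<close>\<close>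

datatype gen = gF | gH | gE | gY | gU | gV | gW | gX

definition even_gens :: "gen set" where
  "even_gens = {gF, gH, gE, gY}"

definition odd_gens :: "gen set" where
  "odd_gens = {gU, gV, gW, gX}"

record 'v superrep = "(complex, 'v) module" +
  even_part :: "'v set"
  odd_part :: "'v set"
  act :: "gen \<Rightarrow> 'v \<Rightarrow> 'v"

definition comm :: "'v superrep \<Rightarrow> gen \<Rightarrow> gen \<Rightarrow> 'v \<Rightarrow> 'v" where
  "comm R g h v = act R g (act R h v) \<ominus>\<^bsub>R\<^esub> act R h (act R g v)"

definition acomm :: "'v superrep \<Rightarrow> gen \<Rightarrow> gen \<Rightarrow> 'v \<Rightarrow> 'v" where
  "acomm R g h v = act R g (act R h v) \<oplus>\<^bsub>R\<^esub> act R h (act R g v)"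

locale sl21_rep =
  fixes R :: "'v superrep" (structure)
  assumes vectorspace: "vectorspace \<CC> R"
    and even_subspace: "VectorSpace.subspace \<CC> (even_part R) R"
    and odd_subspace: "VectorSpace.subspace \<CC> (odd_part R) R"
    and even_odd_sum: "even_part R <+> odd_part R = carrier R"
    and even_odd_disjoint: "even_part R \<inter> odd_part R = {\<zero>}"
    and act_linear: "act R g \<in> LinearCombinations.module_hom \<CC> R R"
    and even_gen_even: "g \<in> even_gens \<Longrightarrow> act R g ` even_part R \<subseteq> even_part R"
    and even_gen_odd: "g \<in> even_gens \<Longrightarrow> act R g ` odd_part R \<subseteq> odd_part R"
    and odd_gen_even: "g \<in> odd_gens \<Longrightarrow> act R g ` even_part R \<subseteq> odd_part R"
    and odd_gen_odd: "g \<in> odd_gens \<Longrightarrow> act R g ` odd_part R \<subseteq> even_part R"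
    and even_even: "v \<in> carrier R \<Longrightarrow>
          comm R gH gE v = 2 \<odot> act R gE v \<and>
          comm R gH gF v = (-2) \<odot> act R gF v \<and>
          comm R gE gF v = act R gH v \<and>
          comm R gY gE v = \<zero> \<and> comm R gY gF v = \<zero> \<and> comm R gY gH v = \<zero>"
    and H_odd: "v \<in> carrier R \<Longrightarrow>
          comm R gH gU v = \<ominus> act R gU v \<and> comm R gH gW v = act R gW v \<and>
          comm R gH gX v = \<ominus> act R gX v \<and> comm R gH gV v = act R gV v"
    and Y_odd: "v \<in> carrier R \<Longrightarrow>
          comm R gY gU v = act R gU v \<and> comm R gY gW v = act R gW v \<and>
          comm R gY gV v = \<ominus> act R gV v \<and> comm R gY gX v = \<ominus> act R gX v"
    and EF_odd: "v \<in> carrier R \<Longrightarrow>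
          comm R gE gU v = act R gW v \<and> comm R gF gW v = act R gU v \<and>
          comm R gE gX v = \<ominus> act R gV v \<and> comm R gF gV v = \<ominus> act R gX v \<and>
          comm R gE gV v = \<zero> \<and> comm R gE gW v = \<zero> \<and>
          comm R gF gU v = \<zero> \<and> comm R gF gX v = \<zero>"
    and odd_odd: "v \<in> carrier R \<Longrightarrow>
          acomm R gU gV v = (1/2) \<odot> (act R gY v \<oplus> act R gH v) \<and>
          acomm R gW gX v = (1/2) \<odot> (act R gY v \<ominus> act R gH v) \<and>
          acomm R gU gX v = \<ominus> act R gF v \<and> acomm R gV gW v = \<ominus> act R gE v \<and>
          acomm R gU gW v = \<zero> \<and> acomm R gX gV v = \<zero> \<and>
          acomm R gU gU v = \<zero> \<and> acomm R gV gV v = \<zero> \<and>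
          acomm R gW gW v = \<zero> \<and> acomm R gX gX v = \<zero>"

definition fd_rep :: "'v superrep \<Rightarrow> bool" where
  "fd_rep R \<longleftrightarrow> sl21_rep R \<and> vectorspace.fin_dim \<CC> R"

text \<open>Subrepresentations are graded, as representations are.\<close>

definition subrep :: "'v set \<Rightarrow> 'v superrep \<Rightarrow> bool" where
  "subrep N R \<longleftrightarrow> VectorSpace.subspace \<CC> N R \<and>
     N = (N \<inter> even_part R) <+>\<^bsub>R\<^esub> (N \<inter> odd_part R) \<and>
     (\<forall>g. act R g ` N \<subseteq> N)"

definition irreducible_rep :: "'v superrep \<Rightarrow> bool" where
  "irreducible_rep R \<longleftrightarrow> sl21_rep R \<and> carrier R \<noteq> {\<zero>\<^bsub>R\<^esub>} \<and>
     (\<forall>N. subrep N R \<longrightarrow> N = {\<zero>\<^bsub>R\<^esub>} \<or> N = carrier R)"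

text \<open>The fields \<open>mult\<close> and \<open>one\<close> of a module record play no role.\<close>

definition quot_rep :: "'v superrep \<Rightarrow> 'v set \<Rightarrow> 'v set superrep" where
  "quot_rep R N = \<lparr>
     carrier = a_rcosets\<^bsub>R\<^esub> N,
     mult = undefined,
     one = undefined,
     zero = N,
     add = (\<lambda>A B. A <+>\<^bsub>R\<^esub> B),
     smult = (\<lambda>c A. \<Union>x\<in>A. N +>\<^bsub>R\<^esub> (c \<odot>\<^bsub>R\<^esub> x)),
     even_part = (\<lambda>x. N +>\<^bsub>R\<^esub> x) ` even_part R,
     odd_part = (\<lambda>x. N +>\<^bsub>R\<^esub> x) ` odd_part R,
     act = (\<lambda>g A. \<Union>x\<in>A. N +>\<^bsub>R\<^esub> act R g x)\<rparr>"

definition rep_iso :: "'v superrep \<Rightarrow> 'w superrep \<Rightarrow> bool" (infix "\<cong>\<^sub>r" 50) where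
  "R \<cong>\<^sub>r S \<longleftrightarrow> (\<exists>f. f \<in> LinearCombinations.module_hom \<CC> R S \<and> bij_betw f (carrier R) (carrier S) \<and>
     f ` even_part R = even_part S \<and> f ` odd_part R = odd_part S \<and>
     (\<forall>g. \<forall>v\<in>carrier R. f (act R g v) = act S g (f v)))"

definition parity_shift :: "'v superrep \<Rightarrow> 'v superrep" where
  "parity_shift R = R\<lparr>even_part := odd_part R, odd_part := even_part R\<rparr>"

definition rep_iso_upto_parity :: "'v superrep \<Rightarrow> 'w superrep \<Rightarrow> bool" (infix "\<cong>\<^sub>p" 50) where
  "R \<cong>\<^sub>p S \<longleftrightarrow> R \<cong>\<^sub>r S \<or> R \<cong>\<^sub>r parity_shift S"

definition highest_weight_vector ::
    "'v superrep \<Rightarrow> complex \<Rightarrow> complex \<Rightarrow> 'v \<Rightarrow> bool" where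
  "highest_weight_vector R c d v \<longleftrightarrow> v \<in> carrier R \<and> v \<noteq> \<zero>\<^bsub>R\<^esub> \<and>
     act R gH v = c \<odot>\<^bsub>R\<^esub> v \<and>
     (1/2) \<odot>\<^bsub>R\<^esub> (act R gY v \<oplus>\<^bsub>R\<^esub> act R gH v) = d \<odot>\<^bsub>R\<^esub> v \<and>
     act R gE v = \<zero>\<^bsub>R\<^esub> \<and> act R gU v = \<zero>\<^bsub>R\<^esub>"

section \<open>The module \<open>M(a,b)\<close>\<close>

text \<open>The pair \<open>(x, n)\<close> stands for the symbol \<open>F\<^sup>n x\<close>. A vector is its family of
  coordinates, which vanishes off the admissible symbols.\<close>

datatype sym = Lam | VLam | Om | VFVLam

type_synonym mvec = "sym \<times> nat \<Rightarrow> complex"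

fun symbols_of :: "nat \<Rightarrow> sym \<Rightarrow> nat" where
  "symbols_of a Lam = a + 1"
| "symbols_of a VLam = a + 2"
| "symbols_of a Om = a"
| "symbols_of a VFVLam = a + 1"

definition symbols :: "nat \<Rightarrow> (sym \<times> nat) set" where
  "symbols a = {(x, n). n < symbols_of a x}"

definition F_pow :: "nat \<Rightarrow> nat \<Rightarrow> sym \<Rightarrow> mvec" where
  "F_pow a n x = (\<lambda>i. if i = (x, n) \<and> i \<in> symbols a then 1 else 0)"

definition basis_vec :: "nat \<Rightarrow> sym \<times> nat \<Rightarrow> mvec" where
  "basis_vec a = (\<lambda>(x, n). F_pow a n x)"

definition vzero :: mvec where
  "vzero = (\<lambda>i. 0)"

definition vadd :: "mvec \<Rightarrow> mvec \<Rightarrow> mvec" where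
  "vadd f g = (\<lambda>i. f i + g i)"

definition vsmult :: "complex \<Rightarrow> mvec \<Rightarrow> mvec" where
  "vsmult c f = (\<lambda>i. c * f i)"

definition vsub :: "mvec \<Rightarrow> mvec \<Rightarrow> mvec" where
  "vsub f g = (\<lambda>i. f i - g i)"

definition lin_ext :: "nat \<Rightarrow> (nat \<Rightarrow> sym \<Rightarrow> mvec) \<Rightarrow> mvec \<Rightarrow> mvec" where
  "lin_ext a T f = (\<lambda>j. \<Sum>(x, n)\<in>symbols a. f (x, n) * T n x j)"

fun c_wt :: "nat \<Rightarrow> sym \<Rightarrow> complex" where
  "c_wt a Lam = of_nat a"
| "c_wt a VLam = of_nat a + 1"
| "c_wt a Om = of_nat a - 1"
| "c_wt a VFVLam = of_nat a"

fun y_wt :: "nat \<Rightarrow> complex \<Rightarrow> sym \<Rightarrow> complex" where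
  "y_wt a b Lam = 2 * b - of_nat a"
| "y_wt a b VLam = 2 * b - of_nat a - 1"
| "y_wt a b Om = 2 * b - of_nat a - 1"
| "y_wt a b VFVLam = 2 * b - of_nat a - 2"

text \<open>Below, \<open>n - 1\<close> is truncated at \<open>n = 0\<close>, where the coefficient in front of it is \<open>0\<close>.\<close>

definition F_basis :: "nat \<Rightarrow> nat \<Rightarrow> sym \<Rightarrow> mvec" where
  "F_basis a n x = F_pow a (n + 1) x"

definition E_basis :: "nat \<Rightarrow> nat \<Rightarrow> sym \<Rightarrow> mvec" where
  "E_basis a n x = vsmult (of_nat n * (c_wt a x - of_nat n + 1)) (F_pow a (n - 1) x)"

definition H_basis :: "nat \<Rightarrow> nat \<Rightarrow> sym \<Rightarrow> mvec" where
  "H_basis a n x = vsmult (c_wt a x - 2 * of_nat n) (F_pow a n x)"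

definition Y_basis :: "nat \<Rightarrow> complex \<Rightarrow> nat \<Rightarrow> sym \<Rightarrow> mvec" where
  "Y_basis a b n x = vsmult (y_wt a b x) (F_pow a n x)"

fun U_basis :: "nat \<Rightarrow> complex \<Rightarrow> nat \<Rightarrow> sym \<Rightarrow> mvec" where
  "U_basis a b n Lam = vzero"
| "U_basis a b n VLam = vsmult b (F_pow a n Lam)"
| "U_basis a b n Om = vsmult (of_nat a + 1 - b) (F_pow a (n + 1) Lam)"
| "U_basis a b n VFVLam =
     vadd (vsmult (b / (of_nat a + 1) - 1) (F_pow a (n + 1) VLam))
          (vsmult (b / (of_nat a + 1)) (F_pow a n Om))"

fun V_basis :: "nat \<Rightarrow> nat \<Rightarrow> sym \<Rightarrow> mvec" where
  "V_basis a n Lam =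
     vsub (vsmult (1 - of_nat n / (of_nat a + 1)) (F_pow a n VLam))
          (vsmult (of_nat n / (of_nat a + 1)) (F_pow a (n - 1) Om))"
| "V_basis a n VLam = vsmult (of_nat n) (F_pow a (n - 1) VFVLam)"
| "V_basis a n Om = vsmult (of_nat a - of_nat n) (F_pow a n VFVLam)"
| "V_basis a n VFVLam = vzero"

definition op_bracket :: "(mvec \<Rightarrow> mvec) \<Rightarrow> (mvec \<Rightarrow> mvec) \<Rightarrow> mvec \<Rightarrow> mvec" where
  "op_bracket S T f = vsub (S (T f)) (T (S f))"

fun M_act :: "nat \<Rightarrow> complex \<Rightarrow> gen \<Rightarrow> mvec \<Rightarrow> mvec" where
  "M_act a b gF = lin_ext a (F_basis a)"
| "M_act a b gE = lin_ext a (E_basis a)"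
| "M_act a b gH = lin_ext a (H_basis a)"
| "M_act a b gY = lin_ext a (Y_basis a b)"
| "M_act a b gU = lin_ext a (U_basis a b)"
| "M_act a b gV = lin_ext a (V_basis a)"
| "M_act a b gW = op_bracket (lin_ext a (E_basis a)) (lin_ext a (U_basis a b))"
| "M_act a b gX =
     (\<lambda>f. vsmult (-1) (op_bracket (lin_ext a (F_basis a)) (lin_ext a (V_basis a)) f))"

definition M_rep :: "nat \<Rightarrow> complex \<Rightarrow> mvec superrep" where
  "M_rep a b = \<lparr>
     carrier = {f. \<forall>i. i \<notin> symbols a \<longrightarrow> f i = 0},
     mult = undefined,
     one = undefined,
     zero = vzero,
     add = vadd,
     smult = vsmult,
     even_part = {f. \<forall>i. i \<notin> symbols a \<or> fst i \<in> {VLam, Om} \<longrightarrow> f i = 0},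
     odd_part = {f. \<forall>i. i \<notin> symbols a \<or> fst i \<in> {Lam, VFVLam} \<longrightarrow> f i = 0},
     act = M_act a b\<rparr>"

definition M_span :: "nat \<Rightarrow> complex \<Rightarrow> sym set \<Rightarrow> mvec set" where
  "M_span a b T = LinearCombinations.module.span \<CC> (M_rep a b)
     {F_pow a n x | n x. (x, n) \<in> symbols a \<and> x \<in> T}"

abbreviation N1 :: "nat \<Rightarrow> complex \<Rightarrow> mvec set" where
  "N1 a b \<equiv> M_span a b {VLam, VFVLam}"

abbreviation N2 :: "nat \<Rightarrow> complex \<Rightarrow> mvec set" where
  "N2 a b \<equiv> M_span a b {Om, VFVLam}"

text \<open>\<open>R(a,b)\<close> is \<open>M(a,b)\<close> in the typical case and a space of cosets in the atypical ones,
  so it has no single HOL type; the predicate says that a representation is isomorphic to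
  \<open>R(a,b)\<close> up to parity.\<close>

definition is_R :: "nat \<Rightarrow> complex \<Rightarrow> 'v superrep \<Rightarrow> bool" where
  "is_R a b S \<longleftrightarrow>
     b * (b - of_nat a - 1) \<noteq> 0 \<and> S \<cong>\<^sub>p M_rep a b \<or>
     b = 0 \<and> S \<cong>\<^sub>p quot_rep (M_rep a b) (N1 a b) \<or>
     b = of_nat a + 1 \<and> S \<cong>\<^sub>p quot_rep (M_rep a b) (N2 a b)"

section \<open>Matrix entries\<close>

definition is_indexed_basis :: "'v superrep \<Rightarrow> 'i set \<Rightarrow> ('i \<Rightarrow> 'v) \<Rightarrow> bool" where
  "is_indexed_basis R I e \<longleftrightarrow> finite I \<and> inj_on e I \<and> vectorspace.basis \<CC> R (e ` I)"

definition is_matrix_of ::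
    "'v superrep \<Rightarrow> 'i set \<Rightarrow> ('i \<Rightarrow> 'v) \<Rightarrow> ('v \<Rightarrow> 'v) \<Rightarrow> ('i \<Rightarrow> 'i \<Rightarrow> complex) \<Rightarrow> bool" where
  "is_matrix_of R I e T A \<longleftrightarrow>
     (\<forall>j\<in>I. T (e j) = (\<Oplus>\<^bsub>R\<^esub>i\<in>I. A i j \<odot>\<^bsub>R\<^esub> e i))"

text \<open>The eigenvalues of \<open>Y\<close> on the basis are \<open>2b - a\<close>, \<open>2b - a - 1\<close> and \<open>2b - a - 2\<close>,
  which are integers only if \<open>2b\<close> is. Hence \<open>Y\<close> is listed apart from \<open>F\<close>, \<open>H\<close>, \<open>E\<close>.\<close>

fun admissible_entry :: "nat \<Rightarrow> complex \<Rightarrow> gen \<Rightarrow> complex \<Rightarrow> bool" where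
  "admissible_entry a b gF z \<longleftrightarrow> z \<in> \<int>"
| "admissible_entry a b gH z \<longleftrightarrow> z \<in> \<int>"
| "admissible_entry a b gE z \<longleftrightarrow> z \<in> \<int>"
| "admissible_entry a b gY z \<longleftrightarrow>
     (\<exists>p q :: int. z = of_int p + of_int q * b) \<and> (2 * b \<in> \<int> \<longrightarrow> z \<in> \<int>)"
| "admissible_entry a b _ z \<longleftrightarrow>
     (\<exists>p q :: int. z = (of_int p + of_int q * b) / (of_nat a + 1))"

definition has_admissible_matrices ::
    "nat \<Rightarrow> complex \<Rightarrow> 'v superrep \<Rightarrow> 'i set \<Rightarrow> ('i \<Rightarrow> 'v) \<Rightarrow> bool" where
  "has_admissible_matrices a b R I e \<longleftrightarrow> is_indexed_basis R I e \<and>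
     (\<forall>g. \<exists>A. is_matrix_of R I e (act R g) A \<and> (\<forall>i\<in>I. \<forall>j\<in>I. admissible_entry a b g (A i j)))"

end

theory Submission
  imports Defs "HOL-Library.Function_Algebras" "HOL-Computational_Algebra.Fundamental_Theorem_Algebra"
begin

text \<open>
  On coordinate families every generator acts on \<open>M(a,b)\<close> by an explicit formula, and the relations
  become rational identities in the coordinates. An invariant subspace with a vector having a nonzero
  \<open>\<Lambda>\<close>-string component contains \<open>\<Lambda>\<close>: the eigenvalues of \<open>Y\<close> isolate that component and powers of
  \<open>E\<close> lower it to \<open>\<Lambda>\<close>; and \<open>\<Lambda>\<close> generates \<open>M(a,b)\<close>. The operators \<open>U\<close> and \<open>W\<close> move the strings of
  \<open>V\<Lambda>\<close> and \<open>\<omega>\<close> into that of \<open>\<Lambda>\<close>, and \<open>WU F\<^sup>n VFV\<Lambda> = - b (b - a - 1) F\<^sup>n \<Lambda>\<close>. So a proper invariant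
  subspace is zero in the typical case and lies in the span to be divided out in the atypical ones.

  A finite dimensional irreducible representation \<open>S\<close> contains a homogeneous vector killed by \<open>U\<close>, \<open>W\<close>
  and \<open>E\<close> on which \<open>H\<close> and \<open>Y\<close> are scalars. Finiteness of the \<open>F\<close>-string through it forces
  \<open>H = a\<close> with \<open>a\<close> a natural number, and the relations give a homomorphism from \<open>M(a,b)\<close> onto \<open>S\<close>,
  up to parity. Its kernel does not contain \<open>\<Lambda>\<close>, hence is the unique maximal proper submodule.
\<close>


section \<open>Linear operators on complex-valued functions\<close>

text \<open>\<open>M(a,b)\<close> is the exterior algebra on the lowering operators \<open>V\<close>
  and \<open>X\<close>, applied to the module of highest weight \<open>a\<close> for
  \<open>E\<close>, \<open>F\<close>, \<open>H\<close>. Its middle layer splits into highest weights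
  \<open>a + 1\<close> and \<open>a - 1\<close>. Since
  \<open>E F V \<Lambda> = (a + 1) V \<Lambda>\<close> and
  \<open>E V F \<Lambda> = a V \<Lambda>\<close>, the vector \<omega> is the combination of weight
  \<open>a - 1\<close> killed by \<open>E\<close>; solving its definition for
  \<open>V F \<Lambda>\<close> is where the denominators \<open>a + 1\<close> come from.

  An abstract \<open>S\<close> lives on a carrier set, where each identity has membership
  conditions. A choice of basis turns its operators into maps of complex-valued functions that
  satisfy the relations without conditions, so that the computation along the strings is plain
  rewriting. For such operators finite dimension means that all values are supported on one finite
  set; it is used as linear dependence among infinitely many vectors, which makes the strings end
  and provides annihilating polynomials.\<close>

definition sc :: "complex \<Rightarrow> ('i \<Rightarrow> complex) \<Rightarrow> 'i \<Rightarrow> complex" where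
  "sc c f = (\<lambda>i. c * f i)"

lemma sc_apply: "sc c f i = c * f i"
  by (simp add: sc_def)

lemma sum_fun_apply: "sum f A i = (\<Sum>x\<in>A. f x i :: complex)"
  by (induct A rule: infinite_finite_induct) auto

text \<open>Induction methods leave eta-expanded terms such as \<open>T (\<lambda>i. sum h I i)\<close>; with the pointwise
  rules active the simplifier would then rewrite under the argument of \<open>T\<close>, where linearity no
  longer applies.\<close>

declare plus_fun_apply [simp del] zero_fun_apply [simp del] minus_apply [simp del] uminus_apply [simp del]

lemmas pointwise = fun_eq_iff plus_fun_apply zero_fun_apply minus_apply uminus_apply sc_apply sum_fun_apply

interpretation fvs: vector_space sc
  by unfold_locales (auto simp: pointwise algebra_simps)

definition fun_linear :: "(('i \<Rightarrow> complex) \<Rightarrow> ('j \<Rightarrow> complex)) \<Rightarrow> bool" where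
  "fun_linear T \<longleftrightarrow> (\<forall>f g. T (f + g) = T f + T g) \<and> (\<forall>c f. T (sc c f) = sc c (T f))"

lemma fun_linearD:
  assumes "fun_linear T"
  shows "T (f + g) = T f + T g" "T (sc c f) = sc c (T f)" "T 0 = 0"
    "T (- f) = - T f" "T (f - g) = T f - T g" "T (sum h I) = (\<Sum>i\<in>I. T (h i))"
proof -
  show add: "T (f + g) = T f + T g" and scl: "T (sc c f) = sc c (T f)" for f g c
    using assms by (auto simp: fun_linear_def)
  show z: "T 0 = 0" using scl[of 0 0] by simp
  have mn: "T (- f) = - T f" for f using scl[of "-1" f] by simp
  then show "T (- f) = - T f" .
  show "T (f - g) = T f - T g" using add[of f "- g"] mn[of g] by simp
  show "T (sum h I) = (\<Sum>i\<in>I. T (h i))"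
    by (induct I rule: infinite_finite_induct) (auto simp: z add)
qed

definition supported :: "'i set \<Rightarrow> ('i \<Rightarrow> complex) \<Rightarrow> bool" where
  "supported B f \<longleftrightarrow> (\<forall>i. i \<notin> B \<longrightarrow> f i = 0)"

section \<open>Linear dependence and eigenvectors among functions of finite support\<close>

lemma supported_in_span:
  assumes "finite B" "supported B f"
  shows "f \<in> fvs.span ((\<lambda>b i. if i = b then 1 else 0) ` B)"
proof -
  have "f = (\<Sum>b\<in>B. sc (f b) (\<lambda>i. if i = b then 1 else 0))"
    using assms by (auto simp: pointwise supported_def if_distrib sum.delta' cong: if_cong)
  also have "\<dots> \<in> fvs.span ((\<lambda>b i. if i = b then 1 else 0) ` B)"
    by (intro fvs.span_sum fvs.span_scale fvs.span_base) auto
  finally show ?thesis .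
qed

text \<open>Stated for sequences, which may repeat a vector without their range being dependent as a
  set. A repetition \<open>u m = u n\<close> is itself a relation; without repetitions the range is
  infinite inside a finite dimensional span.\<close>

lemma finite_support_dependent:
  fixes u :: "nat \<Rightarrow> 'i \<Rightarrow> complex"
  assumes B: "finite B" and u: "\<And>n. supported B (u n)"
  shows "\<exists>N c. (\<Sum>n<N. sc (c n) (u n)) = 0 \<and> (\<exists>n<N. c n \<noteq> 0)"
proof (cases "inj u")
  case False
  then obtain m n where mn: "m < n" "u m = u n" 
    by (metis injI linorder_neqE_nat)
  let ?c = "\<lambda>k. if k = m then 1 else if k = n then -1 else (0::complex)"
  have "(\<Sum>k<Suc n. sc (?c k) (u k)) = (\<Sum>k\<in>{m,n}. sc (?c k) (u k))"
    by (rule sum.mono_neutral_right) (use mn in auto)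
  also have "\<dots> = 0" using mn by (auto simp: pointwise)
  finally show ?thesis using mn by (intro exI[of _ "Suc n"] exI[of _ ?c]) (auto intro!: exI[of _ m])
next
  case True
  let ?D = "(\<lambda>b i. if i = b then 1 else (0::complex)) ` B"
  have sub: "range u \<subseteq> fvs.span ?D" using supported_in_span[OF B] u by blast
  have "infinite (range u)" using True by (simp add: range_inj_infinite)
  then have "fvs.dependent (range u)"
    using fvs.independent_span_bound[of ?D "range u"] sub B by auto
  then obtain S c where S: "finite S" "S \<subseteq> range u" "(\<Sum>v\<in>S. sc (c v) v) = 0" "\<exists>v\<in>S. c v \<noteq> 0"
    unfolding fvs.dependent_explicit by auto
  define I where "I = u -` S"
  have I: "finite I" "u ` I = S" using S True by (auto simp: I_def finite_vimageI)
  obtain N where N: "I \<subseteq> {..<N}" using I(1) finite_nat_bounded by blast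
  let ?c = "\<lambda>n. if n \<in> I then c (u n) else 0"
  have "(\<Sum>n<N. sc (?c n) (u n)) = (\<Sum>n\<in>I. sc (?c n) (u n))"
    by (rule sum.mono_neutral_right) (use N in auto)
  also have "\<dots> = (\<Sum>n\<in>I. sc (c (u n)) (u n))" by simp
  also have "\<dots> = (\<Sum>v\<in>u ` I. sc (c v) v)"
    using True by (subst sum.reindex) (auto simp: inj_on_def)
  also have "\<dots> = 0" using S I by simp
  finally show ?thesis using S I N
    by (intro exI[of _ N] exI[of _ ?c]) (auto 4 4)
qed

text \<open>Subtracting \<open>l N\<close> times a relation from its image under \<open>T\<close>
  removes the last term and multiplies the others by the nonzero numbers
  \<open>l n - l N\<close>.\<close>

lemma distinct_eigenvalues_independent:
  fixes u :: "nat \<Rightarrow> 'i \<Rightarrow> complex"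
  assumes T: "fun_linear T" and eig: "\<And>n. T (u n) = sc (l n) (u n)"
    and l: "inj l" and nz: "\<And>n. u n \<noteq> 0"
    and "(\<Sum>n<N. sc (c n) (u n)) = 0" "n < N"
  shows "c n = 0"
  using assms(5,6)
proof (induction N arbitrary: c n)
  case (Suc N)
  have s: "(\<Sum>n<N. sc (c n) (u n)) + sc (c N) (u N) = 0" using Suc.prems by simp
  have "T ((\<Sum>n<N. sc (c n) (u n)) + sc (c N) (u N)) = 0"
    unfolding s by (rule fun_linearD[OF T])
  then have "(\<Sum>n<N. sc (c n * l n) (u n)) + sc (c N * l N) (u N) = 0"
    by (simp add: fun_linearD[OF T] eig)
  moreover have "sc (l N) ((\<Sum>n<N. sc (c n) (u n)) + sc (c N) (u N)) = 0"
    using s by simp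
  ultimately have "(\<Sum>n<N. sc (c n * l n) (u n)) + sc (c N * l N) (u N)
      = sc (l N) ((\<Sum>n<N. sc (c n) (u n)) + sc (c N) (u N))" by simp
  then have "(\<Sum>n<N. sc (c n * l n) (u n)) - sc (l N) (\<Sum>n<N. sc (c n) (u n)) = 0"
    by (simp add: fvs.scale_right_distrib mult.commute)
  then have "(\<Sum>n<N. sc (c n * (l n - l N)) (u n)) = 0"
    by (simp add: fvs.scale_sum_right sum_subtractf[symmetric] algebra_simps fvs.scale_left_diff_distrib)
  then have "c n * (l n - l N) = 0" if "n < N" for n
    using Suc.IH[of "\<lambda>n. c n * (l n - l N)"] that by blast
  then have c0: "c n = 0" if "n < N" for n using l that by (auto simp: inj_def)
  then have "c N = 0" using s nz[of N] by simp
  then show ?case using c0 Suc.prems(2) by (auto simp: less_Suc_eq)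
qed simp

text \<open>The termination principle for chains of powers of \<open>E\<close> or of
  \<open>F\<close>, along which the eigenvalue of \<open>H\<close> moves in steps of two.\<close>

lemma distinct_eigenvalues_vanish:
  fixes u :: "nat \<Rightarrow> 'i \<Rightarrow> complex"
  assumes "finite B" "\<And>n. supported B (u n)" "fun_linear T"
    "\<And>n. T (u n) = sc (l n) (u n)" "inj l"
  shows "\<exists>n. u n = 0"
proof (rule ccontr)
  assume "\<nexists>n. u n = 0"
  then have nz: "\<And>n. u n \<noteq> 0" by auto
  obtain N c where "(\<Sum>n<N. sc (c n) (u n)) = 0" "\<exists>n<N. c n \<noteq> 0"
    using finite_support_dependent[of B u] assms(1,2) by auto
  then show False
    using distinct_eigenvalues_independent[OF assms(3-5) nz] by blast
qed

text \<open>Horner's scheme for \<open>p(T) v\<close>.\<close>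

definition poly_op :: "complex poly \<Rightarrow> (('i \<Rightarrow> complex) \<Rightarrow> 'i \<Rightarrow> complex) \<Rightarrow> ('i \<Rightarrow> complex) \<Rightarrow> 'i \<Rightarrow> complex" where
  "poly_op p T v = fold_coeffs (\<lambda>a w. sc a v + T w) p 0"

lemma poly_op_simps [simp]:
  assumes "fun_linear T"
  shows "poly_op 0 T v = 0" "poly_op (pCons a p) T v = sc a v + T (poly_op p T v)"
  using fun_linearD(3)[OF assms]
  by (cases "p = 0 \<and> a = 0"; auto simp: poly_op_def)+

lemma poly_op_add:
  assumes T: "fun_linear T"
  shows "poly_op (p + q) T v = poly_op p T v + poly_op q T v"
  by (induct p q rule: poly_induct2) (simp_all add: T fun_linearD[OF T] fvs.scale_left_distrib)

lemma poly_op_smult: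
  assumes T: "fun_linear T"
  shows "poly_op (Polynomial.smult c p) T v = sc c (poly_op p T v)"
  by (induct p) (simp_all add: T fun_linearD[OF T] fvs.scale_right_distrib)

lemma poly_op_diff:
  assumes T: "fun_linear T"
  shows "poly_op (p - q) T v = poly_op p T v - poly_op q T v"
  using poly_op_add[OF T, of p "Polynomial.smult (-1) q" v] poly_op_smult[OF T, of "-1" q v] by simp

text \<open>Polynomials in \<open>T\<close> commute with \<open>T\<close>, so a linear factor of an
  annihilating polynomial can be moved onto the vector.\<close>

lemma poly_op_shift:
  assumes T: "fun_linear T"
  shows "poly_op p T (T v - sc l v) = poly_op ([:-l, 1:] * p) T v"
proof -
  have "poly_op p T (T v - sc l v) = T (poly_op p T v) - sc l (poly_op p T v)"
  proof (induct p)
    case (pCons a p)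
    show ?case unfolding poly_op_simps(2)[OF T] pCons(2) fun_linearD[OF T]
      by (simp add: fvs.scale_right_distrib fvs.scale_right_diff_distrib mult.commute)
  qed (simp add: T fun_linearD[OF T])
  then show ?thesis
    by (simp add: T poly_op_diff poly_op_smult)
qed

lemma poly_op_monom_sum:
  assumes T: "fun_linear T"
  shows "poly_op (\<Sum>n<N. monom (c n) n) T v = (\<Sum>n<N. sc (c n) ((T ^^ n) v))"
proof -
  have "poly_op (monom a n) T v = sc a ((T ^^ n) v)" for a n
    by (induct n) (simp_all add: T fun_linearD[OF T] monom_0 monom_Suc)
  then show ?thesis by (induct N) (simp_all add: T poly_op_add)
qed

text \<open>For a root \<open>l\<close> of \<open>p\<close>, either \<open>v\<close> is already an
  eigenvector or \<open>T v - l v\<close> is a nonzero vector of \<open>K\<close> killed by the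
  cofactor of smaller degree. The set \<open>K\<close> carries the side conditions that the
  eigenvector has to keep.\<close>

lemma eigenvector_from_annihilator:
  assumes T: "fun_linear T"
    and K: "\<And>v l. v \<in> K \<Longrightarrow> T v - sc l v \<in> K"
  shows "p \<noteq> 0 \<Longrightarrow> poly_op p T v = 0 \<Longrightarrow> v \<in> K \<Longrightarrow> v \<noteq> 0 \<Longrightarrow> \<exists>w l. w \<in> K \<and> w \<noteq> 0 \<and> T w = sc l w"
proof (induct "degree p" arbitrary: p v)
  case 0
  then obtain a where "p = [:a:]" "a \<noteq> 0" by (metis degree_eq_zeroE pCons_0_0)
  with 0 T show ?case by (auto simp: fun_linearD[OF T])
next
  case (Suc n)
  then have "\<not> constant (poly p)" by (simp add: constant_degree)
  then obtain l where "poly p l = 0"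
    using fundamental_theorem_of_algebra by blast
  then obtain q where q: "p = [:-l, 1:] * q" unfolding poly_eq_0_iff_dvd by (rule dvdE)
  with Suc.prems have q0: "q \<noteq> 0" by auto
  have "degree p = Suc (degree q)" unfolding q using q0
    by (subst degree_mult_eq) auto
  with Suc.hyps have dq: "n = degree q" by simp
  show ?case
  proof (cases "T v - sc l v = 0")
    case True
    then show ?thesis using Suc.prems by auto
  next
    case False
    have "poly_op q T (T v - sc l v) = 0" using Suc.prems unfolding q by (simp only: poly_op_shift[OF T])
    then show ?thesis using Suc.hyps(1)[OF dq q0] K False Suc.prems by blast
  qed
qed

text \<open>The powers of \<open>T\<close> applied to \<open>v\<close> stay in \<open>K\<close>
  (take \<open>l = 0\<close> in the closure condition), hence are supported on \<open>B\<close>; a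
  dependence among them is an annihilating polynomial.\<close>

lemma eigenvector_exists:
  assumes B: "finite B" and T: "fun_linear T"
    and K: "\<And>v l. v \<in> K \<Longrightarrow> T v - sc l v \<in> K"
    and supp: "\<And>v. v \<in> K \<Longrightarrow> supported B v"
    and v: "v \<in> K" "v \<noteq> 0"
  shows "\<exists>w l. w \<in> K \<and> w \<noteq> 0 \<and> T w = sc l w"
proof -
  have "(T ^^ n) v \<in> K" for n
    using v(1) K[where l = 0] by (induct n) auto
  then obtain N c where c: "(\<Sum>n<N. sc (c n) ((T ^^ n) v)) = 0" "\<exists>n<N. c n \<noteq> 0"
    using finite_support_dependent[OF B, of "\<lambda>n. (T ^^ n) v"] supp by blast
  let ?p = "\<Sum>n<N. monom (c n) n"
  have "coeff ?p n = c n" if "n < N" for n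
    using that by (simp add: coeff_sum)
  then have "?p \<noteq> 0" using c(2) by (metis coeff_0)
  then show ?thesis using eigenvector_from_annihilator[OF T K, of ?p v] c(1) v
    by (simp add: poly_op_monom_sum[OF T])
qed


section \<open>Operators satisfying the relations of \<open>SU(2/1)\<close>\<close>

lemma of_nat_add_one_neq_0 [simp]: "of_nat a + 1 \<noteq> (0::complex)" "1 + of_nat a \<noteq> (0::complex)"
  by (metis of_nat_Suc of_nat_neq_0 add.commute)+

text \<open>The relations between different generators are oriented for rewriting: \<open>H\<close>,
  \<open>Y\<close> and \<open>E\<close> move to the right, towards a vector on which their action is
  known. All values are supported on \<open>B\<close>, whatever the argument.\<close>

locale op_rep =
  fixes A :: "gen \<Rightarrow> ('i \<Rightarrow> complex) \<Rightarrow> 'i \<Rightarrow> complex" and B :: "'i set"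
  assumes finB: "finite B" and lin: "fun_linear (A g)" and supp: "supported B (A g f)"
    and HE: "A gH (A gE f) = A gE (A gH f) + sc 2 (A gE f)"
    and HF: "A gH (A gF f) = A gF (A gH f) - sc 2 (A gF f)"
    and EF: "A gE (A gF f) = A gF (A gE f) + A gH f"
    and YE: "A gY (A gE f) = A gE (A gY f)"
    and YF: "A gY (A gF f) = A gF (A gY f)"
    and YH: "A gY (A gH f) = A gH (A gY f)"
    and HU: "A gH (A gU f) = A gU (A gH f) - A gU f"
    and HW: "A gH (A gW f) = A gW (A gH f) + A gW f"
    and HV: "A gH (A gV f) = A gV (A gH f) + A gV f"
    and YU: "A gY (A gU f) = A gU (A gY f) + A gU f"
    and YW: "A gY (A gW f) = A gW (A gY f) + A gW f"
    and YV: "A gY (A gV f) = A gV (A gY f) - A gV f"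
    and EU: "A gE (A gU f) = A gU (A gE f) + A gW f"
    and EV: "A gE (A gV f) = A gV (A gE f)"
    and EW: "A gE (A gW f) = A gW (A gE f)"
    and FU: "A gF (A gU f) = A gU (A gF f)"
    and FX: "A gF (A gX f) = A gX (A gF f)"
    and FV: "A gF (A gV f) = A gV (A gF f) - A gX f"
    and UV: "A gU (A gV f) = sc (1/2) (A gY f + A gH f) - A gV (A gU f)"
    and UW: "A gU (A gW f) = - A gW (A gU f)"
    and XV: "A gX (A gV f) = - A gV (A gX f)"
    and UU: "A gU (A gU f) = 0" and WW: "A gW (A gW f) = 0"
    and VV: "A gV (A gV f) = 0" and XX: "A gX (A gX f) = 0"
begin

abbreviation "E \<equiv> A gE" abbreviation "F \<equiv> A gF" abbreviation "H \<equiv> A gH" abbreviation "Y \<equiv> A gY"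
abbreviation "U \<equiv> A gU" abbreviation "V \<equiv> A gV" abbreviation "W \<equiv> A gW" abbreviation "X \<equiv> A gX"

lemmas lins = fun_linearD[OF lin]

text \<open>\<open>U\<close> and \<open>W\<close> square to zero and anticommute, so applying whichever of them does not
  vanish ends in their common kernel.\<close>

lemma killed_vector_exists:
  assumes "v \<in> P \<union> Q" "v \<noteq> 0" "supported B v"
    and PQ: "\<And>g f. g \<in> {gU, gW} \<Longrightarrow> f \<in> P \<Longrightarrow> A g f \<in> Q"
    "\<And>g f. g \<in> {gU, gW} \<Longrightarrow> f \<in> Q \<Longrightarrow> A g f \<in> P"
  shows "\<exists>w. w \<in> P \<union> Q \<and> w \<noteq> 0 \<and> supported B w \<and> U w = 0 \<and> W w = 0"
proof -
  obtain v1 where v1: "v1 \<in> P \<union> Q" "v1 \<noteq> 0" "supported B v1" "U v1 = 0"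
  proof (cases "U v = 0")
    case False
    then show ?thesis using that[of "U v"] assms UU supp by auto
  qed (use that assms in auto)
  show ?thesis
  proof (cases "W v1 = 0")
    case False
    then show ?thesis using v1 PQ by (intro exI[of _ "W v1"]) (auto simp: UW WW supp lins)
  qed (use v1 in auto)
qed

text \<open>The common kernel of \<open>U\<close> and \<open>W\<close> is stable under
  \<open>Y\<close>, \<open>H\<close> and \<open>E\<close>. It contains an eigenvector of
  \<open>Y\<close>; as \<open>H\<close> commutes with \<open>Y\<close>, the eigenspace contains one
  of \<open>H\<close>; and the last nonzero power of \<open>E\<close> on it is killed by
  \<open>E\<close>. The subspace \<open>R\<close> will be one of the two parity parts, which makes
  the result homogeneous.\<close>

lemma highest_weight_exists:
  assumes R: "fvs.subspace R" and ev: "\<And>g f. g \<in> {gE, gH, gY} \<Longrightarrow> f \<in> R \<Longrightarrow> A g f \<in> R"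
    and v: "v \<in> R" "v \<noteq> 0" "supported B v" "U v = 0" "W v = 0"
  shows "\<exists>w c y. w \<in> R \<and> w \<noteq> 0 \<and> supported B w \<and> E w = 0 \<and> U w = 0 \<and> H w = sc c w \<and> Y w = sc y w"
proof -
  note sub = fvs.subspace_diff[OF R] fvs.subspace_scale[OF R]
  have suppD: "supported B (f - sc l g)" if "supported B f" "supported B g" for f g l
    using that by (auto simp: supported_def pointwise)
  define K where "K = {w \<in> R. supported B w \<and> U w = 0 \<and> W w = 0}"
  have "U (Y w) = 0" "W (Y w) = 0" if "U w = 0" "W w = 0" for w
    using YU[of w] YW[of w] that by (auto simp: lins)
  then have KY: "Y w - sc l w \<in> K" if "w \<in> K" for w l
    using that by (auto simp: K_def sub ev supp suppD lins)
  have "\<exists>w l. w \<in> K \<and> w \<noteq> 0 \<and> Y w = sc l w"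
    by (rule eigenvector_exists[OF finB lin KY, where v = v]) (use v in \<open>auto simp: K_def\<close>)
  then obtain w1 y where w1: "w1 \<in> K" "w1 \<noteq> 0" "Y w1 = sc y w1" by blast
  define K' where "K' = {w \<in> K. Y w = sc y w}"
  have "U (H w) = 0" "W (H w) = 0" if "U w = 0" "W w = 0" for w
    using HU[of w] HW[of w] that by (auto simp: lins)
  then have KH: "H w - sc l w \<in> K'" if "w \<in> K'" for w l
    using that by (auto simp: K'_def K_def sub ev supp suppD lins YH fvs.scale_right_diff_distrib mult.commute)
  have "\<exists>w l. w \<in> K' \<and> w \<noteq> 0 \<and> H w = sc l w"
    by (rule eigenvector_exists[OF finB lin KH, where v = w1]) (use w1 in \<open>auto simp: K'_def K_def\<close>)
  then obtain w2 c where w2: "w2 \<in> K'" "w2 \<noteq> 0" "H w2 = sc c w2" by blast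
  define u where "u n = (E ^^ n) w2" for n
  have uS: "u (Suc n) = E (u n)" for n by (simp add: u_def)
  \<comment> \<open>Vanishing of \<open>U w\<close> alone would not pass to \<open>E w\<close>,
    because \<open>E U = U E + W\<close>; this is why \<open>W w = 0\<close> is kept as
    well.\<close>
  have EU0: "U (E w) = 0" "W (E w) = 0" if "U w = 0" "W w = 0" for w
    using EU[of w] EW[of w] that by (auto simp: lins)
  have u: "u n \<in> K' \<and> H (u n) = sc (c + 2 * of_nat n) (u n)" for n
  proof (induct n)
    case 0
    then show ?case using w2 by (simp add: u_def)
  next
    case (Suc n)
    then have "u (Suc n) \<in> K'" unfolding uS using EU0
      by (auto simp: K'_def K_def ev supp YE lins)
    moreover have "H (u (Suc n)) = sc (c + 2 * of_nat (Suc n)) (u (Suc n))" unfolding uS HE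
      using Suc by (simp add: lins) (simp add: pointwise algebra_simps)
    ultimately show ?case by simp
  qed
  have "inj (\<lambda>n. c + 2 * of_nat n)" by (auto simp: inj_def)
  then have "\<exists>n. u n = 0"
    using distinct_eigenvalues_vanish[OF finB _ lin[of gH], of u "\<lambda>n. c + 2 * of_nat n"] u
    by (auto simp: K'_def K_def)
  moreover have "u 0 \<noteq> 0" using w2 by (simp add: u_def)
  ultimately obtain n where "u n \<noteq> 0" "u (Suc n) = 0"
    using ex_least_nat_less[of "\<lambda>n. u n = 0"] by (metis less_imp_le lessI)
  then show ?thesis using u[of n] unfolding uS K'_def K_def by blast
qed

section \<open>Strings of powers of \<open>F\<close>\<close>

lemma pow_lins:
  "(F ^^ n) (f + g) = (F ^^ n) f + (F ^^ n) g" "(F ^^ n) (f - g) = (F ^^ n) f - (F ^^ n) g"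
  "(F ^^ n) (sc c f) = sc c ((F ^^ n) f)" "(F ^^ n) (- f) = - (F ^^ n) f" "(F ^^ n) 0 = 0"
  by (induct n; simp add: lins)+

lemma string_weight:
  assumes "H x = sc c x"
  shows "H ((F ^^ n) x) = sc (c - 2 * of_nat n) ((F ^^ n) x)"
proof (induct n)
  case (Suc n)
  then show ?case by (simp add: HF lins) (simp add: pointwise algebra_simps)
qed (simp add: assms)

lemma string_raise:
  assumes "E x = 0" "H x = sc c x"
  shows "E ((F ^^ n) x) = sc (of_nat n * (c - of_nat n + 1)) ((F ^^ (n - 1)) x)"
proof (induct n)
  case 0
  then show ?case by (simp add: assms)
next
  case (Suc n)
  note IH = Suc
  show ?case
  \<comment> \<open>With truncated subtraction, \<open>F\<close> applied to the power
    \<open>n - 1\<close> gives the power \<open>n\<close> only for \<open>n > 0\<close>.\<close>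
  proof (cases n)
    case 0
    then show ?thesis using assms by (simp add: EF lins)
  next
    case (Suc m)
    then have "F ((F ^^ (n - 1)) x) = (F ^^ n) x" by simp
    then show ?thesis using IH string_weight[OF assms(2), of n]
      by (simp add: EF lins) (simp add: pointwise algebra_simps)
  qed
qed

lemma string_Y:
  assumes "Y x = sc y x"
  shows "Y ((F ^^ n) x) = sc y ((F ^^ n) x)"
  by (induct n) (simp_all add: assms YF lins)

text \<open>If \<open>n\<close> is the last index with \<open>F^n x\<close> nonzero, applying
  \<open>E\<close> to \<open>F^(n+1) x = 0\<close> gives \<open>(n + 1) (c - n) F^n x = 0\<close>,
  so \<open>c = n\<close>.\<close>

lemma string_end:
  assumes x: "x \<noteq> 0" "supported B x" and hw: "E x = 0" "H x = sc c x"
  shows "\<exists>m. c = of_nat m \<and> (F ^^ Suc m) x = 0"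
proof -
  define u where "u n = (F ^^ n) x" for n
  have "supported B (u n)" for n using x(2) supp by (cases n) (auto simp: u_def)
  moreover have "inj (\<lambda>n. c - 2 * of_nat n)" by (auto simp: inj_def)
  ultimately have "\<exists>n. u n = 0"
    using distinct_eigenvalues_vanish[OF finB _ lin[of gH], of u "\<lambda>n. c - 2 * of_nat n"]
      string_weight[OF hw(2)]
    by (auto simp: u_def)
  moreover have "u 0 \<noteq> 0" using x by (simp add: u_def)
  ultimately obtain n where n: "u n \<noteq> 0" "u (Suc n) = 0"
    using ex_least_nat_less[of "\<lambda>n. u n = 0"] by (metis less_imp_le lessI)
  have "sc (of_nat (Suc n) * (c - of_nat (Suc n) + 1)) (u n) = 0"
    using string_raise[OF hw, of "Suc n"] n(2) by (simp add: u_def lins del: of_nat_Suc)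
  then have "c - of_nat (Suc n) + 1 = 0" using n(1) by (simp del: of_nat_Suc)
  then have "c = of_nat n" by (simp add: algebra_simps)
  then show ?thesis using n unfolding u_def by blast
qed

end

section \<open>The action of the generators on the vectors obtained from a highest weight
  vector\<close>

locale op_hw = op_rep +
  fixes L :: "'a \<Rightarrow> complex" and a :: nat and b :: complex
  assumes L: "L \<noteq> 0" "supported B L" and EL: "A gE L = 0" and UL: "A gU L = 0"
    and HL: "A gH L = sc (of_nat a) L" and YL: "A gY L = sc (2 * b - of_nat a) L"
begin

fun base :: "sym \<Rightarrow> 'a \<Rightarrow> complex" where
  "base Lam = L"
| "base VLam = V L"
| "base Om = sc (of_nat a) (F (V L)) - sc (of_nat a + 1) (V (F L))"
| "base VFVLam = V (F (V L))"

definition s :: "nat \<Rightarrow> sym \<Rightarrow> 'a \<Rightarrow> complex" where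
  "s n x = (F ^^ n) (base x)"

text \<open>For \<open>Om\<close> the coefficients are those that cancel
  \<open>E F V L = (a + 1) V L\<close> against \<open>E V F L = a V L\<close>; for
  \<open>VFVLam\<close>, commuting \<open>E\<close> past \<open>V\<close> leaves a multiple of
  \<open>V V L = 0\<close>.\<close>

lemma base_hw: "E (base x) = 0 \<and> H (base x) = sc (c_wt a x) (base x) \<and> Y (base x) = sc (y_wt a b x) (base x)"
proof (cases x)
  case Lam
  then show ?thesis by (simp add: EL HL YL)
next
  case VLam
  then show ?thesis by (simp add: EV HV YV EL HL YL lins pointwise algebra_simps)
next
  case Om
  have "H (base Om) = sc (c_wt a Om) (base Om) \<and> Y (base Om) = sc (y_wt a b Om) (base Om)"
    by (simp add: HF HV YF YV HL YL lins) (simp add: pointwise algebra_simps)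
  moreover have "E (base Om) = 0"
    by (simp add: EF EV HV EL HL lins) (simp add: pointwise algebra_simps)
  ultimately show ?thesis using Om by simp
next
  case VFVLam
  have "H (base VFVLam) = sc (c_wt a VFVLam) (base VFVLam) \<and> Y (base VFVLam) = sc (y_wt a b VFVLam) (base VFVLam)"
    by (simp add: HF HV YF YV HL YL lins) (simp add: pointwise algebra_simps)
  moreover have "E (base VFVLam) = 0"
    by (simp add: EF EV HV EL HL VV lins)
  ultimately show ?thesis using VFVLam by simp
qed

lemma supp_base: "supported B (base x)"
  using L(2) supp by (cases x) (auto simp: supported_def pointwise)

lemma s_zero:
  assumes "(x, n) \<notin> symbols a"
  shows "s n x = 0"
proof (cases "base x = 0")
  case True
  then show ?thesis unfolding s_def by (induct n) (auto simp: lins)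
next
  case False
  then obtain m where m: "c_wt a x = of_nat m" "(F ^^ Suc m) (base x) = 0"
    using string_end[OF False supp_base, of "c_wt a x"] base_hw[of x] by auto
  \<comment> \<open>The number of symbols in a string is its weight plus one. For
    \<open>x = Om\<close> and \<open>a = 0\<close> this reads \<open>0 = Suc m\<close>, a
    contradiction: there \<open>base Om\<close> has to vanish.\<close>
  have "of_nat (symbols_of a x) = (of_nat (Suc m) :: complex)" using m(1) by (cases x) (auto simp: diff_eq_eq add.commute)
  then have "symbols_of a x = Suc m" unfolding of_nat_eq_iff .
  then obtain k where "n = k + Suc m" using assms
    by (auto simp: symbols_def not_less le_iff_add add.commute)
  then have "s n x = (F ^^ k) 0" by (simp only: s_def funpow_add o_apply m(2))
  then show ?thesis by (simp add: pow_lins)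
qed

lemma F_s: "F (s n x) = s (Suc n) x"
  by (simp add: s_def)

lemma E_s: "E (s n x) = sc (of_nat n * (c_wt a x - of_nat n + 1)) (s (n - 1) x)"
  using string_raise base_hw by (simp add: s_def)

lemma H_s: "H (s n x) = sc (c_wt a x - 2 * of_nat n) (s n x)"
  using string_weight base_hw by (simp add: s_def)

lemma Y_s: "Y (s n x) = sc (y_wt a b x) (s n x)"
  using string_Y base_hw by (simp add: s_def)

lemma U_pow: "U ((F ^^ n) x) = (F ^^ n) (U x)"
  by (induct n) (simp_all add: FU[symmetric])

lemma X_pow: "X ((F ^^ n) x) = (F ^^ n) (X x)"
  by (induct n) (simp_all add: FX[symmetric])

text \<open>\<open>X = V F - F V\<close> commutes with \<open>F\<close>, so moving \<open>V\<close>
  past each of the \<open>n\<close> factors contributes the same term.\<close>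

lemma V_pow: "V ((F ^^ n) x) = (F ^^ n) (V x) + sc (of_nat n) ((F ^^ (n - 1)) (X x))"
proof (induct n)
  case (Suc n)
  have V: "V (F f) = F (V f) + X f" for f by (simp add: FV)
  have "F ((F ^^ (n - 1)) (X x)) = (F ^^ n) (X x)" if "n \<noteq> 0" using that by (cases n) auto
  then show ?case using Suc
    by (cases "n = 0") (auto simp: V X_pow lins, auto simp: pointwise algebra_simps)
qed simp

text \<open>Substituting \<open>V F L = F V L + X L\<close> turns \<open>base Om\<close> into
  \<open>- F V L - (a + 1) X L\<close>, which is solved for \<open>X L\<close>.\<close>

lemma X_L: "X L = - sc (1 / (of_nat a + 1)) (base Om + F (V L))"
  using FV[of L] of_nat_add_one_neq_0(1)[of a] by (simp add: pointwise) (simp add: field_simps)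

lemma X_VL: "X (V L) = base VFVLam"
  using FV[of "V L"] by (simp add: VV lins)

text \<open>\<open>X\<close> sends both \<open>F V L\<close> and \<open>V F L\<close> to
  \<open>F V F V L\<close>, for the latter because \<open>X X = 0\<close>; the coefficients of
  \<open>base Om\<close> leave \<open>a - (a + 1) = -1\<close>.\<close>

lemma X_Om: "X (base Om) = - F (base VFVLam)"
proof -
  have V: "V (F f) = F (V f) + X f" for f by (simp add: FV)
  have XV': "V (X f) = - X (V f)" for f by (simp add: XV)
  have "X (V (F L)) = - V (X (F L))" by (simp add: XV)
  also have "\<dots> = - V (F (X L))" by (simp add: FX)
  also have "\<dots> = - F (V (X L)) - X (X L)" by (simp add: V)
  also have "\<dots> = F (X (V L))" by (simp add: XX XV' lins)
  finally have "X (V (F L)) = F (base VFVLam)" by (simp add: X_VL)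
  moreover have "X (F (V L)) = F (base VFVLam)" by (simp only: FX[symmetric] X_VL)
  ultimately show ?thesis by (simp add: lins) (simp add: pointwise algebra_simps)
qed

text \<open>The relations make this vector equal to its own negative.\<close>

lemma X_VFVL: "X (base VFVLam) = 0"
proof -
  have "X (base VFVLam) = - V (X (F (V L)))" by (simp add: XV)
  also have "\<dots> = - V (F (base VFVLam))" by (simp only: FX[symmetric] X_VL)
  also have "\<dots> = - X (base VFVLam)" using FV[of "base VFVLam"] by (simp add: VV lins)
  finally show ?thesis by (simp add: pointwise)
qed

text \<open>The summand \<open>F V L\<close> of \<open>X L\<close> recombines with
  \<open>F^n V L\<close>, which lowers the coefficient from \<open>1\<close> to
  \<open>1 - n / (a + 1)\<close>.\<close>

lemma V_s_Lam:
  "V (s n Lam) = sc (1 - of_nat n / (of_nat a + 1)) (s n VLam) - sc (of_nat n / (of_nat a + 1)) (s (n - 1) Om)"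
proof -
  have "V (s n Lam) = (F ^^ n) (V L)
      - sc (of_nat n / (of_nat a + 1)) ((F ^^ (n - 1)) (base Om) + (F ^^ (n - 1)) (F (V L)))"
    by (simp add: s_def V_pow X_L pow_lins del: base.simps(3))
  moreover have "sc (of_nat n / (of_nat a + 1)) ((F ^^ (n - 1)) (F (V L)))
      = sc (of_nat n / (of_nat a + 1)) ((F ^^ n) (V L))"
    by (cases n) (simp_all add: funpow_swap1)
  ultimately show ?thesis
    by (simp add: s_def fvs.scale_right_distrib fvs.scale_left_diff_distrib
        del: base.simps(3) fvs.scale_cancel_left)
qed

lemma V_s_VLam: "V (s n VLam) = sc (of_nat n) (s (n - 1) VFVLam)"
  by (simp add: s_def V_pow X_VL VV pow_lins)

text \<open>The coefficient \<open>a\<close> is that of \<open>V\<close> on \<open>base Om\<close>,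
  where the second summand dies by \<open>V V = 0\<close>; commuting \<open>V\<close> past
  \<open>F^n\<close> adds \<open>- n\<close> through \<open>X_Om\<close>.\<close>

lemma V_s_Om: "V (s n Om) = sc (of_nat a - of_nat n) (s n VFVLam)"
proof -
  have V: "V (base Om) = sc (of_nat a) (base VFVLam)" by (simp add: VV lins)
  have "F ((F ^^ (n - 1)) (base VFVLam)) = s n VFVLam" if "n \<noteq> 0"
    using that by (cases n) (auto simp: s_def)
  then have "sc (of_nat n) ((F ^^ (n - 1)) (F (base VFVLam))) = sc (of_nat n) (s n VFVLam)"
    by (cases "n = 0") (simp_all add: funpow_swap1)
  then show ?thesis unfolding s_def
    by (simp add: V_pow X_Om V pow_lins del: base.simps fvs.scale_cancel_left) (simp add: pointwise algebra_simps)
qed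

lemma V_s_VFVLam: "V (s n VFVLam) = 0"
proof -
  have "V (base VFVLam) = 0" by (simp add: VV)
  then show ?thesis unfolding s_def by (simp add: V_pow X_VFVL pow_lins del: base.simps)
qed

lemma U_s_Lam: "U (s n Lam) = 0"
  by (simp add: s_def U_pow UL pow_lins)

lemma U_VL: "U (V L) = sc b L"
  by (simp add: UV UL YL HL lins pointwise algebra_simps)

lemma U_s_VLam: "U (s n VLam) = sc b (s n Lam)"
  by (simp add: s_def U_pow U_VL pow_lins)

lemma U_VFL: "U (V (F L)) = sc (b - 1) (F L)"
proof -
  have "Y (F L) + H (F L) = sc (2 * b - 2) (F L)"
    by (simp add: YF HF YL HL lins) (simp add: pointwise algebra_simps)
  then show ?thesis
    by (simp add: UV FU[symmetric] UL lins)
qed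

lemma U_s_Om: "U (s n Om) = sc (of_nat a + 1 - b) (s (n + 1) Lam)"
proof -
  \<comment> \<open>The coefficient is \<open>a b - (a + 1) (b - 1)\<close>.\<close>
  have "U (base Om) = sc (of_nat a + 1 - b) (F L)"
    by (simp add: FU[symmetric] U_VL U_VFL lins) (simp add: pointwise algebra_simps)
  then show ?thesis unfolding s_def by (simp add: U_pow pow_lins funpow_swap1 del: base.simps(3))
qed

lemma U_s_VFVLam:
  "U (s n VFVLam) = sc (b / (of_nat a + 1) - 1) (s (n + 1) VLam) + sc (b / (of_nat a + 1)) (s n Om)"
proof -
  have YH: "Y (F (V L)) + H (F (V L)) = sc (2 * b - 2) (F (V L))"
    by (simp add: YF HF YV HV YL HL lins) (simp add: pointwise algebra_simps)
  have "U (V (F (V L))) = sc (1/2) (sc (2 * b - 2) (F (V L))) - V (F (U (V L)))"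
    by (simp only: UV[of "F (V L)"] YH FU)
  then have "U (base VFVLam) = sc (b - 1) (F (V L)) - sc b (V (F L))"
    by (simp add: U_VL lins)
  \<comment> \<open>Here \<open>V F L\<close> is eliminated in favour of \<open>base Om\<close>,
    using \<open>(a + 1) V F L = a F V L - base Om\<close>. Naming \<open>q = b / (a + 1)\<close>
    makes it a polynomial identity.\<close>
  also have "\<dots> = sc (b / (of_nat a + 1) - 1) (F (V L)) + sc (b / (of_nat a + 1)) (base Om)"
  proof -
    have "sc (q * (of_nat a + 1) - 1) f - sc (q * (of_nat a + 1)) g
        = sc (q - 1) f + sc q (sc (of_nat a) f - sc (of_nat a + 1) g)" for q and f g :: "'a \<Rightarrow> complex"
      by (simp add: pointwise algebra_simps)
    from this[of "b / (of_nat a + 1)" "F (V L)" "V (F L)"] show ?thesis using of_nat_add_one_neq_0(1)[of a] by simp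
  qed
  finally show ?thesis unfolding s_def by (simp add: U_pow pow_lins funpow_swap1 del: base.simps(3,4))
qed

end


section \<open>Homomorphisms, quotients and bases of representations\<close>

lemma module_of_vectorspace: "vectorspace \<CC> V \<Longrightarrow> Module.module \<CC> V"
  by (simp add: vectorspace_def)

lemma abelian_group_of_vectorspace: "vectorspace \<CC> V \<Longrightarrow> abelian_group V"
  by (simp add: vectorspace_def Module.module_def)

lemma subspace_iff:
  assumes "vectorspace \<CC> V"
  shows "VectorSpace.subspace \<CC> N V \<longleftrightarrow> N \<subseteq> carrier V \<and> \<zero>\<^bsub>V\<^esub> \<in> N \<and>
    (\<forall>v\<in>N. \<forall>w\<in>N. v \<oplus>\<^bsub>V\<^esub> w \<in> N) \<and> (\<forall>c. \<forall>v\<in>N. c \<odot>\<^bsub>V\<^esub> v \<in> N)"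
  using assms module_of_vectorspace[OF assms]
  by (auto simp: VectorSpace.subspace_def LinearCombinations.submodule_def)

definition rep_hom :: "'v superrep \<Rightarrow> 'w superrep \<Rightarrow> ('v \<Rightarrow> 'w) \<Rightarrow> bool" where
  "rep_hom R Q p \<longleftrightarrow> p ` carrier R \<subseteq> carrier Q \<and> p \<zero>\<^bsub>R\<^esub> = \<zero>\<^bsub>Q\<^esub> \<and>
     (\<forall>x\<in>carrier R. \<forall>y\<in>carrier R. p (x \<oplus>\<^bsub>R\<^esub> y) = p x \<oplus>\<^bsub>Q\<^esub> p y) \<and>
     (\<forall>c. \<forall>x\<in>carrier R. p (c \<odot>\<^bsub>R\<^esub> x) = c \<odot>\<^bsub>Q\<^esub> p x) \<and>
     p ` even_part R \<subseteq> even_part Q \<and> p ` odd_part R \<subseteq> odd_part Q \<and>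
     (\<forall>g. \<forall>x\<in>carrier R. p (act R g x) = act Q g (p x))"

text \<open>Surjectivity is required on each parity part, so that \<open>Q\<close> receives its
  grading from \<open>R\<close> together with its operations.\<close>

definition rep_epi :: "'v superrep \<Rightarrow> 'w superrep \<Rightarrow> ('v \<Rightarrow> 'w) \<Rightarrow> bool" where
  "rep_epi R Q p \<longleftrightarrow> rep_hom R Q p \<and> p ` carrier R = carrier Q \<and>
     p ` even_part R = even_part Q \<and> p ` odd_part R = odd_part Q"

lemma rep_homD:
  assumes "rep_hom R Q p"
  shows "p \<zero>\<^bsub>R\<^esub> = \<zero>\<^bsub>Q\<^esub>"
    "x \<in> carrier R \<Longrightarrow> p x \<in> carrier Q"
    "x \<in> carrier R \<Longrightarrow> y \<in> carrier R \<Longrightarrow> p (x \<oplus>\<^bsub>R\<^esub> y) = p x \<oplus>\<^bsub>Q\<^esub> p y"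
    "x \<in> carrier R \<Longrightarrow> p (c \<odot>\<^bsub>R\<^esub> x) = c \<odot>\<^bsub>Q\<^esub> p x"
    "x \<in> even_part R \<Longrightarrow> p x \<in> even_part Q" "x \<in> odd_part R \<Longrightarrow> p x \<in> odd_part Q"
    "x \<in> carrier R \<Longrightarrow> p (act R g x) = act Q g (p x)"
  using assms unfolding rep_hom_def by auto

context sl21_rep
begin

sublocale vectorspace \<CC> R by (rule vectorspace)

lemma act_closed [simp, intro]: "x \<in> carrier R \<Longrightarrow> act R g x \<in> carrier R"
  and act_add: "x \<in> carrier R \<Longrightarrow> y \<in> carrier R \<Longrightarrow> act R g (x \<oplus> y) = act R g x \<oplus> act R g y"
  and act_smult: "x \<in> carrier R \<Longrightarrow> act R g (c \<odot> x) = c \<odot> act R g x"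
  using act_linear[of g] by (auto simp: LinearCombinations.module_hom_def)

lemma smult_closed' [simp, intro]: "x \<in> carrier R \<Longrightarrow> c \<odot> x \<in> carrier R"
  using smult_closed[of c x] by simp

lemma zero_smult [simp]: "x \<in> carrier R \<Longrightarrow> 0 \<odot> x = \<zero>"
  and one_smult [simp]: "x \<in> carrier R \<Longrightarrow> 1 \<odot> x = x"
  using smult_l_null[of x] smult_one[of x] by simp_all

lemmas subD = subspace_iff[OF vectorspace, THEN iffD1]
lemmas evenD = subD[OF even_subspace] and oddD = subD[OF odd_subspace]

lemma even_carrier: "x \<in> even_part R \<Longrightarrow> x \<in> carrier R"
  and odd_carrier: "x \<in> odd_part R \<Longrightarrow> x \<in> carrier R"
  using evenD oddD by auto

lemma even_odd_decompose:
  assumes "x \<in> carrier R"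
  obtains e u where "e \<in> even_part R" "u \<in> odd_part R" "x = e \<oplus> u"
  using assms unfolding even_odd_sum[symmetric] set_add_def' by auto

lemma minus_eq_smult: "x \<in> carrier R \<Longrightarrow> \<ominus> x = (-1) \<odot> x"
  using smult_l_minus[of 1 x] smult_one[of x] by (simp add: class_ring_simps)

lemma sub_minus:
  assumes "VectorSpace.subspace \<CC> N R" "x \<in> N" "y \<in> N" shows "x \<ominus> y \<in> N"
proof -
  have "y \<in> carrier R" using subD[OF assms(1)] assms(3) by auto
  then show ?thesis using subD[OF assms(1)] assms(2,3) by (simp add: a_minus_def minus_eq_smult)
qed

end

lemma rep_hom_minus:
  assumes "vectorspace \<CC> R" "vectorspace \<CC> Q" "rep_hom R Q p" "x \<in> carrier R" "y \<in> carrier R"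
  shows "p (\<ominus>\<^bsub>R\<^esub> x) = \<ominus>\<^bsub>Q\<^esub> p x" "p (x \<ominus>\<^bsub>R\<^esub> y) = p x \<ominus>\<^bsub>Q\<^esub> p y"
proof -
  interpret R: vectorspace \<CC> R by fact
  interpret Q: vectorspace \<CC> Q by fact
  note h = rep_homD[OF assms(3)]
  have *: "p (\<ominus>\<^bsub>R\<^esub> x) = \<ominus>\<^bsub>Q\<^esub> p x" if "x \<in> carrier R" for x
  proof -
    have "p (\<ominus>\<^bsub>R\<^esub> x) \<oplus>\<^bsub>Q\<^esub> p x = \<zero>\<^bsub>Q\<^esub>"
      using that by (simp add: h(3)[symmetric] h(1) R.l_neg)
    then show ?thesis using that h(2) by (simp add: Q.minus_equality)
  qed
  show "p (\<ominus>\<^bsub>R\<^esub> x) = \<ominus>\<^bsub>Q\<^esub> p x" "p (x \<ominus>\<^bsub>R\<^esub> y) = p x \<ominus>\<^bsub>Q\<^esub> p y"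
    using assms(4,5) by (simp_all add: * a_minus_def h(3))
qed

lemma rep_hom_finsum:
  assumes "vectorspace \<CC> R" "vectorspace \<CC> Q" "rep_hom R Q p" "finite I" "f \<in> I \<rightarrow> carrier R"
  shows "p (\<Oplus>\<^bsub>R\<^esub>i\<in>I. f i) = (\<Oplus>\<^bsub>Q\<^esub>i\<in>I. p (f i))"
proof -
  interpret R: vectorspace \<CC> R by fact
  interpret Q: vectorspace \<CC> Q by fact
  note h = rep_homD[OF assms(3)]
  show ?thesis using assms(4,5)
  proof (induct I)
    case (insert i I)
    then have "f \<in> I \<rightarrow> carrier R" "(\<lambda>i. p (f i)) \<in> I \<rightarrow> carrier Q" using h(2) by auto
    with insert h(2) show ?case by (simp add: h(3) Pi_iff)
  qed (simp add: h)
qed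

text \<open>\<open>Q\<close> is a bare record here: each axiom is pulled back to \<open>R\<close>
  along preimages. This is how \<open>quot_rep\<close> becomes a vector space.\<close>

lemma rep_epi_vectorspace:
  assumes R: "vectorspace \<CC> R" and p: "rep_epi R Q p"
  shows "vectorspace \<CC> Q"
proof -
  interpret R: vectorspace \<CC> R by fact
  have hom: "rep_hom R Q p" using p by (simp add: rep_epi_def)
  note h = rep_homD[OF hom]
  have sur: "\<exists>x\<in>carrier R. v = p x" if "v \<in> carrier Q" for v
    using p that unfolding rep_epi_def by blast
  have sc: "c \<odot>\<^bsub>R\<^esub> x \<in> carrier R" if "x \<in> carrier R" for c x using R.smult_closed[of c x] that by simp
  note hs = h(1)[symmetric] h(3)[symmetric] h(4)[symmetric]
  show ?thesis
  proof (rule vs_criteria)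
    show "field \<CC>" by (rule class_field)
    show "\<zero>\<^bsub>Q\<^esub> \<in> carrier Q" using h(2)[of "\<zero>\<^bsub>R\<^esub>"] by (simp add: h(1))
    show "\<forall>v w. v \<in> carrier Q \<and> w \<in> carrier Q \<longrightarrow> v \<oplus>\<^bsub>Q\<^esub> w \<in> carrier Q"
      by (auto dest!: sur simp: hs intro!: h(2))
    show "\<forall>v\<in>carrier Q. \<exists>neg_v\<in>carrier Q. v \<oplus>\<^bsub>Q\<^esub> neg_v = \<zero>\<^bsub>Q\<^esub>"
    proof
      fix v assume "v \<in> carrier Q"
      then obtain x where "x \<in> carrier R" "v = p x" using sur by auto
      then show "\<exists>neg_v\<in>carrier Q. v \<oplus>\<^bsub>Q\<^esub> neg_v = \<zero>\<^bsub>Q\<^esub>"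
        by (intro bexI[of _ "p (\<ominus>\<^bsub>R\<^esub> x)"]) (auto simp: hs R.r_neg intro!: h(2))
    qed
    show "\<forall>c v. c \<in> carrier \<CC> \<and> v \<in> carrier Q \<longrightarrow> c \<odot>\<^bsub>Q\<^esub> v \<in> carrier Q"
      by (auto dest!: sur simp: hs sc intro!: h(2))
    show "\<forall>v w. v \<in> carrier Q \<and> w \<in> carrier Q \<longrightarrow> v \<oplus>\<^bsub>Q\<^esub> w = w \<oplus>\<^bsub>Q\<^esub> v"
      by (auto dest!: sur simp: hs R.a_comm)
    show "\<forall>v w x. v \<in> carrier Q \<and> w \<in> carrier Q \<and> x \<in> carrier Q \<longrightarrow>
        v \<oplus>\<^bsub>Q\<^esub> w \<oplus>\<^bsub>Q\<^esub> x = v \<oplus>\<^bsub>Q\<^esub> (w \<oplus>\<^bsub>Q\<^esub> x)"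
      by (auto dest!: sur simp: hs R.a_assoc)
    show "\<forall>v\<in>carrier Q. v \<oplus>\<^bsub>Q\<^esub> \<zero>\<^bsub>Q\<^esub> = v"
      by (auto dest!: sur simp: hs)
    show "\<forall>a b v. a \<in> carrier \<CC> \<and> b \<in> carrier \<CC> \<and> v \<in> carrier Q \<longrightarrow>
        (a \<otimes>\<^bsub>\<CC>\<^esub> b) \<odot>\<^bsub>Q\<^esub> v = a \<odot>\<^bsub>Q\<^esub> (b \<odot>\<^bsub>Q\<^esub> v)"
      using R.smult_assoc1 by (auto dest!: sur simp: hs sc)
    show "\<forall>v\<in>carrier Q. \<one>\<^bsub>\<CC>\<^esub> \<odot>\<^bsub>Q\<^esub> v = v"
      using R.smult_one by (auto dest!: sur simp: hs)
    show "\<forall>a b v. a \<in> carrier \<CC> \<and> b \<in> carrier \<CC> \<and> v \<in> carrier Q \<longrightarrow>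
        (a \<oplus>\<^bsub>\<CC>\<^esub> b) \<odot>\<^bsub>Q\<^esub> v = a \<odot>\<^bsub>Q\<^esub> v \<oplus>\<^bsub>Q\<^esub> b \<odot>\<^bsub>Q\<^esub> v"
      using R.smult_l_distr by (auto dest!: sur simp: hs sc)
    show "\<forall>a v w. a \<in> carrier \<CC> \<and> v \<in> carrier Q \<and> w \<in> carrier Q \<longrightarrow>
        a \<odot>\<^bsub>Q\<^esub> (v \<oplus>\<^bsub>Q\<^esub> w) = a \<odot>\<^bsub>Q\<^esub> v \<oplus>\<^bsub>Q\<^esub> a \<odot>\<^bsub>Q\<^esub> w"
      using R.smult_r_distr by (auto dest!: sur simp: hs sc)
  qed
qed

lemma rep_hom_image_subspace:
  assumes R: "vectorspace \<CC> R" and Q: "vectorspace \<CC> Q" and p: "rep_hom R Q p"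
    and N: "VectorSpace.subspace \<CC> N R"
  shows "VectorSpace.subspace \<CC> (p ` N) Q"
proof -
  note h = rep_homD[OF p]
  note hs = h(1)[symmetric] h(3)[symmetric] h(4)[symmetric]
  have N: "N \<subseteq> carrier R" "\<zero>\<^bsub>R\<^esub> \<in> N" "\<And>v w. v \<in> N \<Longrightarrow> w \<in> N \<Longrightarrow> v \<oplus>\<^bsub>R\<^esub> w \<in> N"
    "\<And>c v. v \<in> N \<Longrightarrow> c \<odot>\<^bsub>R\<^esub> v \<in> N"
    using N unfolding subspace_iff[OF R] by auto
  then show ?thesis unfolding subspace_iff[OF Q]
    using N(1) h(2) by (auto simp: hs subset_iff)
qed

lemma rep_hom_image_set_add:
  assumes "rep_hom R Q p" "A \<subseteq> carrier R" "B \<subseteq> carrier R"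
  shows "p ` (A <+>\<^bsub>R\<^esub> B) = p ` A <+>\<^bsub>Q\<^esub> p ` B"
  using assms(2,3) rep_homD(3)[OF assms(1)]
  unfolding set_add_def' by (auto simp: image_iff subset_iff) force+

text \<open>Everything in the definition of a representation passes to images except directness of
  the grading: images of complementary subspaces may overlap. Hence the hypothesis
  \<open>disj\<close>.\<close>

lemma rep_epi_sl21_rep:
  assumes R: "sl21_rep R" and p: "rep_epi R Q p"
    and disj: "even_part Q \<inter> odd_part Q \<subseteq> {\<zero>\<^bsub>Q\<^esub>}"
  shows "sl21_rep Q"
proof -
  interpret R: sl21_rep R by fact
  have vsR: "vectorspace \<CC> R" by (rule R.vectorspace)
  have vsQ: "vectorspace \<CC> Q" by (rule rep_epi_vectorspace[OF vsR p])
  have hom: "rep_hom R Q p" using p by (simp add: rep_epi_def)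
  note h = rep_homD[OF hom] and hm1 = rep_hom_minus(1)[OF vsR vsQ hom _ R.zero_closed]
    and hm2 = rep_hom_minus(2)[OF vsR vsQ hom]
  have img: "p ` carrier R = carrier Q" "p ` even_part R = even_part Q" "p ` odd_part R = odd_part Q"
    using p by (auto simp: rep_epi_def)
  have sur: "\<exists>x\<in>carrier R. v = p x" if "v \<in> carrier Q" for v using img(1) that by blast
  have comm: "comm Q g k (p x) = p (comm R g k x)" "acomm Q g k (p x) = p (acomm R g k x)"
    if "x \<in> carrier R" for g k x
    using that by (simp_all add: comm_def acomm_def h hm2)
  show ?thesis
  proof (rule sl21_rep.intro)
    show "vectorspace \<CC> Q" by fact
    show ev: "VectorSpace.subspace \<CC> (even_part Q) Q" and od: "VectorSpace.subspace \<CC> (odd_part Q) Q"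
      using rep_hom_image_subspace[OF vsR vsQ hom R.even_subspace]
        rep_hom_image_subspace[OF vsR vsQ hom R.odd_subspace] by (simp_all add: img)
    show "even_part Q <+>\<^bsub>Q\<^esub> odd_part Q = carrier Q"
      using rep_hom_image_set_add[OF hom, of "even_part R" "odd_part R"] R.evenD R.oddD
      by (simp add: R.even_odd_sum img)
    show "even_part Q \<inter> odd_part Q = {\<zero>\<^bsub>Q\<^esub>}"
      using disj ev od unfolding subspace_iff[OF vsQ] by blast
    show "act Q g \<in> LinearCombinations.module_hom \<CC> Q Q" for g
      unfolding LinearCombinations.module_hom_def
      by (auto dest!: sur simp: h(3,4,7)[symmetric] R.act_add R.act_smult intro!: h(2))
    show "act Q g ` even_part Q \<subseteq> even_part Q" "act Q g ` odd_part Q \<subseteq> odd_part Q" if "g \<in> even_gens" for g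
      using R.even_gen_even[OF that] R.even_gen_odd[OF that] R.even_carrier R.odd_carrier
      unfolding img[symmetric] by (auto simp: h(7)[symmetric])
    show "act Q g ` even_part Q \<subseteq> odd_part Q" "act Q g ` odd_part Q \<subseteq> even_part Q" if "g \<in> odd_gens" for g
      using R.odd_gen_even[OF that] R.odd_gen_odd[OF that] R.even_carrier R.odd_carrier
      unfolding img[symmetric] by (auto simp: h(7)[symmetric])
  qed (drule sur, elim bexE, hypsubst,
      simp add: comm R.even_even R.H_odd R.Y_odd R.EF_odd R.odd_odd h hm1 hm2)+
qed

lemma linear_map_of_rep_hom:
  assumes R: "vectorspace \<CC> R" and Q: "vectorspace \<CC> Q" and p: "rep_hom R Q p"
  shows "linear_map \<CC> R Q p"
  using R Q module_of_vectorspace[OF R] module_of_vectorspace[OF Q] p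
  by (auto simp: linear_map_def mod_hom_def mod_hom_axioms_def LinearCombinations.module_hom_def rep_hom_def)

lemma rep_epi_fd_rep:
  assumes R: "fd_rep R" and p: "rep_epi R Q p" and disj: "even_part Q \<inter> odd_part Q \<subseteq> {\<zero>\<^bsub>Q\<^esub>}"
  shows "fd_rep Q"
proof -
  have r: "sl21_rep R" using R by (simp add: fd_rep_def)
  have q: "sl21_rep Q" by (rule rep_epi_sl21_rep[OF r p disj])
  have "linear_map \<CC> R Q p"
    using p by (intro linear_map_of_rep_hom sl21_rep.vectorspace r q) (simp add: rep_epi_def)
  then show ?thesis using q R p linear_map.surj_fin_dim[of \<CC> R Q p] by (simp add: fd_rep_def rep_epi_def)
qed

lemma rep_hom_image_subrep:
  assumes R: "sl21_rep R" and Q: "sl21_rep Q" and p: "rep_hom R Q p" and N: "subrep N R"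
  shows "subrep (p ` N) Q"
proof -
  interpret R: sl21_rep R by fact
  interpret Q: sl21_rep Q by fact
  note h = rep_homD[OF p]
  have sub: "VectorSpace.subspace \<CC> N R" and gr: "N = (N \<inter> even_part R) <+>\<^bsub>R\<^esub> (N \<inter> odd_part R)"
    and act: "\<And>g. act R g ` N \<subseteq> N" using N by (auto simp: subrep_def)
  have Nc: "N \<subseteq> carrier R" using R.subD[OF sub] by simp
  have sub': "VectorSpace.subspace \<CC> (p ` N) Q"
    by (rule rep_hom_image_subspace[OF R.vectorspace Q.vectorspace p sub])
  have "p ` N = p ` (N \<inter> even_part R) <+>\<^bsub>Q\<^esub> p ` (N \<inter> odd_part R)"
    using gr Nc rep_hom_image_set_add[OF p, of "N \<inter> even_part R" "N \<inter> odd_part R"] by auto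
  also have "\<dots> \<subseteq> (p ` N \<inter> even_part Q) <+>\<^bsub>Q\<^esub> (p ` N \<inter> odd_part Q)"
    using h(5,6) unfolding set_add_def' by blast
  finally have "p ` N \<subseteq> (p ` N \<inter> even_part Q) <+>\<^bsub>Q\<^esub> (p ` N \<inter> odd_part Q)" .
  moreover have "(p ` N \<inter> even_part Q) <+>\<^bsub>Q\<^esub> (p ` N \<inter> odd_part Q) \<subseteq> p ` N"
    using Q.subD[OF sub'] unfolding set_add_def' by auto
  moreover have "act Q g ` p ` N \<subseteq> p ` N" for g
    using act[of g] Nc by (auto simp: h(7)[symmetric] subset_iff)
  ultimately show ?thesis using sub' by (simp add: subrep_def subset_antisym)
qed

lemma carrier_subrep:
  assumes "sl21_rep R" shows "subrep (carrier R) R"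
proof -
  interpret R: sl21_rep R by fact
  have "VectorSpace.subspace \<CC> (carrier R) R" unfolding subspace_iff[OF R.vectorspace] by auto
  moreover have "carrier R \<inter> even_part R = even_part R" "carrier R \<inter> odd_part R = odd_part R"
    using R.evenD R.oddD by auto
  ultimately show ?thesis by (auto simp: subrep_def R.even_odd_sum)
qed

text \<open>Split a preimage of a homogeneous \<open>v\<close> by parity. The component of the wrong
  parity has an image that is a difference of two vectors of the parity of \<open>v\<close>, so it
  is both even and odd and vanishes.\<close>

lemma rep_hom_surj_epi:
  assumes R: "sl21_rep R" and Q: "sl21_rep Q" and p: "rep_hom R Q p" and sur: "p ` carrier R = carrier Q"
  shows "rep_epi R Q p"
proof -
  interpret R: sl21_rep R by fact
  interpret Q: sl21_rep Q by fact
  note h = rep_homD[OF p]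
  have "v \<in> p ` even_part R" if v: "v \<in> even_part Q" for v
  proof -
    obtain x where x: "x \<in> carrier R" "v = p x" using sur Q.even_carrier[OF v] by auto
    obtain e u where eu: "e \<in> even_part R" "u \<in> odd_part R" "x = e \<oplus>\<^bsub>R\<^esub> u"
      using R.even_odd_decompose[OF x(1)] .
    have c: "p e \<in> carrier Q" "p u \<in> carrier Q" using eu h(2) R.even_carrier R.odd_carrier by auto
    have v': "v = p e \<oplus>\<^bsub>Q\<^esub> p u" using x eu R.even_carrier R.odd_carrier by (simp add: h(3))
    then have "p u = v \<ominus>\<^bsub>Q\<^esub> p e" using c by (simp add: a_minus_def Q.a_comm[of "p e"] Q.a_assoc Q.r_neg)
    then have "p u \<in> even_part Q" using v h(5)[OF eu(1)] Q.sub_minus[OF Q.even_subspace] by simp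
    then have "p u = \<zero>\<^bsub>Q\<^esub>" using h(6)[OF eu(2)] Q.even_odd_disjoint by auto
    then show ?thesis using v' c eu by auto
  qed
  moreover have "v \<in> p ` odd_part R" if v: "v \<in> odd_part Q" for v
  proof -
    obtain x where x: "x \<in> carrier R" "v = p x" using sur Q.odd_carrier[OF v] by auto
    obtain e u where eu: "e \<in> even_part R" "u \<in> odd_part R" "x = e \<oplus>\<^bsub>R\<^esub> u"
      using R.even_odd_decompose[OF x(1)] .
    have c: "p e \<in> carrier Q" "p u \<in> carrier Q" using eu h(2) R.even_carrier R.odd_carrier by auto
    have v': "v = p e \<oplus>\<^bsub>Q\<^esub> p u" using x eu R.even_carrier R.odd_carrier by (simp add: h(3))
    then have "p e = v \<ominus>\<^bsub>Q\<^esub> p u" using c by (simp add: a_minus_def Q.a_assoc Q.r_neg)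
    then have "p e \<in> odd_part Q" using v h(6)[OF eu(2)] Q.sub_minus[OF Q.odd_subspace] by simp
    then have "p e = \<zero>\<^bsub>Q\<^esub>" using h(5)[OF eu(1)] Q.even_odd_disjoint by auto
    then show ?thesis using v' c eu by auto
  qed
  ultimately show ?thesis using p sur h(5,6) by (auto simp: rep_epi_def)
qed

text \<open>A symmetric form of the first isomorphism theorem: \<open>f\<close> and \<open>p\<close>
  have the same fibres, so \<open>p\<close> of an arbitrary preimage under \<open>f\<close> is well
  defined and injective.\<close>

lemma rep_iso_common_kernel:
  assumes f: "rep_epi R S f" and p: "rep_epi R Q p" and R: "sl21_rep R"
    and ker: "\<And>x y. x \<in> carrier R \<Longrightarrow> y \<in> carrier R \<Longrightarrow> f x = f y \<longleftrightarrow> p x = p y"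
  shows "S \<cong>\<^sub>r Q"
proof -
  interpret R: sl21_rep R by fact
  have fh: "rep_hom R S f" and ph: "rep_hom R Q p" using f p by (auto simp: rep_epi_def)
  note f' = rep_homD[OF fh] and p' = rep_homD[OF ph]
  define k where "k s = p (SOME x. x \<in> carrier R \<and> f x = s)" for s
  have k: "k (f x) = p x" if "x \<in> carrier R" for x
  proof -
    have "\<exists>y. y \<in> carrier R \<and> f y = f x" using that by auto
    from someI_ex[OF this] ker that show ?thesis unfolding k_def by auto
  qed
  have imf: "f ` carrier R = carrier S" "f ` even_part R = even_part S" "f ` odd_part R = odd_part S"
    and imp: "p ` carrier R = carrier Q" "p ` even_part R = even_part Q" "p ` odd_part R = odd_part Q"
    using f p by (auto simp: rep_epi_def)
  have "k \<in> LinearCombinations.module_hom \<CC> S Q"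
    unfolding LinearCombinations.module_hom_def imf(1)[symmetric]
    by (auto simp: f'(3,4)[symmetric] k p')
  moreover have "k ` carrier S = carrier Q" "k ` even_part S = even_part Q" "k ` odd_part S = odd_part Q"
    unfolding imf[symmetric] imp[symmetric] image_image
    using R.even_carrier R.odd_carrier k by (auto intro!: image_cong)
  moreover have "inj_on k (carrier S)" unfolding imf(1)[symmetric] using ker by (auto intro!: inj_onI simp: k)
  moreover have "\<forall>g. \<forall>v\<in>carrier S. k (act S g v) = act Q g (k v)"
    unfolding imf(1)[symmetric] by (auto simp: f'(7)[symmetric] k p'(7))
  ultimately show ?thesis unfolding rep_iso_def bij_betw_def by blast
qed

section \<open>Quotient representations\<close>

context sl21_rep
begin

lemma subrep_abelian_subgroup:
  assumes "VectorSpace.subspace \<CC> N R" shows "abelian_subgroup N R"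
proof (rule abelian_subgroupI3)
  show "abelian_group R" by (rule abelian_group_of_vectorspace[OF vectorspace])
  show "additive_subgroup N R"
    unfolding additive_subgroup_def
  proof (rule add.subgroupI)
    show "\<ominus> x \<in> N" if "x \<in> N" for x
      using that subD[OF assms] minus_eq_smult[of x] by auto
  qed (use subD[OF assms] in auto)
qed

lemma coset_eq_iff:
  assumes N: "VectorSpace.subspace \<CC> N R" and xy: "x \<in> carrier R" "y \<in> carrier R"
  shows "N +> x = N +> y \<longleftrightarrow> x \<ominus> y \<in> N"
proof -
  interpret N: abelian_subgroup N R by (rule subrep_abelian_subgroup[OF N])
  have mem: "z \<in> N +> w \<longleftrightarrow> z \<ominus> w \<in> N" if "z \<in> carrier R" "w \<in> carrier R" for z w
    using N.a_rcos_module[of w z] abelian_group_of_vectorspace[OF vectorspace] that by (simp add: a_minus_def)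
  show ?thesis
    using N.a_rcos_self[OF xy(1)] N.a_repr_independence'[of x y] mem[OF xy] xy by metis
qed

text \<open>Operations of \<open>quot_rep\<close> are unions over all representatives of a coset.
  For additive \<open>T\<close> preserving \<open>N\<close> all members of the union coincide, so
  one representative suffices.\<close>

lemma coset_union:
  assumes N: "VectorSpace.subspace \<CC> N R" and x: "x \<in> carrier R"
    and T: "\<And>z. z \<in> carrier R \<Longrightarrow> T z \<in> carrier R"
    "\<And>y z. y \<in> carrier R \<Longrightarrow> z \<in> carrier R \<Longrightarrow> T (y \<oplus> z) = T y \<oplus> T z"
    "\<And>z. z \<in> N \<Longrightarrow> T z \<in> N"
  shows "(\<Union>y\<in>N +> x. N +> T y) = N +> T x"
proof -
  interpret N: abelian_subgroup N R by (rule subrep_abelian_subgroup[OF N])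
  have "N +> T y = N +> T x" if "y \<in> N +> x" for y
  proof -
    have "y \<in> (\<Union>h\<in>N. {h \<oplus> x})" using that by (simp only: a_r_coset_def')
    then obtain n where n: "n \<in> N" "y = n \<oplus> x" by auto
    then have nc: "n \<in> carrier R" using subD[OF N] by auto
    have "T y \<ominus> T x = T n" using n nc x T(1) by (simp add: T(2) a_minus_def a_assoc r_neg)
    then show ?thesis using n nc x T by (subst coset_eq_iff[OF N]) auto
  qed
  moreover have "x \<in> N +> x" using x by (rule N.a_rcos_self)
  ultimately show ?thesis by blast
qed

lemma quot_rep_epi:
  assumes N: "subrep N R"
  shows "rep_epi R (quot_rep R N) (\<lambda>x. N +> x)"
proof -
  have sub: "VectorSpace.subspace \<CC> N R" and act: "\<And>g. act R g ` N \<subseteq> N" using N by (auto simp: subrep_def)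
  interpret N: abelian_subgroup N R by (rule subrep_abelian_subgroup[OF sub])
  have 1: "act (quot_rep R N) g (N +> x) = N +> act R g x" if "x \<in> carrier R" for g x
    using coset_union[OF sub that, of "act R g"] act by (auto simp: quot_rep_def act_add)
  have 2: "c \<odot>\<^bsub>quot_rep R N\<^esub> (N +> x) = N +> (c \<odot> x)" if "x \<in> carrier R" for c x
    using coset_union[OF sub that, of "\<lambda>x. c \<odot> x"] subD[OF sub] smult_r_distr[of c]
    by (auto simp: quot_rep_def)
  have 3: "carrier (quot_rep R N) = (\<lambda>x. N +> x) ` carrier R"
    "even_part (quot_rep R N) = (\<lambda>x. N +> x) ` even_part R"
    "odd_part (quot_rep R N) = (\<lambda>x. N +> x) ` odd_part R"
    by (auto simp: quot_rep_def A_RCOSETS_def')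
  have 4: "N +> \<zero> = \<zero>\<^bsub>quot_rep R N\<^esub>" using N.a_rcos_const[of \<zero>] by (simp add: quot_rep_def)
  have 5: "N +> (x \<oplus> y) = (N +> x) \<oplus>\<^bsub>quot_rep R N\<^esub> (N +> y)" if "x \<in> carrier R" "y \<in> carrier R" for x y
    using N.a_rcos_sum[OF that] by (simp add: quot_rep_def)
  show ?thesis unfolding rep_epi_def rep_hom_def using 1 2 3 4 5 by auto
qed

text \<open>This is where \<open>N\<close> has to be graded. If an even \<open>e\<close> and an odd
  \<open>u\<close> are congruent, write \<open>e - u = e' + u'\<close> with homogeneous
  \<open>e'\<close>, \<open>u'\<close> in \<open>N\<close>; then \<open>e - e' = u' + u\<close> is
  even and odd, so \<open>e = e'\<close> lies in \<open>N\<close>.\<close>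

lemma quot_rep_disjoint:
  assumes N: "subrep N R"
  shows "even_part (quot_rep R N) \<inter> odd_part (quot_rep R N) \<subseteq> {\<zero>\<^bsub>quot_rep R N\<^esub>}"
proof
  have sub: "VectorSpace.subspace \<CC> N R" and gr: "N = (N \<inter> even_part R) <+> (N \<inter> odd_part R)"
    using N by (auto simp: subrep_def)
  interpret N: abelian_subgroup N R by (rule subrep_abelian_subgroup[OF sub])
  fix A assume "A \<in> even_part (quot_rep R N) \<inter> odd_part (quot_rep R N)"
  then obtain e u where eu: "e \<in> even_part R" "u \<in> odd_part R" "A = N +> e" "A = N +> u"
    by (auto simp: quot_rep_def)
  have c: "e \<in> carrier R" "u \<in> carrier R" using eu even_carrier odd_carrier by auto
  have "e \<ominus> u \<in> N" using eu coset_eq_iff[OF sub c] by simp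
  then obtain e' u' where n: "e' \<in> N" "e' \<in> even_part R" "u' \<in> N" "u' \<in> odd_part R" "e \<ominus> u = e' \<oplus> u'"
    using gr[unfolded set_add_def'] by blast
  have c': "e' \<in> carrier R" "u' \<in> carrier R" using n even_carrier odd_carrier by auto
  have "e = (e' \<oplus> u') \<oplus> u" unfolding n(5)[symmetric] using c by (simp add: a_minus_def a_assoc l_neg)
  then have "e \<ominus> e' = u' \<oplus> u" using c c' by (simp add: a_minus_def a_assoc a_comm r_neg2 r_neg1)
     (metis a_closed a_comm a_inv_closed a_assoc r_neg1)
  moreover have "e \<ominus> e' \<in> even_part R" using eu n sub_minus[OF even_subspace] by auto
  moreover have "u' \<oplus> u \<in> odd_part R" using eu n oddD by auto
  ultimately have "e \<ominus> e' = \<zero>" using even_odd_disjoint by auto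
  moreover have "e = (e \<ominus> e') \<oplus> e'" using c c' by (simp add: a_minus_def a_assoc l_neg)
  ultimately have "e = e'" using c' by simp
  then show "A \<in> {\<zero>\<^bsub>quot_rep R N\<^esub>}" using eu n N.a_rcos_const by (simp add: quot_rep_def)
qed

end

text \<open>A basis is a set, whereas matrices need a family; independence of the family also yields
  injectivity.\<close>

lemma indexed_basisI:
  assumes V: "vectorspace \<CC> R" and I: "finite I" and e: "\<And>i. i \<in> I \<Longrightarrow> e i \<in> carrier R"
    and gen: "\<And>v. v \<in> carrier R \<Longrightarrow> \<exists>c. v = (\<Oplus>\<^bsub>R\<^esub>i\<in>I. c i \<odot>\<^bsub>R\<^esub> e i)"
    and ind: "\<And>c i. (\<Oplus>\<^bsub>R\<^esub>i\<in>I. c i \<odot>\<^bsub>R\<^esub> e i) = \<zero>\<^bsub>R\<^esub> \<Longrightarrow> i \<in> I \<Longrightarrow> c i = 0"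
  shows "is_indexed_basis R I e"
proof -
  interpret V: vectorspace \<CC> R by fact
  have sc: "c \<odot>\<^bsub>R\<^esub> x \<in> carrier R" if "x \<in> carrier R" for c x using V.smult_closed[of c x] that by simp
  have inj: "inj_on e I"
  proof (rule inj_onI, rule ccontr)
    fix i j assume ij: "i \<in> I" "j \<in> I" "e i = e j" "i \<noteq> j"
    \<comment> \<open>The coefficients of the relation \<open>e i - e j = 0\<close>.\<close>
    define c where "c k = (if k = i then 1 else if k = j then -1 else (0::complex))" for k
    define J where "J = I - {i, j}"
    have J: "i \<notin> insert j J" "j \<notin> J" "finite J" "insert i (insert j J) = I"
      using ij I by (auto simp: J_def)
    have mem: "k \<in> carrier R" if "k \<in> e ` J" for k using that e by (auto simp: J_def)
    have "(\<Oplus>\<^bsub>R\<^esub>k\<in>insert i (insert j J). c k \<odot>\<^bsub>R\<^esub> e k)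
        = c i \<odot>\<^bsub>R\<^esub> e i \<oplus>\<^bsub>R\<^esub> (c j \<odot>\<^bsub>R\<^esub> e j \<oplus>\<^bsub>R\<^esub> (\<Oplus>\<^bsub>R\<^esub>k\<in>J. c k \<odot>\<^bsub>R\<^esub> e k))"
      using J(1-3) ij e sc mem by (simp add: Pi_iff)
    also have "(\<Oplus>\<^bsub>R\<^esub>k\<in>J. c k \<odot>\<^bsub>R\<^esub> e k) = (\<Oplus>\<^bsub>R\<^esub>k\<in>J. \<zero>\<^bsub>R\<^esub>)"
    proof (rule V.finsum_cong')
      fix k assume "k \<in> J"
      then show "c k \<odot>\<^bsub>R\<^esub> e k = \<zero>\<^bsub>R\<^esub>"
        using mem[of "e k"] V.smult_l_null[of "e k"] by (simp add: c_def J_def)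
    qed auto
    also have "c i \<odot>\<^bsub>R\<^esub> e i \<oplus>\<^bsub>R\<^esub> (c j \<odot>\<^bsub>R\<^esub> e j \<oplus>\<^bsub>R\<^esub> (\<Oplus>\<^bsub>R\<^esub>k\<in>J. \<zero>\<^bsub>R\<^esub>)) = \<zero>\<^bsub>R\<^esub>"
      using ij(4) e[OF ij(2)] sc[OF e[OF ij(2)]] V.smult_l_distr[of 1 "-1" "e j"] V.smult_l_null[of "e j"] ij(3)
      by (simp add: c_def)
    finally have "(\<Oplus>\<^bsub>R\<^esub>k\<in>I. c k \<odot>\<^bsub>R\<^esub> e k) = \<zero>\<^bsub>R\<^esub>" unfolding J(4) .
    then have "c i = 0" using ind ij(1) by blast
    then show False by (simp add: c_def)
  qed
  have lc: "V.lincomb c (e ` I) = (\<Oplus>\<^bsub>R\<^esub>i\<in>I. c (e i) \<odot>\<^bsub>R\<^esub> e i)" for c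
    unfolding V.lincomb_def using e sc inj by (intro V.finsum_reindex) auto
  have sub: "e ` I \<subseteq> carrier R" using e by auto
  have "V.lin_indpt (e ` I)"
  proof (rule V.finite_lin_indpt2)
    fix c assume "V.lincomb c (e ` I) = \<zero>\<^bsub>R\<^esub>"
    then have "c (e i) = 0" if "i \<in> I" for i using ind[of "\<lambda>i. c (e i)" i] that by (simp only: lc)
    then show "\<forall>v\<in>e ` I. c v = \<zero>\<^bsub>\<CC>\<^esub>" by simp
  qed (use I sub in auto)
  moreover have "V.gen_set (e ` I)"
  proof
    show "V.span (e ` I) \<subseteq> carrier R" using sub by auto
    show "carrier R \<subseteq> V.span (e ` I)"
    proof
      fix v assume "v \<in> carrier R"
      then obtain c where c: "v = (\<Oplus>\<^bsub>R\<^esub>i\<in>I. c i \<odot>\<^bsub>R\<^esub> e i)" using gen by blast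
      have "v = V.lincomb (\<lambda>w. c (the_inv_into I e w)) (e ` I)"
        unfolding lc c using e sc inj by (intro V.finsum_cong') (auto simp: the_inv_into_f_f)
      then show "v \<in> V.span (e ` I)" unfolding V.finite_span[OF finite_imageI[OF I] sub] by auto
    qed
  qed
  ultimately show ?thesis using I inj sub unfolding is_indexed_basis_def V.basis_def by auto
qed


section \<open>The module \<open>M(a,b)\<close> in coordinates\<close>

lemma vec_ops: "vadd f g = f + g" "vzero = 0" "vsmult c f = sc c f" "vsub f g = f - g"
  by (auto simp: vadd_def vzero_def vsmult_def vsub_def pointwise)

lemma finite_symbols: "finite (symbols a)"
proof -
  have "symbols a \<subseteq> {Lam, VLam, Om, VFVLam} \<times> {..<a + 2}"
  proof
    fix i assume "i \<in> symbols a"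
    then show "i \<in> {Lam, VLam, Om, VFVLam} \<times> {..<a + 2}"
      by (cases i; cases "fst i") (auto simp: symbols_def)
  qed
  then show ?thesis by (rule finite_subset) simp
qed

lemma M_rep_sel [simp]:
  "carrier (M_rep a b) = {f. supported (symbols a) f}"
  "zero (M_rep a b) = 0" "add (M_rep a b) = (+)" "module.smult (M_rep a b) = sc"
  "even_part (M_rep a b) = {f. supported {i \<in> symbols a. fst i \<in> {Lam, VFVLam}} f}"
  "odd_part (M_rep a b) = {f. supported {i \<in> symbols a. fst i \<in> {VLam, Om}} f}"
  "act (M_rep a b) = M_act a b"
proof -
  have 1: "fst i \<in> {VLam, Om} \<longleftrightarrow> fst i \<notin> {Lam, VFVLam}" for i :: "sym \<times> nat" by (cases "fst i") auto
  show "carrier (M_rep a b) = {f. supported (symbols a) f}"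
    "even_part (M_rep a b) = {f. supported {i \<in> symbols a. fst i \<in> {Lam, VFVLam}} f}"
    "odd_part (M_rep a b) = {f. supported {i \<in> symbols a. fst i \<in> {VLam, Om}} f}"
    unfolding M_rep_def supported_def using 1 by auto
qed (auto simp: M_rep_def fun_eq_iff vec_ops)

lemma F_pow_outside: "(x, n) \<notin> symbols a \<Longrightarrow> F_pow a n x = 0"
  by (auto simp: F_pow_def pointwise)

lemma supported_F_pow: "supported (symbols a) (F_pow a n x)"
  by (auto simp: F_pow_def supported_def)

lemma F_pow_expansion:
  assumes "supported (symbols a) f"
  shows "f = (\<Sum>i\<in>symbols a. sc (f i) (basis_vec a i))"
proof
  fix j
  have "(\<Sum>i\<in>symbols a. f i * basis_vec a i j) = (\<Sum>i\<in>symbols a. if j = i then f i else 0)"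
    by (rule sum.cong) (auto simp: basis_vec_def F_pow_def)
  then show "f j = (\<Sum>i\<in>symbols a. sc (f i) (basis_vec a i)) j"
    using assms[unfolded supported_def, rule_format, of j] finite_symbols[of a] by (auto simp: sum_fun_apply sc_apply)
qed

lemma lin_ext_sum: "lin_ext a T f = (\<Sum>i\<in>symbols a. sc (f i) (T (snd i) (fst i)))"
  by (auto simp: lin_ext_def pointwise case_prod_beta)

lemma lin_ext_linear: "fun_linear (lin_ext a T)"
  by (simp add: fun_linear_def lin_ext_sum fvs.scale_sum_right sum.distrib
      fvs.scale_left_distrib plus_fun_apply sc_apply)

lemma fun_linear_compose: "fun_linear S \<Longrightarrow> fun_linear T \<Longrightarrow> fun_linear (\<lambda>f. S (T f))"
  by (simp add: fun_linear_def)

lemma fun_linear_diff: "fun_linear S \<Longrightarrow> fun_linear T \<Longrightarrow> fun_linear (\<lambda>f. S f - T f)"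
  by (simp add: fun_linear_def fvs.scale_right_diff_distrib)

lemma fun_linear_scale: "fun_linear S \<Longrightarrow> fun_linear (\<lambda>f. sc c (S f))"
  by (simp add: fun_linear_def fvs.scale_right_distrib mult.commute)

lemma M_act_linear: "fun_linear (M_act a b g)"
  by (cases g) (simp_all add: lin_ext_linear op_bracket_def[abs_def] vec_ops fun_linear_compose
      fun_linear_diff fun_linear_scale del: fvs.scale_minus_left)

lemmas M_act_lins = fun_linearD[OF M_act_linear]

text \<open>The matrices of the generators read by rows: the coordinate at \<open>F^n x\<close> of
  the image in terms of the coordinates of \<open>f\<close>. Shifts are therefore opposite to those
  on basis vectors (\<open>F\<close> reads index \<open>n - 1\<close>, \<open>E\<close> reads
  \<open>n + 1\<close>), the conditions on \<open>n\<close> cut the strings at their ends, and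
  \<open>W\<close> and \<open>X\<close> get closed forms in place of commutators.\<close>

fun M_coord :: "nat \<Rightarrow> complex \<Rightarrow> gen \<Rightarrow> mvec \<Rightarrow> sym \<Rightarrow> nat \<Rightarrow> complex" where
  "M_coord a b gF f x n = (if 0 < n \<and> n < symbols_of a x then f (x, n - 1) else 0)"
| "M_coord a b gE f x n = (of_nat n + 1) * (c_wt a x - of_nat n) * f (x, n + 1)"
| "M_coord a b gH f x n = (c_wt a x - 2 * of_nat n) * f (x, n)"
| "M_coord a b gY f x n = y_wt a b x * f (x, n)"
| "M_coord a b gU f Lam n = (if n < a + 1 then b * f (VLam, n) else 0)
     + (if 0 < n then (of_nat a + 1 - b) * f (Om, n - 1) else 0)"
| "M_coord a b gU f VLam n = (if 0 < n then (b / (of_nat a + 1) - 1) * f (VFVLam, n - 1) else 0)"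
| "M_coord a b gU f Om n = (if n < a then b / (of_nat a + 1) * f (VFVLam, n) else 0)"
| "M_coord a b gU f VFVLam n = 0"
| "M_coord a b gV f Lam n = 0"
| "M_coord a b gV f VLam n = (1 - of_nat n / (of_nat a + 1)) * f (Lam, n)"
| "M_coord a b gV f Om n = - ((of_nat n + 1) / (of_nat a + 1)) * f (Lam, n + 1)"
| "M_coord a b gV f VFVLam n = (of_nat n + 1) * f (VLam, n + 1) + (of_nat a - of_nat n) * f (Om, n)"
| "M_coord a b gW f Lam n = - (of_nat n + 1) * b * f (VLam, n + 1)
     + (of_nat a + 1 - b) * (of_nat a - of_nat n) * f (Om, n)"
| "M_coord a b gW f VLam n = (b / (of_nat a + 1) - 1) * (of_nat a + 1 - of_nat n) * f (VFVLam, n)"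
| "M_coord a b gW f Om n = - (of_nat n + 1) * (b / (of_nat a + 1)) * f (VFVLam, n + 1)"
| "M_coord a b gW f VFVLam n = 0"
| "M_coord a b gX f Lam n = 0"
| "M_coord a b gX f VLam n = (if 0 < n then - (1 / (of_nat a + 1)) * f (Lam, n - 1) else 0)"
| "M_coord a b gX f Om n = (if n < a then - (1 / (of_nat a + 1)) * f (Lam, n) else 0)"
| "M_coord a b gX f VFVLam n = (if n < a + 1 then f (VLam, n) else 0)
     - (if 0 < n then f (Om, n - 1) else 0)"

lemma M_coord_linear:
  "fun_linear (\<lambda>f (x, n). M_coord a b g f x n)"
proof -
  have "M_coord a b g (f + h) x n = M_coord a b g f x n + M_coord a b g h x n
      \<and> M_coord a b g (sc c f) x n = c * M_coord a b g f x n" for f h x n c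
    by (cases g; cases x) (simp_all add: pointwise algebra_simps add_divide_distrib diff_divide_distrib)
  then show ?thesis by (auto simp: fun_linear_def pointwise)
qed

lemma lin_ext_eqI:
  assumes T: "\<And>n x. (x, n) \<in> symbols a \<Longrightarrow> T n x = G (F_pow a n x)"
    and G: "fun_linear G" and f: "supported (symbols a) f"
  shows "lin_ext a T f = G f"
proof -
  have "G f = G (\<Sum>i\<in>symbols a. sc (f i) (basis_vec a i))" using F_pow_expansion[OF f] by simp
  also have "\<dots> = (\<Sum>i\<in>symbols a. sc (f i) (G (basis_vec a i)))" by (simp add: fun_linearD[OF G])
  also have "\<dots> = lin_ext a T f"
    unfolding lin_ext_sum by (rule sum.cong) (auto simp: basis_vec_def T)
  finally show ?thesis by simp
qed

lemma basis_operators_eq_M_coord: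
  assumes "(y, m) \<in> symbols a"
  shows "F_basis a m y = (\<lambda>(x, n). M_coord a b gF (F_pow a m y) x n)"
    "E_basis a m y = (\<lambda>(x, n). M_coord a b gE (F_pow a m y) x n)"
    "H_basis a m y = (\<lambda>(x, n). M_coord a b gH (F_pow a m y) x n)"
    "Y_basis a b m y = (\<lambda>(x, n). M_coord a b gY (F_pow a m y) x n)"
    "U_basis a b m y = (\<lambda>(x, n). M_coord a b gU (F_pow a m y) x n)"
    "V_basis a m y = (\<lambda>(x, n). M_coord a b gV (F_pow a m y) x n)"
proof -
  note d = F_basis_def E_basis_def H_basis_def Y_basis_def vec_ops F_pow_def pointwise symbols_def
  show "F_basis a m y = (\<lambda>(x, n). M_coord a b gF (F_pow a m y) x n)"
    using assms by (auto simp: d)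
  show "E_basis a m y = (\<lambda>(x, n). M_coord a b gE (F_pow a m y) x n)"
    using assms by (cases m) (auto simp: d)
  show "H_basis a m y = (\<lambda>(x, n). M_coord a b gH (F_pow a m y) x n)"
    using assms by (auto simp: d)
  show "Y_basis a b m y = (\<lambda>(x, n). M_coord a b gY (F_pow a m y) x n)"
    using assms by (auto simp: d)
  show "U_basis a b m y = (\<lambda>(x, n). M_coord a b gU (F_pow a m y) x n)"
  proof (rule ext, clarify)
    fix x n show "U_basis a b m y (x, n) = M_coord a b gU (F_pow a m y) x n"
      using assms by (cases x; cases y; cases n) (auto simp: d)
  qed
  show "V_basis a m y = (\<lambda>(x, n). M_coord a b gV (F_pow a m y) x n)"
  proof (rule ext, clarify)
    fix x n show "V_basis a m y (x, n) = M_coord a b gV (F_pow a m y) x n"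
      using assms by (cases x; cases y; cases m) (auto simp: d less_Suc_eq)
  qed
qed


abbreviation MC :: "nat \<Rightarrow> complex \<Rightarrow> gen \<Rightarrow> mvec \<Rightarrow> mvec" where
  "MC a b g f \<equiv> (\<lambda>(x, n). M_coord a b g f x n)"

lemma supported_symbolsD:
  "supported (symbols a) f \<Longrightarrow> \<not> n < symbols_of a x \<Longrightarrow> f (x, n) = 0"
  by (auto simp: supported_def symbols_def)

lemma M_coord_supported:
  assumes "supported (symbols a) f"
  shows "supported (symbols a) (MC a b g f)"
proof -
  note z = supported_symbolsD[OF assms]
  have "M_coord a b g f x n = 0" if "\<not> n < symbols_of a x" for x n
    using that by (cases g; cases x) (auto simp: z not_less le_Suc_eq)
  then show ?thesis by (auto simp: supported_def symbols_def)
qed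

lemma of_nat_shift:
  obtains t :: complex where "of_nat a = t - 1" "t \<noteq> 0"
  using of_nat_add_one_neq_0(1)[of a] by (metis add_diff_cancel)

lemma of_nat_pred: "0 < n \<Longrightarrow> of_nat (n - Suc 0) = (of_nat n - 1 :: complex)"
  by (simp add: of_nat_diff)

text \<open>Writing \<open>a = t - 1\<close> makes every denominator a power of the nonzero variable \<open>t\<close>. The four
  strings end at \<open>n = a - 1\<close>, \<open>a\<close> or \<open>a + 1\<close>, which is where the cases split.\<close>

lemma boundary_cases:
  assumes "of_nat a = t - (1 :: complex)"
  obtains "n < a" "Suc n < a" | "n < a" "\<not> Suc n < a" "of_nat n = t - 2"
  | "\<not> n < a" "n < Suc a" "of_nat n = t - 1" | "\<not> n < a" "\<not> n < Suc a" "n < Suc (Suc a)" "of_nat n = t"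
  | "\<not> n < a" "\<not> n < Suc a" "\<not> n < Suc (Suc a)"
proof -
  have t: "t = of_nat a + 1" using assms by simp
  consider "Suc n < a" | "Suc n = a" | "n = a" | "n = Suc a" | "Suc a < n" by linarith
  then show ?thesis by cases (auto intro: that simp: t)
qed

lemma M_coord_W:
  assumes "supported (symbols a) f"
  shows "M_coord a b gE (MC a b gU f) x n - M_coord a b gU (MC a b gE f) x n = M_coord a b gW f x n"
proof -
  note z = supported_symbolsD[OF assms]
  obtain t :: complex where t: "of_nat a = t - 1" "t \<noteq> 0" by (rule of_nat_shift)
  show ?thesis
    by (rule boundary_cases[OF t(1), of n]; cases x; cases "n = 0"; simp add: z t of_nat_pred)
      (simp_all add: t(2) field_simps)
qed

lemma M_coord_X:
  assumes "supported (symbols a) f"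
  shows "M_coord a b gV (MC a b gF f) x n - M_coord a b gF (MC a b gV f) x n = M_coord a b gX f x n"
proof -
  note z = supported_symbolsD[OF assms]
  obtain t :: complex where t: "of_nat a = t - 1" "t \<noteq> 0" by (rule of_nat_shift)
  show ?thesis
    by (rule boundary_cases[OF t(1), of n]; cases x; cases "n = 0"; simp add: z t of_nat_pred)
      (simp_all add: t(2) field_simps)
qed

lemma M_act_coord:
  assumes f: "supported (symbols a) f"
  shows "M_act a b g f = MC a b g f"
proof -
  note I = lin_ext_eqI[OF _ M_coord_linear]
  have F: "lin_ext a (F_basis a) f = MC a b gF f" and E: "lin_ext a (E_basis a) f = MC a b gE f"
    and H: "lin_ext a (H_basis a) f = MC a b gH f" and Y: "lin_ext a (Y_basis a b) f = MC a b gY f"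
    and U: "lin_ext a (U_basis a b) f = MC a b gU f" and V: "lin_ext a (V_basis a) f = MC a b gV f"
    if "supported (symbols a) f" for f
    by (rule I[OF _ that], rule basis_operators_eq_M_coord, assumption)+
  note s = M_coord_supported[OF f]
  show ?thesis
  proof (cases g)
    case gW
    have "M_act a b gW f = MC a b gW f"
      unfolding M_act.simps op_bracket_def U[OF f] E[OF f] E[OF s] U[OF s]
      by (rule ext) (simp only: split_paired_all vsub_def prod.case M_coord_W[OF f])
    then show ?thesis using gW by simp
  next
    case gX
    have "M_act a b gX f = MC a b gX f"
      unfolding M_act.simps op_bracket_def F[OF f] V[OF f] F[OF s] V[OF s]
      by (rule ext) (simp only: split_paired_all vsub_def vsmult_def prod.case M_coord_X[OF f, symmetric], simp)
    then show ?thesis using gX by simp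
  qed (simp_all add: F E H Y U V f)
qed

lemma M_act_supported:
  "supported (symbols a) f \<Longrightarrow> supported (symbols a) (M_act a b g f)"
  by (simp add: M_act_coord M_coord_supported)


text \<open>In every boundary case the coordinates beyond the ends of the strings are zero by
  \<open>supported\<close>, and what remains is a rational identity whose denominators are powers of
  \<open>t\<close>.\<close>

lemma M_coord_relations:
  fixes a :: nat and b :: complex
  assumes "supported (symbols a) f"
  defines "c \<equiv> (\<lambda>g h x n. M_coord a b g (MC a b h f) x n - M_coord a b h (MC a b g f) x n)"
    and "d \<equiv> (\<lambda>g h x n. M_coord a b g (MC a b h f) x n + M_coord a b h (MC a b g f) x n)"
    and "m \<equiv> (\<lambda>g x n. M_coord a b g f x n)"
  shows "c gH gE x n = 2 * m gE x n" "c gH gF x n = - 2 * m gF x n" "c gE gF x n = m gH x n"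
    "c gY gE x n = 0" "c gY gF x n = 0" "c gY gH x n = 0"
    "c gH gU x n = - m gU x n" "c gH gW x n = m gW x n" "c gH gX x n = - m gX x n" "c gH gV x n = m gV x n"
    "c gY gU x n = m gU x n" "c gY gW x n = m gW x n" "c gY gV x n = - m gV x n" "c gY gX x n = - m gX x n"
    "c gE gU x n = m gW x n" "c gF gW x n = m gU x n" "c gE gX x n = - m gV x n" "c gF gV x n = - m gX x n"
    "c gE gV x n = 0" "c gE gW x n = 0" "c gF gU x n = 0" "c gF gX x n = 0"
    "d gU gV x n = (1/2) * (m gY x n + m gH x n)" "d gW gX x n = (1/2) * (m gY x n - m gH x n)"
    "d gU gX x n = - m gF x n" "d gV gW x n = - m gE x n"
    "d gU gW x n = 0" "d gX gV x n = 0"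
    "d gU gU x n = 0" "d gV gV x n = 0" "d gW gW x n = 0" "d gX gX x n = 0"
proof -
  note z = supported_symbolsD[OF assms(1)]
  obtain t :: complex where t: "of_nat a = t - 1" "t \<noteq> 0" by (rule of_nat_shift)
  note cs = boundary_cases[OF t(1), of n]
  show "c gH gE x n = 2 * m gE x n" "c gH gF x n = - 2 * m gF x n" "c gE gF x n = m gH x n"
    "c gY gE x n = 0" "c gY gF x n = 0" "c gY gH x n = 0"
    "c gH gU x n = - m gU x n" "c gH gW x n = m gW x n" "c gH gX x n = - m gX x n" "c gH gV x n = m gV x n"
    "c gY gU x n = m gU x n" "c gY gW x n = m gW x n" "c gY gV x n = - m gV x n" "c gY gX x n = - m gX x n"
    "c gE gU x n = m gW x n" "c gF gW x n = m gU x n" "c gE gX x n = - m gV x n" "c gF gV x n = - m gX x n"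
    "c gE gV x n = 0" "c gE gW x n = 0" "c gF gU x n = 0" "c gF gX x n = 0"
    "d gU gV x n = (1/2) * (m gY x n + m gH x n)" "d gW gX x n = (1/2) * (m gY x n - m gH x n)"
    "d gU gX x n = - m gF x n" "d gV gW x n = - m gE x n"
    "d gU gW x n = 0" "d gX gV x n = 0"
    "d gU gU x n = 0" "d gV gV x n = 0" "d gW gW x n = 0" "d gX gX x n = 0"
    unfolding c_def d_def m_def
    by (rule cs; cases x; cases "n = 0"; simp add: z t of_nat_pred; (simp add: t(2) field_simps)?; linarith?)+
qed


section \<open>The representation axioms and the dimension of \<open>M(a,b)\<close>\<close>

lemma supported_closed:
  "supported B 0" "supported B f \<Longrightarrow> supported B h \<Longrightarrow> supported B (f + h)"
  "supported B f \<Longrightarrow> supported B h \<Longrightarrow> supported B (f - h)"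
  "supported B f \<Longrightarrow> supported B (- f)" "supported B f \<Longrightarrow> supported B (sc c f)"
  "(\<And>i. i \<in> I \<Longrightarrow> supported B (k i)) \<Longrightarrow> supported B (sum k I)"
  by (auto simp: supported_def pointwise intro!: sum.neutral)

lemma M_vectorspace: "vectorspace \<CC> (M_rep a b)"
proof (rule vs_criteria)
  show "\<forall>v\<in>carrier (M_rep a b). \<exists>w\<in>carrier (M_rep a b). v \<oplus>\<^bsub>M_rep a b\<^esub> w = \<zero>\<^bsub>M_rep a b\<^esub>"
  proof
    fix v assume "v \<in> carrier (M_rep a b)"
    then show "\<exists>w\<in>carrier (M_rep a b). v \<oplus>\<^bsub>M_rep a b\<^esub> w = \<zero>\<^bsub>M_rep a b\<^esub>"
      by (intro bexI[of _ "- v"]) (auto simp: supported_closed)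
  qed
qed (auto simp: class_field supported_closed fvs.scale_left_distrib fvs.scale_right_distrib)

lemma M_minus:
  assumes "supported (symbols a) f" "supported (symbols a) h"
  shows "\<ominus>\<^bsub>M_rep a b\<^esub> f = - f" "h \<ominus>\<^bsub>M_rep a b\<^esub> f = h - f"
proof -
  interpret M: vectorspace \<CC> "M_rep a b" by (rule M_vectorspace)
  show 1: "\<ominus>\<^bsub>M_rep a b\<^esub> f = - f"
    using M.minus_equality[of "- f" f] assms by (simp add: supported_closed)
  show "h \<ominus>\<^bsub>M_rep a b\<^esub> f = h - f" by (simp add: a_minus_def 1)
qed

lemma M_finsum:
  assumes "finite I" "\<And>i. i \<in> I \<Longrightarrow> supported (symbols a) (k i)"
  shows "finsum (M_rep a b) k I = sum k I"
proof -
  interpret M: vectorspace \<CC> "M_rep a b" by (rule M_vectorspace)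
  show ?thesis using assms by (induct I) (simp_all add: Pi_iff)
qed

lemma supported_Collect_iff:
  "supported {i \<in> symbols a. fst i \<in> P} f \<longleftrightarrow>
     supported (symbols a) f \<and> (\<forall>x n. x \<notin> P \<longrightarrow> f (x, n) = 0)"
  by (auto simp: supported_def)

lemma supported_Collect: "supported {i \<in> B. Q i} f \<Longrightarrow> supported B f"
  by (auto simp: supported_def)

text \<open>The hypothesis says that image coordinates off \<open>Q\<close> only read coordinates
  off \<open>P\<close>. One criterion thus serves both for parity and for invariance of spans of
  strings.\<close>

lemma M_act_support_transfer:
  assumes f: "supported {i \<in> symbols a. fst i \<in> P} f"
    and "\<And>x n. x \<notin> Q \<Longrightarrow> (\<And>y m. y \<notin> P \<Longrightarrow> f (y, m) = 0) \<Longrightarrow> M_coord a b g f x n = 0"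
  shows "supported {i \<in> symbols a. fst i \<in> Q} (M_act a b g f)"
proof -
  have s: "supported (symbols a) f" using f by (auto simp: supported_Collect_iff)
  have "\<forall>y m. y \<notin> P \<longrightarrow> f (y, m) = 0" using f by (auto simp: supported_Collect_iff)
  then show ?thesis using assms(2) M_act_supported[OF s, of b g]
    unfolding supported_Collect_iff by (auto simp: M_act_coord[OF s])
qed

lemma M_act_parity:
  shows "g \<in> even_gens \<Longrightarrow> f \<in> even_part (M_rep a b) \<Longrightarrow> M_act a b g f \<in> even_part (M_rep a b)"
    "g \<in> even_gens \<Longrightarrow> f \<in> odd_part (M_rep a b) \<Longrightarrow> M_act a b g f \<in> odd_part (M_rep a b)"
    "g \<in> odd_gens \<Longrightarrow> f \<in> even_part (M_rep a b) \<Longrightarrow> M_act a b g f \<in> odd_part (M_rep a b)"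
    "g \<in> odd_gens \<Longrightarrow> f \<in> odd_part (M_rep a b) \<Longrightarrow> M_act a b g f \<in> even_part (M_rep a b)"
proof -
  have even: "supported {i \<in> symbols a. fst i \<in> P} (M_act a b g f)"
    if "g \<in> even_gens" "supported {i \<in> symbols a. fst i \<in> P} f" for P
    by (rule M_act_support_transfer[OF that(2)]) (use that(1) in \<open>auto simp: even_gens_def\<close>)
  show "g \<in> even_gens \<Longrightarrow> f \<in> even_part (M_rep a b) \<Longrightarrow> M_act a b g f \<in> even_part (M_rep a b)"
    "g \<in> even_gens \<Longrightarrow> f \<in> odd_part (M_rep a b) \<Longrightarrow> M_act a b g f \<in> odd_part (M_rep a b)"
    unfolding M_rep_sel mem_Collect_eq by (rule even; assumption)+
  have 1: "supported {i \<in> symbols a. fst i \<in> {VLam, Om}} (M_act a b g f)"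
    if g: "g \<in> odd_gens" and f: "supported {i \<in> symbols a. fst i \<in> {Lam, VFVLam}} f"
  proof (rule M_act_support_transfer[OF f])
    fix x n assume "x \<notin> {VLam, Om}" "\<And>y m. y \<notin> {Lam, VFVLam} \<Longrightarrow> f (y, m) = 0"
    then show "M_coord a b g f x n = 0" using g by (cases x) (auto simp: odd_gens_def)
  qed
  have 2: "supported {i \<in> symbols a. fst i \<in> {Lam, VFVLam}} (M_act a b g f)"
    if g: "g \<in> odd_gens" and f: "supported {i \<in> symbols a. fst i \<in> {VLam, Om}} f"
  proof (rule M_act_support_transfer[OF f])
    fix x n assume "x \<notin> {Lam, VFVLam}" "\<And>y m. y \<notin> {VLam, Om} \<Longrightarrow> f (y, m) = 0"
    then show "M_coord a b g f x n = 0" using g by (cases x) (auto simp: odd_gens_def)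
  qed
  show "g \<in> odd_gens \<Longrightarrow> f \<in> even_part (M_rep a b) \<Longrightarrow> M_act a b g f \<in> odd_part (M_rep a b)"
    "g \<in> odd_gens \<Longrightarrow> f \<in> odd_part (M_rep a b) \<Longrightarrow> M_act a b g f \<in> even_part (M_rep a b)"
    unfolding M_rep_sel mem_Collect_eq by (rule 1 2; assumption)+
qed

lemma M_comm:
  assumes f: "supported (symbols a) f"
  shows "comm (M_rep a b) g h f = (\<lambda>(x, n). M_coord a b g (MC a b h f) x n - M_coord a b h (MC a b g f) x n)"
    "acomm (M_rep a b) g h f = (\<lambda>(x, n). M_coord a b g (MC a b h f) x n + M_coord a b h (MC a b g f) x n)"
proof -
  note s = M_coord_supported[OF f]
  have "comm (M_rep a b) g h f = M_act a b g (M_act a b h f) - M_act a b h (M_act a b g f)"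
    by (simp add: comm_def M_minus M_act_supported f)
  also have "\<dots> = MC a b g (MC a b h f) - MC a b h (MC a b g f)"
    by (simp only: M_act_coord[OF f] M_act_coord[OF s])
  finally show "comm (M_rep a b) g h f = (\<lambda>(x, n). M_coord a b g (MC a b h f) x n - M_coord a b h (MC a b g f) x n)"
    by (simp add: fun_eq_iff minus_apply del: M_coord.simps)
  have "acomm (M_rep a b) g h f = MC a b g (MC a b h f) + MC a b h (MC a b g f)"
    unfolding acomm_def M_rep_sel by (simp only: M_act_coord[OF f] M_act_coord[OF s])
  then show "acomm (M_rep a b) g h f = (\<lambda>(x, n). M_coord a b g (MC a b h f) x n + M_coord a b h (MC a b g f) x n)"
    by (simp add: fun_eq_iff plus_fun_apply del: M_coord.simps)
qed

lemma M_sl21_rep: "sl21_rep (M_rep a b)"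
proof (rule sl21_rep.intro)
  let ?M = "M_rep a b"
  show vs: "vectorspace \<CC> ?M" by (rule M_vectorspace)
  show "VectorSpace.subspace \<CC> (even_part ?M) ?M" "VectorSpace.subspace \<CC> (odd_part ?M) ?M"
    unfolding subspace_iff[OF vs] by (auto simp: supported_closed dest: supported_Collect)
  show "even_part ?M <+>\<^bsub>?M\<^esub> odd_part ?M = carrier ?M"
  proof (rule subset_antisym)
    show "even_part ?M <+>\<^bsub>?M\<^esub> odd_part ?M \<subseteq> carrier ?M"
      by (auto simp: set_add_def' intro!: supported_closed(2) dest: supported_Collect)
    show "carrier ?M \<subseteq> even_part ?M <+>\<^bsub>?M\<^esub> odd_part ?M"
    proof
      fix f assume f: "f \<in> carrier ?M"
      let ?e = "\<lambda>i. if fst i \<in> {Lam, VFVLam} then f i else 0"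
      have ne: "x \<notin> {VLam, Om} \<Longrightarrow> x \<in> {Lam, VFVLam}" for x by (cases x) auto
      have "?e \<in> even_part ?M" using f by (auto simp: supported_def)
      moreover have "f - ?e \<in> odd_part ?M"
        using f ne by (auto simp: supported_def minus_apply)
      moreover have "f = ?e + (f - ?e)" by simp
      ultimately show "f \<in> even_part ?M <+>\<^bsub>?M\<^esub> odd_part ?M"
        unfolding set_add_def' M_rep_sel by blast
    qed
  qed
  show "even_part ?M \<inter> odd_part ?M = {\<zero>\<^bsub>?M\<^esub>}"
  proof -
    have "f = 0" if "f \<in> even_part ?M" "f \<in> odd_part ?M" for f
    proof
      fix i show "f i = 0 i" using that by (cases i; cases "fst i") (auto simp: supported_def zero_fun_apply)
    qed
    then show ?thesis by (auto simp: supported_closed)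
  qed
  show "act ?M g \<in> LinearCombinations.module_hom \<CC> ?M ?M" for g
    by (auto simp: LinearCombinations.module_hom_def M_act_supported M_act_lins)
  show "g \<in> even_gens \<Longrightarrow> act ?M g ` even_part ?M \<subseteq> even_part ?M"
    "g \<in> even_gens \<Longrightarrow> act ?M g ` odd_part ?M \<subseteq> odd_part ?M"
    "g \<in> odd_gens \<Longrightarrow> act ?M g ` even_part ?M \<subseteq> odd_part ?M"
    "g \<in> odd_gens \<Longrightarrow> act ?M g ` odd_part ?M \<subseteq> even_part ?M" for g
    using M_act_parity[of g _ a b] by (auto simp del: M_rep_sel(5,6) simp: M_rep_sel(7))
  fix f assume "f \<in> carrier ?M"
  then have f: "supported (symbols a) f" by simp
  note z = supported_closed(1) and s = M_coord_supported[OF f]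
  note R = M_comm[OF f] M_coord_relations[OF f, of b] M_minus(1)[OF s z]
     M_minus(2)[OF s s] M_act_coord[OF f]
  have ext: "p = q \<longleftrightarrow> (\<forall>x n. p (x, n) = q (x, n))" for p q :: mvec by auto
  show "comm ?M gH gE f = 2 \<odot>\<^bsub>?M\<^esub> act ?M gE f \<and> comm ?M gH gF f = (-2) \<odot>\<^bsub>?M\<^esub> act ?M gF f \<and>
      comm ?M gE gF f = act ?M gH f \<and>
      comm ?M gY gE f = \<zero>\<^bsub>?M\<^esub> \<and> comm ?M gY gF f = \<zero>\<^bsub>?M\<^esub> \<and> comm ?M gY gH f = \<zero>\<^bsub>?M\<^esub>"
    "comm ?M gH gU f = \<ominus>\<^bsub>?M\<^esub> act ?M gU f \<and> comm ?M gH gW f = act ?M gW f \<and>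
          comm ?M gH gX f = \<ominus>\<^bsub>?M\<^esub> act ?M gX f \<and> comm ?M gH gV f = act ?M gV f"
    "comm ?M gY gU f = act ?M gU f \<and> comm ?M gY gW f = act ?M gW f \<and>
          comm ?M gY gV f = \<ominus>\<^bsub>?M\<^esub> act ?M gV f \<and> comm ?M gY gX f = \<ominus>\<^bsub>?M\<^esub> act ?M gX f"
    "comm ?M gE gU f = act ?M gW f \<and> comm ?M gF gW f = act ?M gU f \<and>
          comm ?M gE gX f = \<ominus>\<^bsub>?M\<^esub> act ?M gV f \<and> comm ?M gF gV f = \<ominus>\<^bsub>?M\<^esub> act ?M gX f \<and>
          comm ?M gE gV f = \<zero>\<^bsub>?M\<^esub> \<and> comm ?M gE gW f = \<zero>\<^bsub>?M\<^esub> \<and>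
          comm ?M gF gU f = \<zero>\<^bsub>?M\<^esub> \<and> comm ?M gF gX f = \<zero>\<^bsub>?M\<^esub>"
    "acomm ?M gU gV f = (1/2) \<odot>\<^bsub>?M\<^esub> (act ?M gY f \<oplus>\<^bsub>?M\<^esub> act ?M gH f) \<and>
          acomm ?M gW gX f = (1/2) \<odot>\<^bsub>?M\<^esub> (act ?M gY f \<ominus>\<^bsub>?M\<^esub> act ?M gH f) \<and>
          acomm ?M gU gX f = \<ominus>\<^bsub>?M\<^esub> act ?M gF f \<and> acomm ?M gV gW f = \<ominus>\<^bsub>?M\<^esub> act ?M gE f \<and>
          acomm ?M gU gW f = \<zero>\<^bsub>?M\<^esub> \<and> acomm ?M gX gV f = \<zero>\<^bsub>?M\<^esub> \<and>
          acomm ?M gU gU f = \<zero>\<^bsub>?M\<^esub> \<and> acomm ?M gV gV f = \<zero>\<^bsub>?M\<^esub> \<and>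
          acomm ?M gW gW f = \<zero>\<^bsub>?M\<^esub> \<and> acomm ?M gX gX f = \<zero>\<^bsub>?M\<^esub>"
    unfolding M_rep_sel R(3-) R(1,2)
    by (simp_all only: R ext prod.case pointwise(2-6) simp_thms refl)
qed

lemma M_indexed_basis: "is_indexed_basis (M_rep a b) (symbols a) (basis_vec a)"
proof (rule indexed_basisI[OF M_vectorspace finite_symbols])
  have s: "supported (symbols a) (sc c (basis_vec a i))" for c i
    by (auto simp: basis_vec_def supported_F_pow supported_closed split: prod.split)
  show "basis_vec a i \<in> carrier (M_rep a b)" for i using s[of 1 i] by simp
  have fs: "(\<Oplus>\<^bsub>M_rep a b\<^esub>i\<in>symbols a. c i \<odot>\<^bsub>M_rep a b\<^esub> basis_vec a i) = (\<Sum>i\<in>symbols a. sc (c i) (basis_vec a i))" for c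
    by (simp add: M_finsum finite_symbols s)
  show "\<exists>c. f = (\<Oplus>\<^bsub>M_rep a b\<^esub>i\<in>symbols a. c i \<odot>\<^bsub>M_rep a b\<^esub> basis_vec a i)" if "f \<in> carrier (M_rep a b)" for f
    unfolding fs using F_pow_expansion[of a f] that by auto
  show "c i = 0" if z: "(\<Oplus>\<^bsub>M_rep a b\<^esub>i\<in>symbols a. c i \<odot>\<^bsub>M_rep a b\<^esub> basis_vec a i) = \<zero>\<^bsub>M_rep a b\<^esub>" and i: "i \<in> symbols a" for c i
  proof -
    \<comment> \<open>The expansion in the basis applies to supported families, so \<open>c\<close>
      is cut off outside the symbols.\<close>
    define f where "f j = (if j \<in> symbols a then c j else 0)" for j
    have "f = (\<Sum>i\<in>symbols a. sc (f i) (basis_vec a i))"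
      by (rule F_pow_expansion) (auto simp: supported_def f_def)
    also have "\<dots> = (\<Sum>i\<in>symbols a. sc (c i) (basis_vec a i))" by (rule sum.cong) (auto simp: f_def)
    also have "\<dots> = 0" using z unfolding fs by simp
    finally have "f i = 0" by (simp add: zero_fun_apply)
    then show ?thesis using i by (simp add: f_def)
  qed
qed

lemma card_symbols: "card (symbols a) = 4 * (a + 1)"
proof -
  have "symbols a = (SIGMA x:{Lam, VLam, Om, VFVLam}. {..<symbols_of a x})"
  proof (rule Set.set_eqI)
    fix i show "i \<in> symbols a \<longleftrightarrow> i \<in> (SIGMA x:{Lam, VLam, Om, VFVLam}. {..<symbols_of a x})"
      by (cases i; cases "fst i") (auto simp: symbols_def)
  qed
  then show ?thesis by simp
qed

lemma M_dim: "vectorspace.dim \<CC> (M_rep a b) = 4 * (a + 1)"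
proof -
  have b: "finite (basis_vec a ` symbols a)" "vectorspace.basis \<CC> (M_rep a b) (basis_vec a ` symbols a)"
    "card (basis_vec a ` symbols a) = card (symbols a)"
    using M_indexed_basis[of a b] by (auto simp: is_indexed_basis_def card_image)
  then show ?thesis using vectorspace.dim_basis[OF M_vectorspace b(1,2)] card_symbols by simp
qed

lemma M_fd_rep: "fd_rep (M_rep a b)"
proof -
  have "finite (basis_vec a ` symbols a)" "vectorspace.basis \<CC> (M_rep a b) (basis_vec a ` symbols a)"
    using M_indexed_basis[of a b] by (auto simp: is_indexed_basis_def)
  then show ?thesis using M_sl21_rep[of a b]
    unfolding fd_rep_def vectorspace.fin_dim_def[OF M_vectorspace] vectorspace.basis_def[OF M_vectorspace] by blast
qed


section \<open>Invariant subspaces of \<open>M(a,b)\<close>\<close>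

declare M_act.simps [simp del]

text \<open>No grading is demanded, so kernels of homomorphisms and preimages under quotient maps
  qualify without a parity argument.\<close>

definition M_invariant :: "nat \<Rightarrow> complex \<Rightarrow> mvec set \<Rightarrow> bool" where
  "M_invariant a b K \<longleftrightarrow> K \<subseteq> {f. supported (symbols a) f} \<and> 0 \<in> K \<and> (\<forall>f\<in>K. \<forall>h\<in>K. f + h \<in> K) \<and>
     (\<forall>c. \<forall>f\<in>K. sc c f \<in> K) \<and> (\<forall>g. \<forall>f\<in>K. M_act a b g f \<in> K)"

lemma M_invariantD:
  assumes "M_invariant a b K"
  shows "f \<in> K \<Longrightarrow> supported (symbols a) f" "0 \<in> K" "f \<in> K \<Longrightarrow> h \<in> K \<Longrightarrow> f + h \<in> K"
    "f \<in> K \<Longrightarrow> sc c f \<in> K" "f \<in> K \<Longrightarrow> M_act a b g f \<in> K" "f \<in> K \<Longrightarrow> h \<in> K \<Longrightarrow> f - h \<in> K"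
    "(\<And>i. i \<in> I \<Longrightarrow> k i \<in> K) \<Longrightarrow> sum k I \<in> K"
proof -
  show 1: "f \<in> K \<Longrightarrow> supported (symbols a) f" "0 \<in> K" "f \<in> K \<Longrightarrow> h \<in> K \<Longrightarrow> f + h \<in> K"
    "f \<in> K \<Longrightarrow> sc c f \<in> K" "f \<in> K \<Longrightarrow> M_act a b g f \<in> K" for f h c g
    using assms by (auto simp: M_invariant_def)
  show "f - h \<in> K" if "f \<in> K" "h \<in> K" using 1(3)[of f "sc (-1) h"] 1(4)[of h "-1"] that by simp
  show "sum k I \<in> K" if "\<And>i. i \<in> I \<Longrightarrow> k i \<in> K"
    using that by (induct I rule: infinite_finite_induct) (auto intro: 1)
qed

lemma M_act_apply:
  assumes "M_invariant a b K" "f \<in> K"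
  shows "M_act a b g f (x, n) = M_coord a b g f x n"
  using M_act_coord[OF M_invariantD(1)[OF assms]] by simp

text \<open>Induction on the top index: \<open>E\<close> moves the coordinate at
  \<open>N + 1\<close> to \<open>N\<close> with the factor \<open>(N + 1) (a - N)\<close>, nonzero
  because index \<open>N + 1\<close> still lies on the string. At \<open>N = 0\<close> the vector is
  a multiple of \<Lambda>.\<close>

lemma Lam_vector_generates:
  assumes K: "M_invariant a b K" and k: "k \<in> K" and "\<And>x n. x \<noteq> Lam \<Longrightarrow> k (x, n) = 0"
    and "k (Lam, N) \<noteq> 0" "\<And>n. N < n \<Longrightarrow> k (Lam, n) = 0"
  shows "F_pow a 0 Lam \<in> K"
  using assms(2-)
proof (induct N arbitrary: k)
  case 0
  have "F_pow a 0 Lam = sc (1 / k (Lam, 0)) k"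
  proof
    fix i :: "sym \<times> nat"
    obtain x n where i: "i = (x, n)" by (cases i)
    show "F_pow a 0 Lam i = sc (1 / k (Lam, 0)) k i"
      using 0(2-4) unfolding i by (cases "x = Lam"; cases n) (auto simp: F_pow_def sc_apply symbols_def)
  qed
  then show ?case using M_invariantD(4)[OF K 0(1)] by simp
next
  case (Suc N)
  have ap: "M_act a b gE k (x, n) = (of_nat n + 1) * (c_wt a x - of_nat n) * k (x, n + 1)" for x n
    using M_act_apply[OF K Suc(2), of gE x n] by simp
  have "Suc N < symbols_of a Lam"
    using Suc(4) supported_symbolsD[OF M_invariantD(1)[OF K Suc(2)]] by blast
  then have N: "N < a" by simp
  show ?case
  proof (rule Suc(1))
    show "M_act a b gE k \<in> K" by (rule M_invariantD(5)[OF K Suc(2)])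
    show "M_act a b gE k (x, n) = 0" if "x \<noteq> Lam" for x n using Suc(3) that unfolding ap by simp
    have "of_nat N + 1 \<noteq> (0::complex)" "of_nat a - of_nat N \<noteq> (0::complex)" using N by auto
    then show "M_act a b gE k (Lam, N) \<noteq> 0" using Suc(4) unfolding ap by simp
    show "M_act a b gE k (Lam, n) = 0" if "N < n" for n using Suc(5) that unfolding ap by simp
  qed
qed

lemma Lam_component_generates:
  assumes K: "M_invariant a b K" and k: "k \<in> K" and n: "k (Lam, n) \<noteq> 0"
  shows "F_pow a 0 Lam \<in> K"
proof -
  \<comment> \<open>\<open>Y\<close> separates the \<open>\<Lambda>\<close>-string from the three other strings.\<close>
  define h where "h = M_act a b gY k - sc (2 * b - of_nat a - 2) k"
  define k' where "k' = M_act a b gY h - sc (2 * b - of_nat a - 1) h"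
  have h: "h \<in> K" unfolding h_def by (intro M_invariantD[OF K] k)
  have k': "k' \<in> K" unfolding k'_def by (intro M_invariantD[OF K] h)
  have hv: "h (x, n) = (y_wt a b x - (2 * b - of_nat a - 2)) * k (x, n)" for x n
    by (simp add: h_def minus_apply sc_apply M_act_apply[OF K k] left_diff_distrib)
  have kv: "k' (x, n) = (y_wt a b x - (2 * b - of_nat a - 1)) * h (x, n)" for x n
    by (simp add: k'_def minus_apply sc_apply M_act_apply[OF K h] left_diff_distrib)
  \<comment> \<open>The two subtracted numbers are the eigenvalues of \<open>Y\<close> on the other
    strings; on the string of \<Lambda> the factors are \<open>2\<close> and
    \<open>1\<close>.\<close>
  have k'L: "k' (Lam, n) = 2 * k (Lam, n)" and k'0: "x \<noteq> Lam \<Longrightarrow> k' (x, n) = 0" for n x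
    unfolding kv hv by (simp, cases x) simp_all
  define S where "S = {m. k (Lam, m) \<noteq> 0}"
  have "S \<subseteq> {..a}"
  proof
    fix m assume "m \<in> S"
    then have "m < symbols_of a Lam"
      using supported_symbolsD[OF M_invariantD(1)[OF K k], of m Lam] unfolding S_def by blast
    then show "m \<in> {..a}" by simp
  qed
  then have fin: "finite S" by (rule finite_subset) simp
  have "n \<in> S" using n by (simp add: S_def)
  then have M: "Max S \<in> S" "\<And>m. m \<in> S \<Longrightarrow> m \<le> Max S" using fin by (auto intro: Max_in)
  show ?thesis
  proof (rule Lam_vector_generates[OF K k' k'0])
    show "k' (Lam, Max S) \<noteq> 0" using M(1) unfolding k'L by (simp add: S_def)
    show "k' (Lam, m) = 0" if "Max S < m" for m
      using M(2)[of m] that unfolding k'L by (fastforce simp: S_def)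
  qed
qed

lemma M_act_basis:
  "M_act a b gF (F_pow a n x) = F_pow a (n + 1) x" "M_act a b gV (F_pow a n x) = V_basis a n x"
  if "(x, n) \<in> symbols a"
proof -
  have "lin_ext a T (F_pow a n x) = T n x" for T
  proof -
    have "lin_ext a T (F_pow a n x) = (\<Sum>i\<in>symbols a. if i = (x, n) then T n x else 0)"
      unfolding lin_ext_sum by (rule sum.cong) (auto simp: F_pow_def)
    then show ?thesis using that finite_symbols by simp
  qed
  then show "M_act a b gF (F_pow a n x) = F_pow a (n + 1) x" "M_act a b gV (F_pow a n x) = V_basis a n x"
    by (simp_all add: F_basis_def M_act.simps)
qed

text \<open>For \<open>a = 0\<close> the symbol on the left denotes zero, and so does the right side
  since \<open>F \<Lambda> = 0\<close>; otherwise the action of \<open>V\<close> on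
  \<open>F \<Lambda>\<close> is solved for \<omega>.\<close>

lemma Om_formula:
  "F_pow a 0 Om = sc (of_nat a) (M_act a b gF (M_act a b gV (F_pow a 0 Lam)))
     - sc (of_nat a + 1) (M_act a b gV (M_act a b gF (F_pow a 0 Lam)))"
proof -
  have V: "M_act a b gV (F_pow a 0 Lam) = F_pow a 0 VLam"
    using M_act_basis(2)[of Lam 0 a b] by (simp add: symbols_def vec_ops)
  have FV: "M_act a b gF (F_pow a 0 VLam) = F_pow a 1 VLam"
    using M_act_basis(1)[of VLam 0 a b] by (simp add: symbols_def)
  have F: "M_act a b gF (F_pow a 0 Lam) = F_pow a 1 Lam"
    using M_act_basis(1)[of Lam 0 a b] by (simp add: symbols_def)
  show ?thesis
  proof (cases "a = 0")
    case True
    have z: "M_act a b gF (F_pow a 0 Lam) = 0" "F_pow a 0 Om = 0"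
      unfolding F using True by (auto intro!: F_pow_outside simp: symbols_def)
    show ?thesis unfolding z using True by (simp add: M_act_lins)
  next
    case False
    then have VF: "M_act a b gV (F_pow a 1 Lam) = sc (1 - 1 / (of_nat a + 1)) (F_pow a 1 VLam)
        - sc (1 / (of_nat a + 1)) (F_pow a 0 Om)"
      using M_act_basis(2)[of Lam 1 a b] by (simp add: symbols_def vec_ops)
    show ?thesis unfolding F V FV VF using of_nat_add_one_neq_0(1)[of a]
      by (auto simp: pointwise field_simps)
  qed
qed

text \<open>The heads of all four strings are combinations of words in \<open>F\<close> and
  \<open>V\<close> applied to \<Lambda>, and \<open>F\<close> runs along each string from its
  head.\<close>

lemma Lam_generates_all:
  assumes K: "M_invariant a b K" and L: "F_pow a 0 Lam \<in> K"
  shows "K = {f. supported (symbols a) f}"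
proof
  show "K \<subseteq> {f. supported (symbols a) f}" using M_invariantD(1)[OF K] by auto
  note act = M_invariantD(5)[OF K]
  have V: "F_pow a 0 VLam \<in> K"
    using act[OF L, of gV] M_act_basis(2)[of Lam 0 a b] by (simp add: symbols_def vec_ops)
  have O: "F_pow a 0 Om \<in> K"
    by (subst Om_formula[of a b]) (intro M_invariantD[OF K] L)
  have "F_pow a 1 VLam \<in> K"
    using act[OF V, of gF] M_act_basis(1)[of VLam 0 a b] by (simp add: symbols_def)
  then have VFV: "F_pow a 0 VFVLam \<in> K"
    using act[of "F_pow a 1 VLam" gV] M_act_basis(2)[of VLam 1 a b] by (simp add: symbols_def vec_ops)
  have z: "F_pow a 0 x \<in> K" for x using L V O VFV by (cases x) auto
  have "F_pow a n x \<in> K" for n x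
  proof (induct n)
    case (Suc n)
    show ?case
    proof (cases "(x, n) \<in> symbols a")
      case True
      then show ?thesis using act[OF Suc, of gF] M_act_basis(1)[of x n a b] by simp
    next
      case False
      then have "F_pow a (Suc n) x = 0" by (intro F_pow_outside) (auto simp: symbols_def)
      then show ?thesis using M_invariantD(2)[OF K] by simp
    qed
  qed (rule z)
  then have b: "basis_vec a i \<in> K" for i by (simp add: basis_vec_def split: prod.split)
  show "{f. supported (symbols a) f} \<subseteq> K"
  proof
    fix f assume "f \<in> {f. supported (symbols a) f}"
    then have "f = (\<Sum>i\<in>symbols a. sc (f i) (basis_vec a i))" by (intro F_pow_expansion) simp
    then show "f \<in> K" using b by (metis (no_types, lifting) M_invariantD(4,7)[OF K])
  qed
qed

text \<open>If \<Lambda> is not in \<open>K\<close>, no element of \<open>K\<close> has a component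
  on its string. Applied to \<open>U k\<close> and \<open>W k\<close>, this gives linear equations
  for the coordinates of \<open>k\<close> on the strings of \<open>VLam\<close> and
  \<open>Om\<close>; applied to \<open>W (U k)\<close>, it then settles the string of
  \<open>VFVLam\<close>.\<close>

lemma Lam_in_invariant_typical:
  assumes K: "M_invariant a b K" and k: "k \<in> K" "k \<noteq> 0" and b: "b \<noteq> 0" "b \<noteq> of_nat a + 1"
  shows "F_pow a 0 Lam \<in> K"
proof (rule ccontr)
  assume no: "F_pow a 0 Lam \<notin> K"
  have zero: "f (Lam, n) = 0" if "f \<in> K" for f n
    using Lam_component_generates[OF K that] no by blast
  note act = M_invariantD(5)[OF K] and ap = M_act_apply[OF K]
  note supp = supported_symbolsD[OF M_invariantD(1)[OF K k(1)]]
  have b': "of_nat a + 1 - b \<noteq> 0" using b(2) by simp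
  have U: "M_coord a b gU k Lam n = 0" and W: "M_coord a b gW k Lam n = 0" for n
    using zero[OF act[OF k(1)]] ap[OF k(1)] by metis+
  have Om: "k (Om, n) = 0" for n
  proof (cases "n < a")
    case True
    have 1: "b * k (VLam, n + 1) = - ((of_nat a + 1 - b) * k (Om, n))"
      using U[of "n + 1"] True by (simp add: add_eq_0_iff2)
    have "- (of_nat n + 1) * (b * k (VLam, n + 1)) + (of_nat a + 1 - b) * ((of_nat a - of_nat n) * k (Om, n)) = 0"
      using W[of n] by (simp only: M_coord.simps mult.assoc)
    \<comment> \<open>Eliminating \<open>k (VLam, n + 1)\<close> by the equation from
      \<open>U\<close> produces the factor \<open>(n + 1) + (a - n) = a + 1\<close>.\<close>
    then have "(of_nat a + 1 - b) * (of_nat a + 1) * k (Om, n) = 0"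
      unfolding 1 by (simp add: algebra_simps)
    then show ?thesis using b' of_nat_add_one_neq_0(1)[of a] by simp
  qed (use supp[of n Om] in simp)
  have VL: "k (VLam, n) = 0" for n
  proof (cases n)
    case 0
    then show ?thesis using U[of 0] b by simp
  next
    case (Suc m)
    have "- (of_nat m + 1) * b * k (VLam, m + 1) = 0"
      using W[of m] Om[of m] by (simp only: M_coord.simps mult_zero_right add_0_right)
    then show ?thesis using Suc b(1) of_nat_add_one_neq_0(1)[of m]
      by (simp only: mult_eq_0_iff neg_equal_0_iff_equal Suc_eq_plus1) simp
  qed
  have VFV: "k (VFVLam, n) = 0" for n
  proof (cases "n < a + 1")
    case True
    have "M_coord a b gW (M_act a b gU k) Lam n = 0"
      using zero[OF act[OF act[OF k(1)]]] ap[OF act[OF k(1)]] by metis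
    then have e: "- (of_nat n + 1) * b * ((b / (of_nat a + 1) - 1) * k (VFVLam, n))
       + (of_nat a + 1 - b) * (of_nat a - of_nat n) * (if n < a then b / (of_nat a + 1) * k (VFVLam, n) else 0) = 0"
      by (simp add: ap[OF k(1)])
    \<comment> \<open>The cut-off bites only at \<open>n = a\<close>, where the factor in front of
      it is zero.\<close>
    have i: "(of_nat a - of_nat n) * (if n < a then z else 0) = (of_nat a - of_nat n) * z" for z :: complex
      using True by (auto simp: less_Suc_eq)
    have e2: "- (of_nat n + 1) * b * ((b / (of_nat a + 1) - 1) * k (VFVLam, n))
       + (of_nat a + 1 - b) * ((of_nat a - of_nat n) * (b / (of_nat a + 1) * k (VFVLam, n))) = 0"
      using e unfolding mult.assoc i .
    define q where "q = b / (of_nat a + 1)"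
    have q: "b = q * (of_nat a + 1)" using of_nat_add_one_neq_0(1)[of a] by (simp add: q_def)
    \<comment> \<open>With \<open>b = q (a + 1)\<close> both coefficients equal
      \<open>(a + 1)^2 q (1 - q)\<close>.\<close>
    have "b * (of_nat a + 1 - b) * k (VFVLam, n)
      = - (of_nat n + 1) * b * ((q - 1) * k (VFVLam, n))
       + (of_nat a + 1 - b) * ((of_nat a - of_nat n) * (q * k (VFVLam, n)))"
      unfolding q by (simp add: algebra_simps)
    then have "b * (of_nat a + 1 - b) * k (VFVLam, n) = 0" using e2 unfolding q_def by simp
    then show ?thesis using b b' by simp
  qed (use supp[of n VFVLam] in simp)
  have "k = 0"
  proof
    fix i show "k i = 0 i" using zero[OF k(1)] VL Om VFV by (cases i; cases "fst i") (auto simp: zero_fun_apply)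
  qed
  then show False using k by simp
qed

text \<open>With \<open>b = 0\<close>, the coordinate of \<open>U k\<close> at
  \<open>F^(n+1) \<Lambda>\<close> sees only the string of \<omega>, with the nonzero coefficient
  \<open>a + 1\<close>.\<close>

lemma Lam_in_invariant_atypical1:
  assumes K: "M_invariant a 0 K" and k: "k \<in> K" and nz: "k (x, n) \<noteq> 0" and x: "x \<notin> {VLam, VFVLam}"
  shows "F_pow a 0 Lam \<in> K"
proof (cases x)
  case Om
  have n: "n < a" using supported_symbolsD[OF M_invariantD(1)[OF K k], of n Om] nz Om by auto
  have "M_act a 0 gU k (Lam, n + 1) \<noteq> 0" using nz of_nat_add_one_neq_0(1)[of a]
    by (simp add: M_act_apply[OF K k] Om)
  then show ?thesis using Lam_component_generates[OF K M_invariantD(5)[OF K k]] by blast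
qed (use x nz Lam_component_generates[OF K k] in auto)

text \<open>With \<open>b = a + 1\<close> the terms of \<omega> drop out of \<open>U\<close> and
  \<open>W\<close>. Both are used because \<open>U\<close> loses the last vector
  \<open>F^(a+1) V \<Lambda>\<close> of its string and \<open>W\<close> loses the first.\<close>

lemma Lam_in_invariant_atypical2:
  assumes b: "b = of_nat a + 1" and K: "M_invariant a b K" and k: "k \<in> K" and nz: "k (x, n) \<noteq> 0"
    and x: "x \<notin> {Om, VFVLam}"
  shows "F_pow a 0 Lam \<in> K"
proof (cases x)
  case VLam
  have b0: "b \<noteq> 0" using of_nat_add_one_neq_0(1)[of a] b by simp
  show ?thesis
  proof (cases n)
    case 0
    then have "M_act a b gU k (Lam, 0) \<noteq> 0" using nz b0 VLam
      by (simp add: M_act_apply[OF K k])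
    then show ?thesis using Lam_component_generates[OF K M_invariantD(5)[OF K k]] by blast
  next
    case (Suc m)
    have "- (of_nat m + 1) * b * k (VLam, m + 1) \<noteq> 0"
      using nz b0 VLam Suc of_nat_add_one_neq_0(1)[of m]
      by (simp only: mult_eq_0_iff neg_equal_0_iff_equal Suc_eq_plus1) simp
    then have "M_act a b gW k (Lam, m) \<noteq> 0"
      by (simp only: M_act_apply[OF K k] M_coord.simps) (simp add: b)
    then show ?thesis using Lam_component_generates[OF K M_invariantD(5)[OF K k]] by blast
  qed
qed (use x nz Lam_component_generates[OF K k] in auto)


section \<open>Spans of strings and their invariance\<close>

abbreviation coords :: "nat \<Rightarrow> sym set \<Rightarrow> (sym \<times> nat) set" where
  "coords a T \<equiv> {i \<in> symbols a. fst i \<in> T}"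

lemma supported_coords_expansion:
  assumes "supported (coords a T) f"
  shows "f = (\<Sum>i\<in>coords a T. sc (f i) (basis_vec a i))"
proof -
  have "f = (\<Sum>i\<in>symbols a. sc (f i) (basis_vec a i))"
    by (rule F_pow_expansion) (rule supported_Collect[OF assms])
  also have "\<dots> = (\<Sum>i\<in>coords a T. sc (f i) (basis_vec a i))"
    using assms finite_symbols by (intro sum.mono_neutral_right) (auto simp: supported_def)
  finally show ?thesis .
qed

lemma sum_closed:
  assumes "0 \<in> N" "\<And>v w. v \<in> N \<Longrightarrow> w \<in> N \<Longrightarrow> v + w \<in> N" "\<And>i. i \<in> I \<Longrightarrow> h i \<in> N"
  shows "sum h I \<in> N"
  using assms(3) by (induct I rule: infinite_finite_induct) (simp_all add: assms)

lemma M_span_eq: "M_span a b T = {f. supported (coords a T) f}"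
proof (rule subset_antisym)
  interpret M: vectorspace \<CC> "M_rep a b" by (rule M_vectorspace)
  define G where "G = {F_pow a n x |n x. (x, n) \<in> symbols a \<and> x \<in> T}"
  have G: "v \<in> G \<Longrightarrow> supported (coords a T) v" for v
    by (auto simp: G_def supported_def F_pow_def)
  have Gc: "G \<subseteq> carrier (M_rep a b)" using supported_Collect[OF G] by auto
  show "M_span a b T \<subseteq> {f. supported (coords a T) f}"
  proof
    fix f assume "f \<in> M_span a b T"
    then obtain c A where A: "finite A" "A \<subseteq> G" and f: "f = M.lincomb c A"
      unfolding M_span_def G_def[symmetric] M.span_def by auto
    have s: "supported (coords a T) (sc (c v) v)" if "v \<in> A" for v
      using G A(2) that by (intro supported_closed) auto
    have "f = (\<Sum>v\<in>A. sc (c v) v)"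
      unfolding f M.lincomb_def M_rep_sel using supported_Collect[OF s] by (intro M_finsum A(1))
    then show "f \<in> {f. supported (coords a T) f}" using supported_closed(6)[OF s] by simp
  qed
  have sub: "VectorSpace.subspace \<CC> (M_span a b T) (M_rep a b)"
    unfolding M_span_def G_def[symmetric] by (rule M.span_is_subspace[OF Gc])
  have sub': "M_span a b T \<subseteq> carrier (M_rep a b)" "0 \<in> M_span a b T"
    "\<And>v w. v \<in> M_span a b T \<Longrightarrow> w \<in> M_span a b T \<Longrightarrow> v + w \<in> M_span a b T"
    "\<And>c v. v \<in> M_span a b T \<Longrightarrow> sc c v \<in> M_span a b T"
    using sub unfolding subspace_iff[OF M_vectorspace] by simp_all
  show "{f. supported (coords a T) f} \<subseteq> M_span a b T"
  proof
    fix f assume "f \<in> {f. supported (coords a T) f}"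
    then have f: "f = (\<Sum>i\<in>coords a T. sc (f i) (basis_vec a i))" using supported_coords_expansion by simp
    have "basis_vec a i \<in> M_span a b T" if "i \<in> coords a T" for i
      unfolding M_span_def G_def[symmetric] using that
      by (intro M.span_mem[OF Gc]) (cases i, auto simp: G_def basis_vec_def)
    then have "sc (f i) (basis_vec a i) \<in> M_span a b T" if "i \<in> coords a T" for i
      using sub'(4) that by simp
    then have "(\<Sum>i\<in>coords a T. sc (f i) (basis_vec a i)) \<in> M_span a b T"
      using sub'(2,3) by (intro sum_closed)
    then show "f \<in> M_span a b T" using f by simp
  qed
qed

lemma subspace_M_iff:
  "VectorSpace.subspace \<CC> N (M_rep a b) \<longleftrightarrow> N \<subseteq> {f. supported (symbols a) f} \<and> 0 \<in> N \<and>
     (\<forall>v\<in>N. \<forall>w\<in>N. v + w \<in> N) \<and> (\<forall>c. \<forall>v\<in>N. sc c v \<in> N)"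
  unfolding subspace_iff[OF M_vectorspace] by simp

lemma subrep_M_invariant: "subrep N (M_rep a b) \<Longrightarrow> M_invariant a b N"
  unfolding subrep_def subspace_M_iff M_invariant_def by (simp add: image_subset_iff)

lemma M_span_subrep:
  assumes inv: "\<And>g x n f. x \<notin> T \<Longrightarrow> (\<And>y m. y \<notin> T \<Longrightarrow> f (y, m) = 0) \<Longrightarrow> M_coord a b g f x n = 0"
  shows "subrep (M_span a b T) (M_rep a b)"
  unfolding subrep_def
proof (intro conjI allI)
  let ?M = "M_rep a b" and ?N = "M_span a b T"
  show sub: "VectorSpace.subspace \<CC> ?N ?M"
    unfolding subspace_M_iff M_span_eq by (auto simp: supported_closed dest: supported_Collect)
  show "act ?M g ` ?N \<subseteq> ?N" for g
    unfolding M_span_eq using M_act_support_transfer[of a T _ T b g] inv by auto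
  show "?N = (?N \<inter> even_part ?M) <+>\<^bsub>?M\<^esub> (?N \<inter> odd_part ?M)"
  proof (rule subset_antisym)
    show "(?N \<inter> even_part ?M) <+>\<^bsub>?M\<^esub> (?N \<inter> odd_part ?M) \<subseteq> ?N"
      using sub[unfolded subspace_M_iff] by (auto simp: set_add_def')
    show "?N \<subseteq> (?N \<inter> even_part ?M) <+>\<^bsub>?M\<^esub> (?N \<inter> odd_part ?M)"
    proof
      fix f assume "f \<in> ?N"
      then have f: "supported (coords a T) f" by (simp add: M_span_eq)
      let ?e = "\<lambda>i. if fst i \<in> {Lam, VFVLam} then f i else 0"
      have ne: "x \<notin> {VLam, Om} \<Longrightarrow> x \<in> {Lam, VFVLam}" for x by (cases x) auto
      have "?e \<in> ?N \<inter> even_part ?M" using f by (auto simp: supported_def M_span_eq)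
      moreover have "f - ?e \<in> ?N \<inter> odd_part ?M"
        using f ne by (auto simp: supported_def minus_apply M_span_eq)
      moreover have "f = ?e + (f - ?e)" by simp
      ultimately show "f \<in> (?N \<inter> even_part ?M) <+>\<^bsub>?M\<^esub> (?N \<inter> odd_part ?M)"
        unfolding set_add_def' M_rep_sel(3) by blast
    qed
  qed
qed

text \<open>Every coefficient leading from these two strings to those of \<Lambda> and \<omega> has
  the factor \<open>b\<close>.\<close>

lemma N1_subrep: "subrep (N1 a 0) (M_rep a 0)"
proof (rule M_span_subrep)
  fix g x n and f :: mvec assume "x \<notin> {VLam, VFVLam}" "\<And>y m. y \<notin> {VLam, VFVLam} \<Longrightarrow> f (y, m) = 0"
  then show "M_coord a 0 g f x n = 0" by (cases g; cases x) auto
qed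

text \<open>Here the coefficients leading out of the span have the factor \<open>a + 1 - b\<close>
  or \<open>b / (a + 1) - 1\<close>.\<close>

lemma N2_subrep: "b = of_nat a + 1 \<Longrightarrow> subrep (N2 a b) (M_rep a b)"
proof (rule M_span_subrep)
  fix g x n and f :: mvec
  assume "b = of_nat a + 1" "x \<notin> {Om, VFVLam}" "\<And>y m. y \<notin> {Om, VFVLam} \<Longrightarrow> f (y, m) = 0"
  then show "M_coord a b g f x n = 0" using of_nat_add_one_neq_0(1)[of a] by (cases g; cases x) auto
qed

lemma Lam_notin_M_span: "Lam \<notin> T \<Longrightarrow> F_pow a 0 Lam \<notin> M_span a b T"
  by (auto simp: M_span_eq supported_def F_pow_def symbols_def)

section \<open>Irreducibility of \<open>M(a,b)\<close> and of the atypical quotients\<close>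

lemma M_irreducible:
  assumes "b \<noteq> 0" "b \<noteq> of_nat a + 1"
  shows "irreducible_rep (M_rep a b)"
proof -
  have "F_pow a 0 Lam \<noteq> 0" by (auto simp: pointwise F_pow_def symbols_def)
  then have "carrier (M_rep a b) \<noteq> {\<zero>\<^bsub>M_rep a b\<^esub>}" using supported_F_pow by auto
  moreover have "N = {\<zero>\<^bsub>M_rep a b\<^esub>} \<or> N = carrier (M_rep a b)" if "subrep N (M_rep a b)" for N
  proof (cases "N \<subseteq> {0}")
    case True
    then show ?thesis using M_invariantD(2)[OF subrep_M_invariant[OF that]] by auto
  next
    case False
    then obtain k where "k \<in> N" "k \<noteq> 0" by auto
    note K = subrep_M_invariant[OF that]
    show ?thesis using Lam_generates_all[OF K Lam_in_invariant_typical[OF K \<open>k \<in> N\<close> \<open>k \<noteq> 0\<close> assms]] by simp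
  qed
  ultimately show ?thesis by (simp add: irreducible_rep_def M_sl21_rep)
qed

lemma quot_M_fd_rep:
  assumes "subrep N (M_rep a b)"
  shows "fd_rep (quot_rep (M_rep a b) N)"
  using rep_epi_fd_rep[OF M_fd_rep sl21_rep.quot_rep_epi[OF M_sl21_rep assms]
      sl21_rep.quot_rep_disjoint[OF M_sl21_rep assms]] .

text \<open>The preimage \<open>K\<close> of a subrepresentation is invariant: either it lies in
  \<open>N\<close> and the subrepresentation is zero, or it contains \<Lambda> and hence everything.
  Both atypical cases enter through the hypothesis \<open>max\<close>.\<close>

lemma quot_M_irreducible:
  assumes N: "subrep N (M_rep a b)" and LN: "F_pow a 0 Lam \<notin> N"
    and max: "\<And>K. M_invariant a b K \<Longrightarrow> \<not> K \<subseteq> N \<Longrightarrow> F_pow a 0 Lam \<in> K"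
  shows "irreducible_rep (quot_rep (M_rep a b) N)"
proof -
  let ?M = "M_rep a b" let ?Q = "quot_rep ?M N" let ?p = "\<lambda>x. N +>\<^bsub>?M\<^esub> x"
  interpret M: sl21_rep ?M by (rule M_sl21_rep)
  have sub: "VectorSpace.subspace \<CC> N ?M" using N by (simp add: subrep_def)
  have epi: "rep_epi ?M ?Q ?p" by (rule M.quot_rep_epi[OF N])
  then have hom: "rep_hom ?M ?Q ?p" and im: "?p ` carrier ?M = carrier ?Q" by (auto simp: rep_epi_def)
  note h = rep_homD[OF hom]
  have Q: "sl21_rep ?Q" using quot_M_fd_rep[OF N] by (simp add: fd_rep_def)
  then have vQ: "vectorspace \<CC> ?Q" by (rule sl21_rep.vectorspace)
  have ker: "?p x = \<zero>\<^bsub>?Q\<^esub> \<longleftrightarrow> x \<in> N" if x: "x \<in> carrier ?M" for x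
    using M.coset_eq_iff[OF sub x, of 0] x by (simp add: h(1)[symmetric, simplified] M_minus supported_closed)
  have Lc: "F_pow a 0 Lam \<in> carrier ?M" by (simp add: supported_F_pow)
  have "?p (F_pow a 0 Lam) \<in> carrier ?Q" "?p (F_pow a 0 Lam) \<noteq> \<zero>\<^bsub>?Q\<^esub>"
    using h(2)[OF Lc] ker[OF Lc] LN by auto
  then have "carrier ?Q \<noteq> {\<zero>\<^bsub>?Q\<^esub>}" by blast
  moreover have "P = {\<zero>\<^bsub>?Q\<^esub>} \<or> P = carrier ?Q" if P: "subrep P ?Q" for P
  proof -
    have "VectorSpace.subspace \<CC> P ?Q" and act: "\<And>g. act ?Q g ` P \<subseteq> P" using P by (auto simp: subrep_def)
    then have P': "P \<subseteq> carrier ?Q" "\<zero>\<^bsub>?Q\<^esub> \<in> P" "\<And>v w. v \<in> P \<Longrightarrow> w \<in> P \<Longrightarrow> v \<oplus>\<^bsub>?Q\<^esub> w \<in> P"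
      "\<And>c v. v \<in> P \<Longrightarrow> c \<odot>\<^bsub>?Q\<^esub> v \<in> P" by (auto simp: subspace_iff[OF vQ])
    define K where "K = {x \<in> carrier ?M. ?p x \<in> P}"
    have PK: "P = ?p ` K" using P'(1) unfolding im[symmetric] K_def by blast
    have K: "M_invariant a b K" unfolding M_invariant_def
    proof (intro conjI allI ballI)
      show "K \<subseteq> {f. supported (symbols a) f}" by (auto simp: K_def)
      show "0 \<in> K" using P'(2) h(1) by (simp add: K_def supported_closed)
      show "f + k \<in> K" if "f \<in> K" "k \<in> K" for f k
        using that P'(3) h(3)[of f k] by (simp add: K_def supported_closed)
      show "sc c f \<in> K" if "f \<in> K" for c f
        using that P'(4) h(4)[of f c] by (simp add: K_def supported_closed)
      show "M_act a b g f \<in> K" if "f \<in> K" for g f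
        using that act[of g] h(7)[of f g] by (auto simp: K_def M_act_supported)
    qed
    show ?thesis
    proof (cases "K \<subseteq> N")
      case True
      then have "P \<subseteq> {\<zero>\<^bsub>?Q\<^esub>}" unfolding PK using ker by (auto simp: K_def)
      then show ?thesis using P'(2) by auto
    next
      case False
      then have "K = carrier ?M" using Lam_generates_all[OF K max[OF K]] by simp
      then show ?thesis using PK im by simp
    qed
  qed
  ultimately show ?thesis by (simp add: irreducible_rep_def Q)
qed

lemma N1_maximal:
  assumes K: "M_invariant a 0 K" and n: "\<not> K \<subseteq> N1 a 0"
  shows "F_pow a 0 Lam \<in> K"
proof -
  obtain k where k: "k \<in> K" "k \<notin> N1 a 0" using n by blast
  then obtain x m where "k (x, m) \<noteq> 0" "x \<notin> {VLam, VFVLam}"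
    using M_invariantD(1)[OF K k(1)] unfolding M_span_eq supported_Collect_iff by auto
  then show ?thesis using Lam_in_invariant_atypical1[OF K k(1)] by blast
qed

lemma N2_maximal:
  assumes b: "b = of_nat a + 1" and K: "M_invariant a b K" and n: "\<not> K \<subseteq> N2 a b"
  shows "F_pow a 0 Lam \<in> K"
proof -
  obtain k where k: "k \<in> K" "k \<notin> N2 a b" using n by blast
  then obtain x m where "k (x, m) \<noteq> 0" "x \<notin> {Om, VFVLam}"
    using M_invariantD(1)[OF K k(1)] unfolding M_span_eq supported_Collect_iff by auto
  then show ?thesis using Lam_in_invariant_atypical2[OF b K k(1)] by blast
qed

lemma F_pow_highest_weight:
  assumes x: "(x, 0) \<in> symbols a" and U: "\<And>y n. M_coord a b gU (F_pow a 0 x) y n = 0"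
  shows "highest_weight_vector (M_rep a b) (c_wt a x) ((y_wt a b x + c_wt a x) / 2) (F_pow a 0 x)"
proof -
  note s = supported_F_pow[of a 0 x]
  have nz: "F_pow a 0 x \<noteq> 0" using x by (auto simp: pointwise F_pow_def)
  note act = M_act_coord[OF s]
  have "M_act a b gH (F_pow a 0 x) = sc (c_wt a x) (F_pow a 0 x)"
    "M_act a b gY (F_pow a 0 x) = sc (y_wt a b x) (F_pow a 0 x)"
    "M_act a b gE (F_pow a 0 x) = 0" "M_act a b gU (F_pow a 0 x) = 0"
    unfolding act using U by (auto simp: pointwise F_pow_def)
  then show ?thesis using nz s
    by (simp add: highest_weight_vector_def fvs.scale_left_distrib[symmetric])
qed

section \<open>Admissible entries\<close>

definition adm :: "nat \<Rightarrow> complex \<Rightarrow> complex \<Rightarrow> bool" where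
  "adm a b z \<longleftrightarrow> (\<exists>p q :: int. z = (of_int p + of_int q * b) / (of_nat a + 1))"

text \<open>The admissible numbers form the additive group \<open>(Z + Z b) / (a + 1)\<close>, which
  is in general not a ring; products are therefore covered only when one factor is an
  integer.\<close>

lemma adm_intros:
  "adm a b 0" "adm a b 1" "adm a b b" "adm a b (1 / (of_nat a + 1))" "adm a b (b / (of_nat a + 1))"
  "adm a b z \<Longrightarrow> adm a b w \<Longrightarrow> adm a b (z + w)" "adm a b z \<Longrightarrow> adm a b w \<Longrightarrow> adm a b (z - w)"
  "adm a b z \<Longrightarrow> adm a b (- z)" "adm a b z \<Longrightarrow> adm a b (of_nat n * z)"
proof -
  show "adm a b 0" unfolding adm_def by (rule exI[of _ 0], rule exI[of _ 0]) simp
  show "adm a b 1" unfolding adm_def by (rule exI[of _ "int a + 1"], rule exI[of _ 0]) simp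
  show "adm a b b" unfolding adm_def by (rule exI[of _ 0], rule exI[of _ "int a + 1"]) simp
  show "adm a b (1 / (of_nat a + 1))" unfolding adm_def by (rule exI[of _ 1], rule exI[of _ 0]) simp
  show "adm a b (b / (of_nat a + 1))" unfolding adm_def by (rule exI[of _ 0], rule exI[of _ 1]) simp
  show "adm a b (z + w)" if zw: "adm a b z" "adm a b w" for z w
  proof -
    obtain p q p' q' :: int where "z = (of_int p + of_int q * b) / (of_nat a + 1)"
      "w = (of_int p' + of_int q' * b) / (of_nat a + 1)" using zw unfolding adm_def by blast
    then show ?thesis unfolding adm_def
      by (intro exI[of _ "p + p'"] exI[of _ "q + q'"]) (simp add: add_divide_distrib[symmetric] algebra_simps)
  qed note add = this
  show mn: "adm a b (- z)" if zw: "adm a b z" for z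
  proof -
    obtain p q :: int where "z = (of_int p + of_int q * b) / (of_nat a + 1)" using zw unfolding adm_def by blast
    then show ?thesis unfolding adm_def
      by (intro exI[of _ "- p"] exI[of _ "- q"]) (simp add: minus_divide_left algebra_simps)
  qed
  show "adm a b (z - w)" if "adm a b z" "adm a b w" using add[OF that(1) mn[OF that(2)]] by simp
  show "adm a b (of_nat n * z)" if zw: "adm a b z"
  proof -
    obtain p q :: int where "z = (of_int p + of_int q * b) / (of_nat a + 1)" using zw unfolding adm_def by blast
    then show ?thesis unfolding adm_def
      by (intro exI[of _ "int n * p"] exI[of _ "int n * q"]) (simp add: algebra_simps)
  qed
qed

lemma M_coord_admissible:
  assumes "(y, m) \<in> symbols a"
  shows "admissible_entry a b g (M_coord a b g (F_pow a m y) x n)"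
proof -
  have Ints: "c_wt a x \<in> \<int>" "c_wt a x - 2 * of_nat n \<in> \<int>" "(of_nat n + 1) * (c_wt a x - of_nat n) \<in> \<int>"
    by (cases x; auto)+
  \<comment> \<open>The coordinates of a basis vector are \<open>0\<close> or \<open>1\<close>, so
    only the coefficients in \<open>M_coord\<close> matter.\<close>
  have zo: "F_pow a m y (z, k) = 0 \<or> F_pow a m y (z, k) = 1" for z k by (auto simp: F_pow_def)
  have zi: "F_pow a m y (z, k) \<in> \<int>" for z k using zo[of z k] by auto
  have ad: "adm a b z \<Longrightarrow> adm a b (z * F_pow a m y (w, k))" for z w k
    using zo[of w k] by (auto intro: adm_intros)
  show ?thesis
  proof (cases "g \<in> {gF, gH, gE, gY}")
    case True
    have yw: "\<exists>p q :: int. y_wt a b x = of_int p + of_int q * b"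
    proof (cases x)
      case Lam then show ?thesis by (intro exI[of _ "- int a"] exI[of _ 2]) simp
    next
      case VLam then show ?thesis by (intro exI[of _ "- int a - 1"] exI[of _ 2]) simp
    next
      case Om then show ?thesis by (intro exI[of _ "- int a - 1"] exI[of _ 2]) simp
    next
      case VFVLam then show ?thesis by (intro exI[of _ "- int a - 2"] exI[of _ 2]) simp
    qed
    have yi: "2 * b \<in> \<int> \<Longrightarrow> y_wt a b x \<in> \<int>" by (cases x) auto
    have y0: "\<exists>p q :: int. 0 = of_int p + of_int q * b" by (intro exI[of _ 0]) simp
    show ?thesis
    proof (cases "g = gY")
      case True
      then show ?thesis using zo[of x n] yw yi y0 by (elim disjE) simp_all
    next
      case False
      then show ?thesis using \<open>g \<in> {gF, gH, gE, gY}\<close> Ints zi by (auto intro!: Ints_mult)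
    qed
  next
    case False
    \<comment> \<open>These are the integer factors occurring in \<open>M_coord\<close>; the other
      factor of each product is admissible.\<close>
    have n1: "adm a b z \<Longrightarrow> adm a b ((of_nat k + 1) * z)" "adm a b z \<Longrightarrow> adm a b ((of_nat a + 1 - of_nat k) * z)"
      "adm a b z \<Longrightarrow> adm a b ((of_nat a - of_nat k) * z)" for z k
      by (simp_all add: ring_distribs adm_intros)
    have n0: "adm a b (of_nat k / (of_nat a + 1))" for k
      using adm_intros(9)[OF adm_intros(4), of a b k] by simp
    have c: "adm a b (of_nat a + 1 - b)" using adm_intros(9)[OF adm_intros(2), of a b a]
      by (intro adm_intros) simp
    have d: "adm a b (1 - of_nat n / (of_nat a + 1))" "adm a b (b / (of_nat a + 1) - 1)"
      "adm a b (- (1 / (of_nat a + 1)))"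
      by (intro adm_intros n0)+
    have d': "adm a b (- ((of_nat n + 1) / (of_nat a + 1)))"
      using adm_intros(8)[OF n0[of "n + 1"]] by (simp only: of_nat_add of_nat_1)
    have e1: "adm a b (- (of_nat n + 1) * b)"
      using n1(1)[OF adm_intros(3), THEN adm_intros(8)] by (simp only: mult_minus_left)
    have e2: "adm a b ((of_nat a + 1 - b) * (of_nat a - of_nat n))"
      using n1(3)[OF c] by (simp only: mult.commute)
    have e3: "adm a b ((b / (of_nat a + 1) - 1) * (of_nat a + 1 - of_nat n))"
      using n1(2)[OF d(2)] by (simp only: mult.commute)
    have e4: "adm a b (- (of_nat n + 1) * (b / (of_nat a + 1)))"
      using n1(1)[OF adm_intros(5), THEN adm_intros(8)] by (simp only: mult_minus_left)
    note e = e1 e2 e3 e4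
    have f3: "adm a b (F_pow a m y (z, k))" for z k
      using ad[OF adm_intros(2)] by simp
    note f = n1(1)[OF f3] n1(3)[OF f3] f3
    note d = d d'
    have i: "adm a b z \<Longrightarrow> adm a b (if P then z else 0)" for z P
      using adm_intros(1) by simp
    note I = adm_intros(1,3,5,6,7) i ad c d e f
    consider "g = gU" | "g = gV" | "g = gW" | "g = gX" using False by (cases g) auto
    then have "adm a b (M_coord a b g (F_pow a m y) x n)"
      by cases (simp; cases x; simp only: M_coord.simps; blast intro: I)+
    moreover have "admissible_entry a b g z = adm a b z" for z
      using False by (cases g) (auto simp: adm_def)
    ultimately show ?thesis by simp
  qed
qed


section \<open>Matrix entries\<close>

lemma supported_basis_vec: "supported (symbols a) (basis_vec a i)"
  by (auto simp: basis_vec_def supported_F_pow split: prod.split)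

lemma basis_vec_action_admissible:
  assumes "j \<in> symbols a"
  shows "admissible_entry a b g (M_act a b g (basis_vec a j) i)"
proof -
  obtain y m where j: "j = (y, m)" by (cases j)
  obtain x n where i: "i = (x, n)" by (cases i)
  show ?thesis using M_coord_admissible[of y m a b g x n] assms
    unfolding M_act_coord[OF supported_basis_vec] by (simp add: i j basis_vec_def)
qed

lemma M_admissible_matrices: "has_admissible_matrices a b (M_rep a b) (symbols a) (basis_vec a)"
  unfolding has_admissible_matrices_def
proof (intro conjI allI exI ballI)
  show "is_indexed_basis (M_rep a b) (symbols a) (basis_vec a)" by (rule M_indexed_basis)
  fix g
  show "is_matrix_of (M_rep a b) (symbols a) (basis_vec a) (act (M_rep a b) g)
      (\<lambda>i j. M_act a b g (basis_vec a j) i)"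
    unfolding is_matrix_of_def M_rep_sel
  proof
    fix j
    have "(\<Oplus>\<^bsub>M_rep a b\<^esub>i\<in>symbols a. sc (M_act a b g (basis_vec a j) i) (basis_vec a i))
      = (\<Sum>i\<in>symbols a. sc (M_act a b g (basis_vec a j) i) (basis_vec a i))"
      by (intro M_finsum finite_symbols supported_closed supported_basis_vec)
    then show "M_act a b g (basis_vec a j)
        = (\<Oplus>\<^bsub>M_rep a b\<^esub>i\<in>symbols a. sc (M_act a b g (basis_vec a j) i) (basis_vec a i))"
      using F_pow_expansion[OF M_act_supported[OF supported_basis_vec]] by simp
  qed
qed (rule basis_vec_action_admissible)

lemma quot_M_zero_iff:
  assumes N: "subrep N (M_rep a b)" and x: "supported (symbols a) x"
  shows "N +>\<^bsub>M_rep a b\<^esub> x = \<zero>\<^bsub>quot_rep (M_rep a b) N\<^esub> \<longleftrightarrow> x \<in> N"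
proof -
  have epi: "rep_epi (M_rep a b) (quot_rep (M_rep a b) N) (\<lambda>x. N +>\<^bsub>M_rep a b\<^esub> x)"
    by (rule sl21_rep.quot_rep_epi[OF M_sl21_rep N])
  then have z: "N +>\<^bsub>M_rep a b\<^esub> 0 = \<zero>\<^bsub>quot_rep (M_rep a b) N\<^esub>"
    using rep_homD(1)[of "M_rep a b" "quot_rep (M_rep a b) N" "\<lambda>x. N +>\<^bsub>M_rep a b\<^esub> x"] by (simp add: rep_epi_def)
  have "VectorSpace.subspace \<CC> N (M_rep a b)" using N by (simp add: subrep_def)
  then show ?thesis unfolding z[symmetric]
    using sl21_rep.coset_eq_iff[OF M_sl21_rep, of N a b x 0] x by (simp add: M_minus supported_closed)
qed

lemma quot_M_expansion:
  fixes a :: nat and b :: complex and T :: "sym set"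
  defines "N \<equiv> M_span a b T"
  assumes N: "subrep N (M_rep a b)" and f: "supported (symbols a) f"
  shows "N +>\<^bsub>M_rep a b\<^esub> f = (\<Oplus>\<^bsub>quot_rep (M_rep a b) N\<^esub>i\<in>coords a (- T).
     f i \<odot>\<^bsub>quot_rep (M_rep a b) N\<^esub> (N +>\<^bsub>M_rep a b\<^esub> basis_vec a i))"
proof -
  let ?M = "M_rep a b" let ?Q = "quot_rep ?M N" let ?p = "\<lambda>x. N +>\<^bsub>?M\<^esub> x"
  have epi: "rep_epi ?M ?Q ?p" by (rule sl21_rep.quot_rep_epi[OF M_sl21_rep N])
  then have hom: "rep_hom ?M ?Q ?p" by (simp add: rep_epi_def)
  note h = rep_homD[OF hom]
  have vQ: "vectorspace \<CC> ?Q" using quot_M_fd_rep[OF N] by (simp add: fd_rep_def sl21_rep.vectorspace)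
  have fin: "finite (coords a (- T))" using finite_symbols by simp
  have s: "supported (symbols a) (sc (f i) (basis_vec a i))" for i
    by (intro supported_closed supported_basis_vec)
  let ?f' = "\<Sum>i\<in>coords a (- T). sc (f i) (basis_vec a i)"
  define fT where "fT i = (if fst i \<in> T then f i else 0)" for i
  have un: "symbols a = coords a (- T) \<union> coords a T" by auto
  have "(\<Sum>i\<in>coords a (- T) \<union> coords a T. sc (f i) (basis_vec a i)) = ?f' + (\<Sum>i\<in>coords a T. sc (f i) (basis_vec a i))"
    using finite_symbols by (intro sum.union_disjoint) auto
  then have fe: "f = ?f' + (\<Sum>i\<in>coords a T. sc (f i) (basis_vec a i))"
    unfolding un[symmetric] by (rule trans[OF F_pow_expansion[OF f]])
  have diff: "f - ?f' = (\<Sum>i\<in>coords a T. sc (f i) (basis_vec a i))"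
    unfolding diff_eq_eq by (subst add.commute) (rule fe)
  have "supported (coords a T) (sc (f i) (basis_vec a i))" if "i \<in> coords a T" for i
    using that by (auto simp: supported_def sc_apply basis_vec_def F_pow_def split: prod.split)
  then have "supported (coords a T) (f - ?f')" unfolding diff by (rule supported_closed(6))
  then have fN: "f - ?f' \<in> N" by (simp only: N_def M_span_eq mem_Collect_eq)
  have f': "supported (symbols a) ?f'" using s by (rule supported_closed(6))
  have "VectorSpace.subspace \<CC> N ?M" using N by (simp only: subrep_def)
  then have "?p f = ?p ?f' \<longleftrightarrow> f \<ominus>\<^bsub>?M\<^esub> ?f' \<in> N"
    by (rule sl21_rep.coset_eq_iff[OF M_sl21_rep]) (use f f' in simp_all)
  then have "?p f = ?p ?f'" using fN unfolding M_minus(2)[OF f' f] by (simp only:)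
  also have "?f' = (\<Oplus>\<^bsub>?M\<^esub>i\<in>coords a (- T). sc (f i) (basis_vec a i))"
    using s fin by (intro M_finsum[symmetric])
  also have "?p \<dots> = (\<Oplus>\<^bsub>?Q\<^esub>i\<in>coords a (- T). ?p (sc (f i) (basis_vec a i)))"
    using s by (intro rep_hom_finsum[OF M_vectorspace vQ hom fin]) auto
  also have "(\<lambda>i. ?p (sc (f i) (basis_vec a i))) = (\<lambda>i. f i \<odot>\<^bsub>?Q\<^esub> ?p (basis_vec a i))"
    using h(4)[of "basis_vec a _"] supported_basis_vec by simp
  finally show ?thesis .
qed

text \<open>The matrices on the quotient are those on \<open>M(a,b)\<close> with the rows and
  columns of the strings in \<open>T\<close> deleted, so their entries need no new
  computation.\<close>

lemma quot_M_admissible_matrices: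
  fixes a :: nat and b :: complex and T :: "sym set"
  defines "N \<equiv> M_span a b T"
  assumes N: "subrep N (M_rep a b)"
  shows "has_admissible_matrices a b (quot_rep (M_rep a b) N) (coords a (- T))
     (\<lambda>i. N +>\<^bsub>M_rep a b\<^esub> basis_vec a i)"
  unfolding has_admissible_matrices_def
proof (intro conjI allI exI ballI)
  let ?M = "M_rep a b" let ?Q = "quot_rep ?M N" let ?p = "\<lambda>x. N +>\<^bsub>?M\<^esub> x" let ?I = "coords a (- T)"
  have epi: "rep_epi ?M ?Q ?p" by (rule sl21_rep.quot_rep_epi[OF M_sl21_rep N])
  then have hom: "rep_hom ?M ?Q ?p" and im: "?p ` carrier ?M = carrier ?Q" by (simp_all add: rep_epi_def)
  note h = rep_homD[OF hom]
  note exp = quot_M_expansion[of a b T, folded N_def, OF N]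
  have vQ: "vectorspace \<CC> ?Q" using quot_M_fd_rep[OF N] by (simp add: fd_rep_def sl21_rep.vectorspace)
  interpret Q: vectorspace \<CC> ?Q by (rule vQ)
  have fin: "finite ?I" using finite_symbols by simp
  have bc: "basis_vec a i \<in> carrier ?M" for i by (simp add: supported_basis_vec)
  show "is_indexed_basis ?Q ?I (\<lambda>i. ?p (basis_vec a i))"
  proof (rule indexed_basisI[OF vQ fin])
    show "?p (basis_vec a i) \<in> carrier ?Q" for i by (rule h(2)[OF bc])
    show "\<exists>c. v = (\<Oplus>\<^bsub>?Q\<^esub>i\<in>?I. c i \<odot>\<^bsub>?Q\<^esub> ?p (basis_vec a i))" if v: "v \<in> carrier ?Q" for v
    proof -
      obtain f where "f \<in> carrier ?M" "v = ?p f" using v unfolding im[symmetric] by (rule imageE) auto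
      then show ?thesis using exp[of f] by auto
    qed
    fix c i assume z: "(\<Oplus>\<^bsub>?Q\<^esub>i\<in>?I. c i \<odot>\<^bsub>?Q\<^esub> ?p (basis_vec a i)) = \<zero>\<^bsub>?Q\<^esub>" and i: "i \<in> ?I"
    \<comment> \<open>Lifts the relation to a vector with no component on the strings in
      \<open>T\<close>. Its coset is zero, so it also lies in their span, and it must
      vanish.\<close>
    define f where "f j = (if j \<in> ?I then c j else 0)" for j
    have f: "supported (symbols a) f" by (auto simp: supported_def f_def)
    have "(\<Oplus>\<^bsub>?Q\<^esub>i\<in>?I. c i \<odot>\<^bsub>?Q\<^esub> ?p (basis_vec a i)) = (\<Oplus>\<^bsub>?Q\<^esub>i\<in>?I. f i \<odot>\<^bsub>?Q\<^esub> ?p (basis_vec a i))"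
      using h(2)[OF bc] Q.smult_closed by (intro Q.finsum_cong') (auto simp: f_def)
    then have "?p f = \<zero>\<^bsub>?Q\<^esub>" using exp[OF f] z by simp
    then have "f \<in> N" using quot_M_zero_iff[OF N f] by simp
    then have "supported (coords a T) f" by (simp only: N_def M_span_eq mem_Collect_eq)
    then have "f i = 0" unfolding supported_def using i by blast
    then show "c i = 0" using i by (simp add: f_def)
  qed
  fix g
  show "is_matrix_of ?Q ?I (\<lambda>i. ?p (basis_vec a i)) (act ?Q g) (\<lambda>i j. M_act a b g (basis_vec a j) i)"
    unfolding is_matrix_of_def
  proof
    fix j
    have "act ?Q g (?p (basis_vec a j)) = ?p (M_act a b g (basis_vec a j))"
      using h(7)[OF bc, of g j] by simp
    then show "act ?Q g (?p (basis_vec a j)) = (\<Oplus>\<^bsub>?Q\<^esub>i\<in>?I. M_act a b g (basis_vec a j) i \<odot>\<^bsub>?Q\<^esub> ?p (basis_vec a i))"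
      using exp[OF M_act_supported[OF supported_basis_vec]] by simp
  qed
qed (use basis_vec_action_admissible in auto)


section \<open>Coordinates on a finite dimensional representation\<close>

text \<open>The coordinates are indexed by the basis vectors themselves: \<open>\<iota>\<close>
  forms the linear combination over a basis \<open>B\<close>, and \<open>\<kappa>\<close> returns
  the coefficients that vanish off \<open>B\<close>.\<close>

lemma coordinates_exist:
  fixes S :: "(complex, 'v, 'm) module_scheme"
  assumes V: "vectorspace \<CC> S" and fd: "vectorspace.fin_dim \<CC> S"
  shows "\<exists>(B :: 'v set) \<iota> \<kappa>. finite B \<and> (\<forall>f. \<iota> f \<in> carrier S) \<and> (\<forall>f h. \<iota> (f + h) = \<iota> f \<oplus>\<^bsub>S\<^esub> \<iota> h) \<and>
     (\<forall>c f. \<iota> (sc c f) = c \<odot>\<^bsub>S\<^esub> \<iota> f) \<and> (\<forall>v\<in>carrier S. \<iota> (\<kappa> v) = v) \<and> (\<forall>v. supported B (\<kappa> v)) \<and>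
     (\<forall>f. supported B f \<longrightarrow> \<kappa> (\<iota> f) = f)"
proof -
  interpret V: vectorspace \<CC> S by fact
  obtain B where B: "finite B" "V.basis B" using V.finite_basis_exists[OF fd] by blast
  then have Bc: "B \<subseteq> carrier S" and li: "V.lin_indpt B" and gen: "V.gen_set B" by (auto simp: V.basis_def)
  define \<iota> where "\<iota> f = V.lincomb f B" for f
  have sm: "c \<odot>\<^bsub>S\<^esub> v \<in> carrier S" if "v \<in> B" for c v using V.smult_closed[of c v] that Bc by auto
  have add: "\<iota> (f + h) = \<iota> f \<oplus>\<^bsub>S\<^esub> \<iota> h" for f h
  proof -
    have "\<iota> (f + h) = (\<Oplus>\<^bsub>S\<^esub>v\<in>B. f v \<odot>\<^bsub>S\<^esub> v \<oplus>\<^bsub>S\<^esub> h v \<odot>\<^bsub>S\<^esub> v)"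
      unfolding \<iota>_def V.lincomb_def using Bc sm V.smult_l_distr
      by (intro V.finsum_cong') (auto simp: plus_fun_apply)
    also have "\<dots> = \<iota> f \<oplus>\<^bsub>S\<^esub> \<iota> h" unfolding \<iota>_def V.lincomb_def using sm by (intro V.finsum_addf) auto
    finally show ?thesis .
  qed
  have scl: "\<iota> (sc c f) = c \<odot>\<^bsub>S\<^esub> \<iota> f" for c f
    unfolding \<iota>_def using V.lincomb_smult[OF Bc, of f c] by (simp add: sc_def)
  have car: "\<iota> f \<in> carrier S" for f unfolding \<iota>_def using Bc by auto
  have inj: "f = h" if "supported B f" "supported B h" "\<iota> f = \<iota> h" for f h
  proof -
    have "\<iota> (f + sc (-1) h) = \<iota> h \<oplus>\<^bsub>S\<^esub> (-1) \<odot>\<^bsub>S\<^esub> \<iota> h" by (simp only: add scl that(3))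
    also have "\<dots> = (1 + - 1) \<odot>\<^bsub>S\<^esub> \<iota> h" using V.smult_l_distr[of 1 "-1" "\<iota> h"] V.smult_one[OF car] car by simp
    also have "\<dots> = \<zero>\<^bsub>S\<^esub>" using V.smult_l_null[OF car] by simp
    finally have z: "V.lincomb (f + sc (-1) h) B = \<zero>\<^bsub>S\<^esub>" by (simp only: \<iota>_def)
    have "(f + sc (-1) h) \<in> B \<rightarrow> {\<zero>\<^bsub>\<CC>\<^esub>}"
      by (rule V.not_lindepD[OF li B(1) subset_refl _ z]) auto
    then have "f v = h v" if "v \<in> B" for v using that by (auto simp: pointwise Pi_iff)
    then have "f x = h x" for x using that(1,2) by (cases "x \<in> B") (simp_all add: supported_def)
    then show ?thesis by (rule ext)
  qed
  have sur: "\<exists>f. supported B f \<and> \<iota> f = v" if v: "v \<in> carrier S" for v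
  proof -
    obtain f where f: "V.lincomb f B = v"
      using V.finite_in_span[OF B(1) Bc, of v] gen v by auto
    let ?g = "\<lambda>i. if i \<in> B then f i else 0"
    have "V.lincomb ?g B = V.lincomb f B" by (rule V.lincomb_cong[OF refl Bc]) auto
    then show ?thesis using f by (intro exI[of _ ?g]) (auto simp: supported_def \<iota>_def)
  qed
  \<comment> \<open>The value \<open>0\<close> off the carrier makes \<open>\<kappa> v\<close>
    supported on \<open>B\<close> for every \<open>v\<close>.\<close>
  define \<kappa> where "\<kappa> v = (if v \<in> carrier S then SOME f. supported B f \<and> \<iota> f = v else 0)" for v
  have k: "supported B (\<kappa> v) \<and> \<iota> (\<kappa> v) = v" if "v \<in> carrier S" for v
    using someI_ex[OF sur[OF that]] that by (simp add: \<kappa>_def)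
  have k': "supported B (\<kappa> v)" for v using k[of v] by (cases "v \<in> carrier S") (auto simp: \<kappa>_def supported_closed)
  have "\<kappa> (\<iota> f) = f" if "supported B f" for f using inj[OF k' that] k[OF car] by blast
  then show ?thesis using B(1) car add scl k k'
    by (intro exI[of _ B] exI[of _ \<iota>] exI[of _ \<kappa>]) simp
qed

text \<open>\<open>\<iota>\<close> is defined on all functions and factors through those supported on the basis \<open>B\<close>.
  Hence the transported operators satisfy the relations on every function, without side conditions.\<close>

locale rep_coordinates = sl21_rep S for S :: "'v superrep" (structure) +
  fixes B :: "'v set" and \<iota> :: "('v \<Rightarrow> complex) \<Rightarrow> 'v" and \<kappa> :: "'v \<Rightarrow> 'v \<Rightarrow> complex"
  assumes finite_B: "finite B" and iota_carrier [simp]: "\<iota> f \<in> carrier S"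
    and iota_add: "\<iota> (f + h) = \<iota> f \<oplus> \<iota> h" and iota_scale: "\<iota> (sc c f) = c \<odot> \<iota> f"
    and iota_kappa: "v \<in> carrier S \<Longrightarrow> \<iota> (\<kappa> v) = v" and kappa_supported: "supported B (\<kappa> v)"
    and kappa_iota: "supported B f \<Longrightarrow> \<kappa> (\<iota> f) = f"
begin

definition A :: "gen \<Rightarrow> ('v \<Rightarrow> complex) \<Rightarrow> 'v \<Rightarrow> complex" where
  "A g f = \<kappa> (act S g (\<iota> f))"

lemma kappa_unique: "supported B f \<Longrightarrow> \<iota> f = v \<Longrightarrow> \<kappa> v = f"
  using kappa_iota by auto

lemma kappa_add: "v \<in> carrier S \<Longrightarrow> w \<in> carrier S \<Longrightarrow> \<kappa> (v \<oplus> w) = \<kappa> v + \<kappa> w"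
  by (intro kappa_unique supported_closed kappa_supported) (simp add: iota_add iota_kappa)

lemma kappa_scale: "v \<in> carrier S \<Longrightarrow> \<kappa> (c \<odot> v) = sc c (\<kappa> v)"
  by (intro kappa_unique supported_closed kappa_supported) (simp add: iota_scale iota_kappa)

lemma kappa_minus: "v \<in> carrier S \<Longrightarrow> \<kappa> (\<ominus> v) = - \<kappa> v"
  by (simp add: minus_eq_smult kappa_scale)

lemma kappa_diff: "v \<in> carrier S \<Longrightarrow> w \<in> carrier S \<Longrightarrow> \<kappa> (v \<ominus> w) = \<kappa> v - \<kappa> w"
  by (simp add: a_minus_def kappa_add kappa_minus)

lemma iota_zero: "\<iota> 0 = \<zero>"
  using iota_scale[of 0 0] by simp

lemma kappa_zero: "\<kappa> \<zero> = 0"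
  using kappa_iota[of 0] by (simp add: supported_closed iota_zero)

lemma iota_A: "\<iota> (A g f) = act S g (\<iota> f)"
  by (simp add: A_def iota_kappa)

lemma A_linear: "fun_linear (A g)"
  by (simp add: fun_linear_def A_def iota_add iota_scale act_add act_smult kappa_add kappa_scale)

lemma A_comm: "A g (A h f) - A h (A g f) = \<kappa> (comm S g h (\<iota> f))"
  by (simp add: comm_def kappa_diff A_def iota_kappa)

lemma A_acomm: "A g (A h f) + A h (A g f) = \<kappa> (acomm S g h (\<iota> f))"
  by (simp add: acomm_def kappa_add A_def iota_kappa)

lemma A_op_rep: "op_rep A B"
proof -
  note C = A_comm[where f = f for f] and D = A_acomm[where f = f for f]
  note E = even_even[OF iota_carrier] H_odd[OF iota_carrier] Y_odd[OF iota_carrier]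
    EF_odd[OF iota_carrier] odd_odd[OF iota_carrier]
  note K = kappa_add kappa_scale kappa_minus kappa_diff kappa_zero A_def[symmetric]
  have move: "x - y = z \<longleftrightarrow> x = y + z" "x + y = z \<longleftrightarrow> x = z - y" for x y z :: "'v \<Rightarrow> complex"
    by (auto simp: algebra_simps)
  \<comment> \<open>Turns \<open>{Z,Z} = 0\<close>, which says \<open>2 Z Z = 0\<close>, into
    \<open>Z Z = 0\<close>.\<close>
  have double: "x + x = 0 \<longleftrightarrow> x = 0" for x :: "'v \<Rightarrow> complex"
    by (auto simp: pointwise)
  note C' = A_comm[unfolded move(1)] and D' = A_acomm[unfolded move(2)]
  have sq: "A g (A g f) = 0" if "acomm S g g (\<iota> f) = \<zero>" for g f
    by (rule double[THEN iffD1]) (simp only: A_acomm that kappa_zero)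
  show ?thesis
  proof (rule op_rep.intro)
    fix f
    show "A gH (A gE f) = A gE (A gH f) + sc 2 (A gE f)" unfolding C'[of gH gE f] by (simp add: E K)
    show "A gH (A gF f) = A gF (A gH f) - sc 2 (A gF f)" unfolding C'[of gH gF f] by (simp add: E K)
    show "A gE (A gF f) = A gF (A gE f) + A gH f" unfolding C'[of gE gF f] by (simp add: E K)
    show "A gY (A gE f) = A gE (A gY f)" unfolding C'[of gY gE f] by (simp add: E K)
    show "A gY (A gF f) = A gF (A gY f)" unfolding C'[of gY gF f] by (simp add: E K)
    show "A gY (A gH f) = A gH (A gY f)" unfolding C'[of gY gH f] by (simp add: E K)
    show "A gH (A gU f) = A gU (A gH f) - A gU f" unfolding C'[of gH gU f] by (simp add: E K)
    show "A gH (A gW f) = A gW (A gH f) + A gW f" unfolding C'[of gH gW f] by (simp add: E K)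
    show "A gH (A gV f) = A gV (A gH f) + A gV f" unfolding C'[of gH gV f] by (simp add: E K)
    show "A gY (A gU f) = A gU (A gY f) + A gU f" unfolding C'[of gY gU f] by (simp add: E K)
    show "A gY (A gW f) = A gW (A gY f) + A gW f" unfolding C'[of gY gW f] by (simp add: E K)
    show "A gY (A gV f) = A gV (A gY f) - A gV f" unfolding C'[of gY gV f] by (simp add: E K)
    show "A gE (A gU f) = A gU (A gE f) + A gW f" unfolding C'[of gE gU f] by (simp add: E K)
    show "A gE (A gV f) = A gV (A gE f)" unfolding C'[of gE gV f] by (simp add: E K)
    show "A gE (A gW f) = A gW (A gE f)" unfolding C'[of gE gW f] by (simp add: E K)
    show "A gF (A gU f) = A gU (A gF f)" unfolding C'[of gF gU f] by (simp add: E K)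
    show "A gF (A gX f) = A gX (A gF f)" unfolding C'[of gF gX f] by (simp add: E K)
    show "A gF (A gV f) = A gV (A gF f) - A gX f" unfolding C'[of gF gV f] by (simp add: E K)
    show "A gU (A gV f) = sc (1/2) (A gY f + A gH f) - A gV (A gU f)" unfolding D'[of gU gV f] by (simp add: E K)
    show "A gU (A gW f) = - A gW (A gU f)" unfolding D'[of gU gW f] by (simp add: E K)
    show "A gX (A gV f) = - A gV (A gX f)" unfolding D'[of gX gV f] by (simp add: E K)
  qed (use finite_B A_linear kappa_supported sq E in \<open>auto simp: A_def[of _ _]\<close>)
qed

end


section \<open>Classification\<close>

context rep_coordinates
begin

lemma even_pullback_subspace: "fvs.subspace {f. \<iota> f \<in> even_part S}"
  and odd_pullback_subspace: "fvs.subspace {f. \<iota> f \<in> odd_part S}"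
  using evenD oddD unfolding fvs.subspace_def by (auto simp: iota_zero iota_add iota_scale)

lemma A_parity:
  "g \<in> even_gens \<Longrightarrow> \<iota> f \<in> even_part S \<Longrightarrow> \<iota> (A g f) \<in> even_part S"
  "g \<in> even_gens \<Longrightarrow> \<iota> f \<in> odd_part S \<Longrightarrow> \<iota> (A g f) \<in> odd_part S"
  "g \<in> odd_gens \<Longrightarrow> \<iota> f \<in> even_part S \<Longrightarrow> \<iota> (A g f) \<in> odd_part S"
  "g \<in> odd_gens \<Longrightarrow> \<iota> f \<in> odd_part S \<Longrightarrow> \<iota> (A g f) \<in> even_part S"
  unfolding iota_A
  using even_gen_even[of g] even_gen_odd[of g] odd_gen_even[of g] odd_gen_odd[of g] by blast+

text \<open>Start from a nonzero homogeneous component of any nonzero vector. \<open>U\<close> and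
  \<open>W\<close> exchange the parities, so homogeneity is kept but not the parity itself.\<close>

lemma highest_weight_vector_exists:
  assumes nz: "carrier S \<noteq> {\<zero>}"
  shows "\<exists>L c y. (\<iota> L \<in> even_part S \<or> \<iota> L \<in> odd_part S) \<and> L \<noteq> 0 \<and> supported B L \<and>
     A gE L = 0 \<and> A gU L = 0 \<and> A gH L = sc c L \<and> A gY L = sc y L"
proof -
  interpret op: op_rep A B by (rule A_op_rep)
  let ?P = "{f. \<iota> f \<in> even_part S}" and ?Q = "{f. \<iota> f \<in> odd_part S}"
  obtain v where v: "v \<in> carrier S" "v \<noteq> \<zero>" using nz by auto
  obtain e u where eu: "e \<in> even_part S" "u \<in> odd_part S" "v = e \<oplus> u" using even_odd_decompose[OF v(1)] .
  have "e \<noteq> \<zero> \<or> u \<noteq> \<zero>" using eu(3) v(2) by auto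
  then obtain x where x: "x \<in> even_part S \<or> x \<in> odd_part S" "x \<noteq> \<zero>" using eu by blast
  have xc: "x \<in> carrier S" using x even_carrier odd_carrier by auto
  have k: "\<kappa> x \<in> ?P \<union> ?Q" "\<kappa> x \<noteq> 0" "supported B (\<kappa> x)"
    using x iota_kappa[OF xc] iota_zero kappa_supported by auto
  have "\<exists>w. w \<in> ?P \<union> ?Q \<and> w \<noteq> 0 \<and> supported B w \<and> A gU w = 0 \<and> A gW w = 0"
    by (rule op.killed_vector_exists[OF k]) (auto intro: A_parity simp: odd_gens_def)
  then obtain w where w: "w \<in> ?P \<union> ?Q" "w \<noteq> 0" "supported B w" "A gU w = 0" "A gW w = 0" by blast
  have ev: "A g f \<in> ?P" if "g \<in> {gE, gH, gY}" "f \<in> ?P" for g f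
    using that A_parity(1)[of g f] by (auto simp: even_gens_def)
  have od: "A g f \<in> ?Q" if "g \<in> {gE, gH, gY}" "f \<in> ?Q" for g f
    using that A_parity(2)[of g f] by (auto simp: even_gens_def)
  from w(1) show ?thesis
  proof
    assume "w \<in> ?P"
    from op.highest_weight_exists[OF even_pullback_subspace ev this w(2-5)] show ?thesis by blast
  next
    assume "w \<in> ?Q"
    from op.highest_weight_exists[OF odd_pullback_subspace od this w(2-5)] show ?thesis by blast
  qed
qed

text \<open>Each symbol \<open>F^n x\<close> is sent to \<open>op.s n x\<close>. The formulas
  derived from the relations coincide with those defining the action on \<open>M(a,b)\<close>, and
  the cases of \<open>W\<close> and \<open>X\<close> follow because these are commutators.\<close>

lemma highest_weight_hom:
  assumes hw: "op_hw A B L a b" and ev: "\<iota> L \<in> even_part S"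
  shows "\<exists>p. rep_hom (M_rep a b) S p \<and> p (F_pow a 0 Lam) = \<iota> L"
proof -
  interpret op: op_hw A B L a b by (rule hw)
  define \<phi> where "\<phi> f = (\<Sum>i\<in>symbols a. sc (f i) (op.s (snd i) (fst i)))" for f :: mvec
  have lin: "fun_linear \<phi>"
    by (simp add: fun_linear_def \<phi>_def fvs.scale_sum_right sum.distrib fvs.scale_left_distrib plus_fun_apply sc_apply)
  note l = fun_linearD[OF lin]
  \<comment> \<open>Validity beyond the symbols matters: \<open>F\<close> and the other operators
    refer to the index after the end of a string, where both sides vanish.\<close>
  have \<phi>F: "\<phi> (F_pow a n x) = op.s n x" for n x
  proof (cases "(x, n) \<in> symbols a")
    case True
    have "\<phi> (F_pow a n x) = (\<Sum>i\<in>symbols a. if i = (x, n) then op.s n x else 0)"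
      unfolding \<phi>_def by (rule sum.cong) (auto simp: F_pow_def)
    then show ?thesis using True finite_symbols by simp
  next
    case False
    then show ?thesis using op.s_zero[OF False] by (simp add: F_pow_outside l)
  qed
  have ext: "\<phi> (lin_ext a T f) = A g (\<phi> f)" if "\<And>n x. \<phi> (T n x) = A g (op.s n x)" for T g f
    unfolding lin_ext_sum by (simp add: l fun_linearD[OF A_linear] that) (simp add: \<phi>_def fun_linearD[OF A_linear])
  have base: "\<phi> (M_act a b gF f) = A gF (\<phi> f)" "\<phi> (M_act a b gE f) = A gE (\<phi> f)"
    "\<phi> (M_act a b gH f) = A gH (\<phi> f)" "\<phi> (M_act a b gY f) = A gY (\<phi> f)"
    "\<phi> (M_act a b gU f) = A gU (\<phi> f)" "\<phi> (M_act a b gV f) = A gV (\<phi> f)" for f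
  proof -
    show "\<phi> (M_act a b gF f) = A gF (\<phi> f)" unfolding M_act.simps
      by (rule ext) (simp add: F_basis_def \<phi>F op.F_s)
    show "\<phi> (M_act a b gE f) = A gE (\<phi> f)" unfolding M_act.simps
      by (rule ext) (simp add: E_basis_def vec_ops \<phi>F l op.E_s)
    show "\<phi> (M_act a b gH f) = A gH (\<phi> f)" unfolding M_act.simps
      by (rule ext) (simp add: H_basis_def vec_ops \<phi>F l op.H_s)
    show "\<phi> (M_act a b gY f) = A gY (\<phi> f)" unfolding M_act.simps
      by (rule ext) (simp add: Y_basis_def vec_ops \<phi>F l op.Y_s)
    show "\<phi> (M_act a b gU f) = A gU (\<phi> f)" unfolding M_act.simps
    proof (rule ext)
      fix n x show "\<phi> (U_basis a b n x) = A gU (op.s n x)"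
        by (cases x) (simp_all only: U_basis.simps vec_ops \<phi>F l op.U_s_Lam op.U_s_VLam op.U_s_Om op.U_s_VFVLam)
    qed
    show "\<phi> (M_act a b gV f) = A gV (\<phi> f)" unfolding M_act.simps
    proof (rule ext)
      fix n x show "\<phi> (V_basis a n x) = A gV (op.s n x)"
        by (cases x) (simp_all only: V_basis.simps vec_ops \<phi>F l op.V_s_Lam op.V_s_VLam op.V_s_Om op.V_s_VFVLam)
    qed
  qed
  have \<phi>act: "\<phi> (M_act a b g f) = A g (\<phi> f)" for g f
  proof (cases g)
    case gW
    have "M_act a b gW f = M_act a b gE (M_act a b gU f) - M_act a b gU (M_act a b gE f)"
      by (simp add: M_act.simps op_bracket_def vec_ops)
    then show ?thesis using gW by (simp add: l base op.EU)
  next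
    case gX
    have "M_act a b gX f = M_act a b gV (M_act a b gF f) - M_act a b gF (M_act a b gV f)"
      by (simp add: M_act.simps op_bracket_def vec_ops)
    then show ?thesis using gX by (simp add: l base op.FV)
  qed (simp_all add: base)
  have F: "gF \<in> even_gens" "gV \<in> odd_gens" by (simp_all add: even_gens_def odd_gens_def)
  have pow: "\<iota> x \<in> even_part S \<Longrightarrow> \<iota> ((A gF ^^ n) x) \<in> even_part S"
    "\<iota> x \<in> odd_part S \<Longrightarrow> \<iota> ((A gF ^^ n) x) \<in> odd_part S" for n x
    by (induct n) (simp_all add: A_parity F)
  have VL: "\<iota> (A gV L) \<in> odd_part S" using A_parity(3)[OF F(2) ev] .
  have "\<iota> (op.base Om) \<in> odd_part S"
    using fvs.subspace_diff[OF odd_pullback_subspace] fvs.subspace_scale[OF odd_pullback_subspace]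
      A_parity(2)[OF F(1) VL] A_parity(3)[OF F(2) A_parity(1)[OF F(1) ev]] by simp
  moreover have "\<iota> (op.base VFVLam) \<in> even_part S"
    using A_parity(4)[OF F(2) A_parity(2)[OF F(1) VL]] by simp
  ultimately have s: "x \<in> {Lam, VFVLam} \<Longrightarrow> \<iota> (op.s n x) \<in> even_part S"
    "x \<in> {VLam, Om} \<Longrightarrow> \<iota> (op.s n x) \<in> odd_part S" for n x
    unfolding op.s_def using ev VL by (auto intro!: pow simp del: op.base.simps(3,4))
  define p where "p f = \<iota> (\<phi> f)" for f
  have "p f \<in> even_part S" if f: "f \<in> even_part (M_rep a b)" for f
  proof -
    have "sc (f i) (op.s (snd i) (fst i)) \<in> {f. \<iota> f \<in> even_part S}" for i
    proof (cases "fst i \<in> {Lam, VFVLam}")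
      case True
      then show ?thesis using fvs.subspace_scale[OF even_pullback_subspace] s(1) by blast
    next
      case False
      then have "f i = 0" using f unfolding M_rep_sel mem_Collect_eq supported_def by blast
      then show ?thesis using fvs.subspace_0[OF even_pullback_subspace] by simp
    qed
    then have "\<phi> f \<in> {f. \<iota> f \<in> even_part S}" unfolding \<phi>_def
      by (rule fvs.subspace_sum[OF even_pullback_subspace])
    then show ?thesis by (simp add: p_def)
  qed
  moreover have "p f \<in> odd_part S" if f: "f \<in> odd_part (M_rep a b)" for f
  proof -
    have "sc (f i) (op.s (snd i) (fst i)) \<in> {f. \<iota> f \<in> odd_part S}" for i
    proof (cases "fst i \<in> {VLam, Om}")
      case True
      then show ?thesis using fvs.subspace_scale[OF odd_pullback_subspace] s(2) by blast
    next
      case False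
      then have "f i = 0" using f unfolding M_rep_sel mem_Collect_eq supported_def by blast
      then show ?thesis using fvs.subspace_0[OF odd_pullback_subspace] by simp
    qed
    then have "\<phi> f \<in> {f. \<iota> f \<in> odd_part S}" unfolding \<phi>_def
      by (rule fvs.subspace_sum[OF odd_pullback_subspace])
    then show ?thesis by (simp add: p_def)
  qed
  ultimately have "rep_hom (M_rep a b) S p"
    unfolding rep_hom_def by (auto simp: p_def l iota_zero iota_add iota_scale \<phi>act iota_A simp del: M_rep_sel(5,6))
  moreover have "p (F_pow a 0 Lam) = \<iota> L" by (simp add: p_def \<phi>F op.s_def)
  ultimately show ?thesis by blast
qed

end

lemma rep_epi_id: "rep_epi R R (\<lambda>x. x)"
  by (simp add: rep_epi_def rep_hom_def)

lemma rep_hom_kernel_invariant: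
  assumes S: "sl21_rep S" and p: "rep_hom (M_rep a b) S p"
  shows "M_invariant a b {f. supported (symbols a) f \<and> p f = \<zero>\<^bsub>S\<^esub>}"
proof -
  interpret S: sl21_rep S by fact
  note h = rep_homD[OF p]
  have sm: "c \<odot>\<^bsub>S\<^esub> \<zero>\<^bsub>S\<^esub> = \<zero>\<^bsub>S\<^esub>" for c using S.smult_r_null[of c] by simp
  have act: "act S g \<zero>\<^bsub>S\<^esub> = \<zero>\<^bsub>S\<^esub>" for g using S.act_smult[of "\<zero>\<^bsub>S\<^esub>" g 0] by simp
  show ?thesis unfolding M_invariant_def
    using h(1) h(3)[simplified] h(4)[simplified] h(7)[simplified]
    by (auto simp: supported_closed M_act_supported sm act)
qed

lemma irreducible_quotient_classification:
  assumes S: "irreducible_rep S" and p: "rep_hom (M_rep a b) S p" and L: "p (F_pow a 0 Lam) \<noteq> \<zero>\<^bsub>S\<^esub>"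
  shows "b * (b - of_nat a - 1) \<noteq> 0 \<Longrightarrow> S \<cong>\<^sub>r M_rep a b"
    "b = 0 \<Longrightarrow> S \<cong>\<^sub>r quot_rep (M_rep a b) (N1 a b)"
    "b = of_nat a + 1 \<Longrightarrow> S \<cong>\<^sub>r quot_rep (M_rep a b) (N2 a b)"
proof -
  let ?M = "M_rep a b"
  have sS: "sl21_rep S" using S by (simp add: irreducible_rep_def)
  interpret S: sl21_rep S by (rule sS)
  interpret M: sl21_rep ?M by (rule M_sl21_rep)
  note h = rep_homD[OF p]
  have simple: "N = {\<zero>\<^bsub>S\<^esub>} \<or> N = carrier S" if "subrep N S" for N
    using S that by (simp add: irreducible_rep_def)
  have Lc: "F_pow a 0 Lam \<in> carrier ?M" by (simp add: supported_F_pow)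
  have "p ` carrier ?M \<noteq> {\<zero>\<^bsub>S\<^esub>}" using L Lc by blast
  then have sur: "p ` carrier ?M = carrier S"
    using simple[OF rep_hom_image_subrep[OF M_sl21_rep sS p carrier_subrep[OF M_sl21_rep]]] by blast
  have epi: "rep_epi ?M S p" by (rule rep_hom_surj_epi[OF M_sl21_rep sS p sur])
  define K where "K = {f. supported (symbols a) f \<and> p f = \<zero>\<^bsub>S\<^esub>}"
  have K: "M_invariant a b K" unfolding K_def by (rule rep_hom_kernel_invariant[OF sS p])
  have LK: "F_pow a 0 Lam \<notin> K" using L by (simp add: K_def)
  have peq: "p f = p k \<longleftrightarrow> f - k \<in> K" if "f \<in> carrier ?M" "k \<in> carrier ?M" for f k
  proof -
    have "p (f - k) = p f \<ominus>\<^bsub>S\<^esub> p k"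
      using rep_hom_minus(2)[OF M.vectorspace S.vectorspace p that] that by (simp add: M_minus)
    moreover have "p f \<ominus>\<^bsub>S\<^esub> p k = \<zero>\<^bsub>S\<^esub> \<longleftrightarrow> p f = p k"
    proof
      assume z: "p f \<ominus>\<^bsub>S\<^esub> p k = \<zero>\<^bsub>S\<^esub>"
      have "p f = (p f \<ominus>\<^bsub>S\<^esub> p k) \<oplus>\<^bsub>S\<^esub> p k" using h(2)[OF that(1)] h(2)[OF that(2)]
        by (simp add: a_minus_def S.a_assoc S.l_neg)
      then show "p f = p k" using z h(2)[OF that(2)] by simp
    qed (use h(2)[OF that(2)] in \<open>simp add: a_minus_def S.r_neg\<close>)
    ultimately show ?thesis using that by (auto simp: K_def supported_closed)
  qed
  show "S \<cong>\<^sub>r M_rep a b" if "b * (b - of_nat a - 1) \<noteq> 0"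
  proof (rule rep_iso_common_kernel[OF epi rep_epi_id M_sl21_rep])
    have b: "b \<noteq> 0" "b \<noteq> of_nat a + 1" using that by auto
    fix f k assume fk: "f \<in> carrier ?M" "k \<in> carrier ?M"
    show "p f = p k \<longleftrightarrow> f = k"
      using peq[OF fk] Lam_in_invariant_typical[OF K _ _ b, of "f - k"] LK by auto
  qed
  have quot: "S \<cong>\<^sub>r quot_rep ?M N" if N: "subrep N ?M" and KN: "K \<subseteq> N" and LN: "F_pow a 0 Lam \<notin> N" for N
  proof -
    have sub: "VectorSpace.subspace \<CC> N ?M" using N by (simp only: subrep_def)
    note NI = subrep_M_invariant[OF N]
    \<comment> \<open>Otherwise some \<open>n\<close> in \<open>N\<close> has the same image as
      \<Lambda>, so \<open>n - \<Lambda>\<close> lies in \<open>K\<close>, hence in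
      \<open>N\<close>, and so does \<Lambda>. Thus the image of \<open>N\<close> is a proper
      subrepresentation of the irreducible \<open>S\<close> and must be zero.\<close>
    have "p ` N \<noteq> carrier S"
    proof
      assume "p ` N = carrier S"
      then obtain n where n: "n \<in> N" "p n = p (F_pow a 0 Lam)" using h(2)[OF Lc] by (metis imageE)
      then have "n - F_pow a 0 Lam \<in> K" using peq[of n "F_pow a 0 Lam"] Lc M_invariantD(1)[OF NI n(1)] by simp
      then have "n - F_pow a 0 Lam \<in> N" using KN by (rule rev_subsetD)
      from M_invariantD(6)[OF NI n(1) this] show False using LN by simp
    qed
    then have "p ` N = {\<zero>\<^bsub>S\<^esub>}" using simple[OF rep_hom_image_subrep[OF M_sl21_rep sS p N]] by blast
    then have "N \<subseteq> K" using M_invariantD(1)[OF NI] by (auto simp: K_def)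
    then have KN': "K = N" using KN by simp
    show ?thesis
    proof (rule rep_iso_common_kernel[OF epi M.quot_rep_epi[OF N] M_sl21_rep])
      fix f k assume fk: "f \<in> carrier ?M" "k \<in> carrier ?M"
      show "p f = p k \<longleftrightarrow> N +>\<^bsub>?M\<^esub> f = N +>\<^bsub>?M\<^esub> k"
        using peq[OF fk] M.coset_eq_iff[OF sub fk] fk by (simp add: KN' M_minus)
    qed
  qed
  show "S \<cong>\<^sub>r quot_rep ?M (N1 a b)" if b: "b = 0"
  proof (rule quot)
    show "subrep (N1 a b) ?M" using N1_subrep b by simp
    show "K \<subseteq> N1 a b" using N1_maximal[of a K] K LK b by auto
    show "F_pow a 0 Lam \<notin> N1 a b" by (rule Lam_notin_M_span) simp
  qed
  show "S \<cong>\<^sub>r quot_rep ?M (N2 a b)" if b: "b = of_nat a + 1"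
  proof (rule quot)
    show "subrep (N2 a b) ?M" by (rule N2_subrep[OF b])
    show "K \<subseteq> N2 a b" using N2_maximal[OF b K] LK by auto
    show "F_pow a 0 Lam \<notin> N2 a b" by (rule Lam_notin_M_span) simp
  qed
qed

section \<open>Parity shift\<close>

lemma parity_shift_sel [simp]:
  "carrier (parity_shift S) = carrier S" "add (parity_shift S) = add S" "zero (parity_shift S) = zero S"
  "module.smult (parity_shift S) = module.smult S" "act (parity_shift S) = act S"
  "even_part (parity_shift S) = odd_part S" "odd_part (parity_shift S) = even_part S"
  by (simp_all add: parity_shift_def)

lemma parity_shift_rep_iso: "parity_shift S \<cong>\<^sub>r R \<Longrightarrow> S \<cong>\<^sub>r parity_shift R"
  unfolding rep_iso_def LinearCombinations.module_hom_def by auto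

lemma parity_shift_a_inv: "\<ominus>\<^bsub>parity_shift S\<^esub> x = \<ominus>\<^bsub>S\<^esub> x" "x \<ominus>\<^bsub>parity_shift S\<^esub> y = x \<ominus>\<^bsub>S\<^esub> y"
  by (simp_all add: a_minus_def a_inv_def)

lemma parity_shift_vectorspace: "vectorspace \<CC> (parity_shift S) \<longleftrightarrow> vectorspace \<CC> S"
  by (simp add: vectorspace_def Module.module_def module_axioms_def abelian_group_def
      abelian_group_axioms_def abelian_monoid_def)

lemma parity_shift_set_add:
  assumes "vectorspace \<CC> S" "A \<subseteq> carrier S" "B \<subseteq> carrier S"
  shows "A <+>\<^bsub>parity_shift S\<^esub> B = B <+>\<^bsub>S\<^esub> A"
proof -
  interpret vectorspace \<CC> S by fact
  show ?thesis using assms(2,3) a_comm unfolding set_add_def' by (auto simp: subset_iff) blast+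
qed

lemma parity_shift_sl21_rep:
  assumes "sl21_rep S" shows "sl21_rep (parity_shift S)"
proof -
  interpret S: sl21_rep S by fact
  have vs: "vectorspace \<CC> (parity_shift S)" using S.vectorspace by (simp add: parity_shift_vectorspace)
  have c: "comm (parity_shift S) = comm S" "acomm (parity_shift S) = acomm S"
    by (simp_all add: fun_eq_iff comm_def acomm_def parity_shift_a_inv)
  show ?thesis
  proof (rule sl21_rep.intro)
    show "VectorSpace.subspace \<CC> (even_part (parity_shift S)) (parity_shift S)"
      "VectorSpace.subspace \<CC> (odd_part (parity_shift S)) (parity_shift S)"
      using S.evenD S.oddD unfolding subspace_iff[OF vs] by simp_all
    show "even_part (parity_shift S) <+>\<^bsub>parity_shift S\<^esub> odd_part (parity_shift S) = carrier (parity_shift S)"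
      using S.evenD S.oddD by (simp add: parity_shift_set_add[OF S.vectorspace] S.even_odd_sum)
    show "even_part (parity_shift S) \<inter> odd_part (parity_shift S) = {\<zero>\<^bsub>parity_shift S\<^esub>}"
      using S.even_odd_disjoint by (simp add: Int_commute)
    show "act (parity_shift S) g \<in> LinearCombinations.module_hom \<CC> (parity_shift S) (parity_shift S)" for g
      using S.act_linear[of g] by (simp add: LinearCombinations.module_hom_def)
  qed (simp_all add: vs S.even_gen_even S.even_gen_odd S.odd_gen_even S.odd_gen_odd c parity_shift_a_inv
      S.even_even S.H_odd S.Y_odd S.EF_odd S.odd_odd)
qed

lemma parity_shift_irreducible_rep:
  assumes "irreducible_rep S" shows "irreducible_rep (parity_shift S)"
proof -
  have sS: "sl21_rep S" using assms by (simp add: irreducible_rep_def)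
  interpret S: sl21_rep S by (rule sS)
  have vs: "vectorspace \<CC> (parity_shift S)" using S.vectorspace by (simp add: parity_shift_vectorspace)
  have "subrep N S" if N: "subrep N (parity_shift S)" for N
  proof -
    have "N \<inter> even_part S \<subseteq> carrier S" "N \<inter> odd_part S \<subseteq> carrier S" using S.evenD S.oddD by auto
    then have "N \<inter> odd_part S <+>\<^bsub>parity_shift S\<^esub> N \<inter> even_part S = N \<inter> even_part S <+>\<^bsub>S\<^esub> N \<inter> odd_part S"
      by (intro parity_shift_set_add[OF S.vectorspace])
    note N' = N[unfolded subrep_def subspace_iff[OF vs] parity_shift_sel this]
    show ?thesis unfolding subrep_def subspace_iff[OF S.vectorspace] by (rule N')
  qed
  then show ?thesis using assms parity_shift_sl21_rep[OF sS] by (simp add: irreducible_rep_def)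
qed

lemma is_R_cases:
  assumes "b * (b - of_nat a - 1) \<noteq> 0 \<Longrightarrow> S \<cong>\<^sub>r M_rep a b \<or> S \<cong>\<^sub>r parity_shift (M_rep a b)"
    and "b = 0 \<Longrightarrow> S \<cong>\<^sub>r quot_rep (M_rep a b) (N1 a b) \<or> S \<cong>\<^sub>r parity_shift (quot_rep (M_rep a b) (N1 a b))"
    and "b = of_nat a + 1 \<Longrightarrow>
      S \<cong>\<^sub>r quot_rep (M_rep a b) (N2 a b) \<or> S \<cong>\<^sub>r parity_shift (quot_rep (M_rep a b) (N2 a b))"
  shows "is_R a b S"
proof -
  consider "b * (b - of_nat a - 1) \<noteq> 0" | "b = 0" | "b = of_nat a + 1"
    by (auto simp: diff_eq_eq add.commute)
  then show ?thesis
  proof cases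
    case 1
    from conjI[OF 1 assms(1)[OF 1]] show ?thesis unfolding is_R_def rep_iso_upto_parity_def by (rule disjI1)
  next
    case 2
    from conjI[OF 2 assms(2)[OF 2]] show ?thesis unfolding is_R_def rep_iso_upto_parity_def by (rule disjI2[OF disjI1])
  next
    case 3
    from conjI[OF 3 assms(3)[OF 3]] show ?thesis unfolding is_R_def rep_iso_upto_parity_def by (rule disjI2[OF disjI2])
  qed
qed

lemma irreducible_rep_is_R:
  fixes S :: "'v superrep"
  assumes fd: "fd_rep S" and irr: "irreducible_rep S"
  shows "\<exists>a b. is_R a b S"
proof -
  have sS: "sl21_rep S" and fin: "vectorspace.fin_dim \<CC> S" using fd by (auto simp: fd_rep_def)
  obtain B \<iota> \<kappa> where co: "rep_coordinates S (B :: 'v set) \<iota> \<kappa>"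
    using coordinates_exist[OF sl21_rep.vectorspace[OF sS] fin] sS
    unfolding rep_coordinates_def rep_coordinates_axioms_def by blast
  interpret C: rep_coordinates S B \<iota> \<kappa> by (rule co)
  interpret op: op_rep C.A B by (rule C.A_op_rep)
  have "carrier S \<noteq> {\<zero>\<^bsub>S\<^esub>}" using irr by (simp add: irreducible_rep_def)
  then obtain L c y where L: "\<iota> L \<in> even_part S \<or> \<iota> L \<in> odd_part S" "L \<noteq> 0" "supported B L"
    "C.A gE L = 0" "C.A gU L = 0" "C.A gH L = sc c L" "C.A gY L = sc y L"
    using C.highest_weight_vector_exists by blast
  obtain a where a: "c = of_nat a" using op.string_end[OF L(2,3,4,6)] by blast
  \<comment> \<open>The eigenvalue of \<open>(Y + H) / 2\<close> on the highest weight
    vector.\<close>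
  define b where "b = (c + y) / 2"
  then have yb: "y = 2 * b - of_nat a" by (simp add: a field_simps)
  have hw: "op_hw C.A B L a b"
    by (rule op_hw.intro[OF C.A_op_rep], unfold_locales) (use L yb in \<open>simp_all add: a\<close>)
  have L0: "\<iota> L \<noteq> \<zero>\<^bsub>S\<^esub>" using C.kappa_iota[OF L(3)] C.kappa_zero L(2) by auto
  show ?thesis using L(1)
  proof
    assume "\<iota> L \<in> even_part S"
    then obtain p where "rep_hom (M_rep a b) S p" "p (F_pow a 0 Lam) \<noteq> \<zero>\<^bsub>S\<^esub>"
      using C.highest_weight_hom[OF hw] L0 by auto
    note cl = irreducible_quotient_classification[OF irr this]
    have "is_R a b S"
      unfolding rep_iso_upto_parity_def by (rule is_R_cases; rule disjI1; rule cl)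
    then show ?thesis by blast
  next
    assume od: "\<iota> L \<in> odd_part S"
    let ?S = "parity_shift S"
    have irr': "irreducible_rep ?S" by (rule parity_shift_irreducible_rep[OF irr])
    have co': "rep_coordinates ?S B \<iota> \<kappa>"
      using co parity_shift_sl21_rep[OF sS] unfolding rep_coordinates_def rep_coordinates_axioms_def by simp
    \<comment> \<open>The shift changes only the grading, so the transported operators are literally
      the same and \<open>hw\<close> applies to the shifted representation, in which the highest
      weight vector is even.\<close>
    have A: "rep_coordinates.A ?S \<iota> \<kappa> = C.A"
      unfolding rep_coordinates.A_def[OF co'] C.A_def by simp
    obtain p where "rep_hom (M_rep a b) ?S p" "p (F_pow a 0 Lam) \<noteq> \<zero>\<^bsub>?S\<^esub>"
      using rep_coordinates.highest_weight_hom[OF co', unfolded A, OF hw] od L0 by auto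
    note cl = irreducible_quotient_classification[OF irr' this, THEN parity_shift_rep_iso]
    have "is_R a b S"
      unfolding rep_iso_upto_parity_def by (rule is_R_cases; rule disjI2; rule cl)
    then show ?thesis by blast
  qed
qed


section \<open>Highest weight vectors of \<open>M(a,b)\<close> and assembly of the
  statements\<close>

lemma Lam_highest_weight:
  "highest_weight_vector (M_rep a b) (of_nat a) b (F_pow a 0 Lam)"
proof -
  have "M_coord a b gU (F_pow a 0 Lam) y n = 0" for y n by (cases y) (auto simp: F_pow_def)
  from F_pow_highest_weight[OF _ this] show ?thesis by (simp add: symbols_def)
qed

lemma VLam_highest_weight:
  "highest_weight_vector (M_rep a 0) (of_nat a + 1) 0 (F_pow a 0 VLam)"
proof -
  have "M_coord a 0 gU (F_pow a 0 VLam) y n = 0" for y n by (cases y) (auto simp: F_pow_def)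
  from F_pow_highest_weight[OF _ this] show ?thesis by (simp add: symbols_def)
qed

text \<open>For \<open>a = 0\<close> there is no symbol \<omega>, hence the bound on
  \<open>a\<close>.\<close>

lemma Om_highest_weight:
  assumes "a \<ge> 1" "b = of_nat a + 1"
  shows "highest_weight_vector (M_rep a b) (of_nat a - 1) ((2 * b - of_nat a - 1 + (of_nat a - 1)) / 2) (F_pow a 0 Om)"
proof -
  have "M_coord a b gU (F_pow a 0 Om) y n = 0" for y n using assms by (cases y) (auto simp: F_pow_def)
  from F_pow_highest_weight[OF _ this] show ?thesis using assms by (simp add: symbols_def)
qed

lemma Om_formula_M_rep:
  "F_pow a 0 Om = of_nat a \<odot>\<^bsub>M_rep a b\<^esub> act (M_rep a b) gF (act (M_rep a b) gV (F_pow a 0 Lam))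
     \<ominus>\<^bsub>M_rep a b\<^esub> (of_nat a + 1) \<odot>\<^bsub>M_rep a b\<^esub> act (M_rep a b) gV (act (M_rep a b) gF (F_pow a 0 Lam))"
proof -
  have "supported (symbols a) (sc c (M_act a b g (M_act a b h (F_pow a 0 Lam))))" for c g h
    by (intro supported_closed M_act_supported supported_F_pow)
  then show ?thesis using Om_formula[of a b] by (simp only: M_rep_sel M_minus)
qed

lemma coords_complement:
  "coords a (- {VLam, VFVLam}) = {(x, n) \<in> symbols a. x \<in> {Lam, Om}}"
  "coords a (- {Om, VFVLam}) = {(x, n) \<in> symbols a. x \<in> {Lam, VLam}}"
proof -
  have "x \<in> - {VLam, VFVLam} \<longleftrightarrow> x \<in> {Lam, Om}" "x \<in> - {Om, VFVLam} \<longleftrightarrow> x \<in> {Lam, VLam}" for x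
    by (cases x; simp)+
  note 1 = this
  show "coords a (- {VLam, VFVLam}) = {(x, n) \<in> symbols a. x \<in> {Lam, Om}}"
    "coords a (- {Om, VFVLam}) = {(x, n) \<in> symbols a. x \<in> {Lam, VLam}}"
    unfolding 1 by auto
qed

theorem mainTheorem4:
  fixes a :: nat and b :: complex and S :: "'v superrep"
  shows
    "vectorspace.dim \<CC> (M_rep a b) = 4 * (a + 1) \<and>
     is_indexed_basis (M_rep a b) (symbols a) (basis_vec a) \<and>
     fd_rep (M_rep a b) \<and>
     highest_weight_vector (M_rep a b) (of_nat a) b (F_pow a 0 Lam) \<and>
     F_pow a 0 Om =
       of_nat a \<odot>\<^bsub>M_rep a b\<^esub> act (M_rep a b) gF (act (M_rep a b) gV (F_pow a 0 Lam))
       \<ominus>\<^bsub>M_rep a b\<^esub>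
       (of_nat a + 1) \<odot>\<^bsub>M_rep a b\<^esub> act (M_rep a b) gV (act (M_rep a b) gF (F_pow a 0 Lam)) \<and>
     (b * (b - of_nat a - 1) \<noteq> 0 \<longrightarrow> irreducible_rep (M_rep a b)) \<and>
     (b = 0 \<longrightarrow>
       (\<exists>c d. highest_weight_vector (M_rep a b) c d (F_pow a 0 VLam)) \<and>
       subrep (N1 a b) (M_rep a b) \<and>
       fd_rep (quot_rep (M_rep a b) (N1 a b)) \<and>
       irreducible_rep (quot_rep (M_rep a b) (N1 a b))) \<and>
     (b = of_nat a + 1 \<longrightarrow>
       (a \<ge> 1 \<longrightarrow> (\<exists>c d. highest_weight_vector (M_rep a b) c d (F_pow a 0 Om))) \<and>
       subrep (N2 a b) (M_rep a b) \<and>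
       fd_rep (quot_rep (M_rep a b) (N2 a b)) \<and>
       irreducible_rep (quot_rep (M_rep a b) (N2 a b))) \<and>
     (fd_rep S \<and> irreducible_rep S \<longrightarrow> (\<exists>a' b'. is_R a' b' S)) \<and>
     has_admissible_matrices a b (M_rep a b) (symbols a) (basis_vec a) \<and>
     (b = 0 \<longrightarrow>
       has_admissible_matrices a b (quot_rep (M_rep a b) (N1 a b))
         {(x, n) \<in> symbols a. x \<in> {Lam, Om}}
         (\<lambda>i. N1 a b +>\<^bsub>M_rep a b\<^esub> basis_vec a i)) \<and>
     (b = of_nat a + 1 \<longrightarrow>
       has_admissible_matrices a b (quot_rep (M_rep a b) (N2 a b))
         {(x, n) \<in> symbols a. x \<in> {Lam, VLam}}
         (\<lambda>i. N2 a b +>\<^bsub>M_rep a b\<^esub> basis_vec a i))"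
proof (intro conjI impI)
  show "vectorspace.dim \<CC> (M_rep a b) = 4 * (a + 1)" by (rule M_dim)
  show "is_indexed_basis (M_rep a b) (symbols a) (basis_vec a)" by (rule M_indexed_basis)
  show "fd_rep (M_rep a b)" by (rule M_fd_rep)
  show "highest_weight_vector (M_rep a b) (of_nat a) b (F_pow a 0 Lam)" by (rule Lam_highest_weight)
  show "F_pow a 0 Om = of_nat a \<odot>\<^bsub>M_rep a b\<^esub> act (M_rep a b) gF (act (M_rep a b) gV (F_pow a 0 Lam))
     \<ominus>\<^bsub>M_rep a b\<^esub> (of_nat a + 1) \<odot>\<^bsub>M_rep a b\<^esub> act (M_rep a b) gV (act (M_rep a b) gF (F_pow a 0 Lam))"
    by (rule Om_formula_M_rep)
  show "irreducible_rep (M_rep a b)" if "b * (b - of_nat a - 1) \<noteq> 0"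
    using that by (intro M_irreducible) auto
  show "\<exists>a b. is_R a b S" if "fd_rep S \<and> irreducible_rep S"
    using that irreducible_rep_is_R by blast
  show "has_admissible_matrices a b (M_rep a b) (symbols a) (basis_vec a)" by (rule M_admissible_matrices)
next
  assume b: "b = 0"
  then have N: "subrep (N1 a b) (M_rep a b)" using N1_subrep by simp
  show "\<exists>c d. highest_weight_vector (M_rep a b) c d (F_pow a 0 VLam)" using VLam_highest_weight b by blast
  show "subrep (N1 a b) (M_rep a b)" by (rule N)
  show "fd_rep (quot_rep (M_rep a b) (N1 a b))" by (rule quot_M_fd_rep[OF N])
  show "irreducible_rep (quot_rep (M_rep a b) (N1 a b))"
    using b by (intro quot_M_irreducible[OF N] Lam_notin_M_span) (auto intro: N1_maximal)
  show "has_admissible_matrices a b (quot_rep (M_rep a b) (N1 a b))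
      {(x, n) \<in> symbols a. x \<in> {Lam, Om}} (\<lambda>i. N1 a b +>\<^bsub>M_rep a b\<^esub> basis_vec a i)"
    using quot_M_admissible_matrices[OF N] unfolding coords_complement .
next
  assume b: "b = of_nat a + 1"
  then have N: "subrep (N2 a b) (M_rep a b)" by (rule N2_subrep)
  show "\<exists>c d. highest_weight_vector (M_rep a b) c d (F_pow a 0 Om)" if "a \<ge> 1"
    using Om_highest_weight[OF that b] by blast
  show "subrep (N2 a b) (M_rep a b)" by (rule N)
  show "fd_rep (quot_rep (M_rep a b) (N2 a b))" by (rule quot_M_fd_rep[OF N])
  show "irreducible_rep (quot_rep (M_rep a b) (N2 a b))"
    using N2_maximal[OF b] by (intro quot_M_irreducible[OF N] Lam_notin_M_span) auto
  show "has_admissible_matrices a b (quot_rep (M_rep a b) (N2 a b))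
      {(x, n) \<in> symbols a. x \<in> {Lam, VLam}} (\<lambda>i. N2 a b +>\<^bsub>M_rep a b\<^esub> basis_vec a i)"
    using quot_M_admissible_matrices[OF N] unfolding coords_complement .
qed

end
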